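(* Let $f:\mathbb{R}^n\to\mathbb{R}$ and $g:\mathbb{R}^n\to\mathbb{R}^m$ be convex and differentiable ($g$ componentwise convex), and let $\mathcal{X}=\mathbb{R}^n$. Assume that the problem of minimizing $f(x)$ subject to $g(x)\le 0$, $x\in\mathcal{X}$, has an optimizer and that Slater's condition holds. Assume that there is a primal-dual solution $z^\star=(x^\star,\mu^\star)$ of this problem that satisfies strict complementary slackness, i.e., for all $i=1,\dots,m$: $g_i(x^\star)=0\Rightarrow \mu_i^\star>0$, and fix such a $z^\star$. Let $\rho>0$, let $$\mathcal{M}_{z^\star}:=\operatorname{cl}\{z\in\mathcal{Z}\mid \langle z-z^\star,[F(z)]^z_{\mathcal{Z}}\rangle=0\},$$ and let $\Omega$ be the largest invariant subset of $\mathcal{M}_{z^\star}$ for the projected saddle flow $\dot z=[F(z)]^z_{\mathcal{Z}}$. Then $\Omega$ is equal to the set of equilibria of the projected saddle flow. Furthermore, all trajectories of the projected saddle flow converge asymptotically to the set of primal-dual solutions of the optimization problem.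
   Context: Notation: $\langle\cdot,\cdot\rangle$ and $\|\cdot\|$ are the Euclidean inner product and norm, $\operatorname{cl}$ denotes closure, $\mathbb{R}^m_{\ge0}$ is the set of vectors with nonnegative entries, and inequalities and $\max$ between vectors are componentwise. $\nabla g(x)$ is the $n\times m$ matrix whose $i$-th column is the gradient $\nabla g_i(x)$. Tangent cone, normal cone, projection: for a closed convex set $\mathcal{C}\subseteq\mathbb{R}^k$ and $x\in\mathcal{C}$, $T_x\mathcal{C}:=\operatorname{cl}\{v\in\mathbb{R}^k\mid\exists\lambda>0:\ x+\lambda v\in\mathcal{C}\}$ and $N_x\mathcal{C}:=\{\eta\mid\langle v,\eta\rangle\le0\ \forall v\in T_x\mathcal{C}\}$. For $v\in\mathbb{R}^k$, $[v]^x_{\mathcal{C}}:=\arg\min_{w\in T_x\mathcal{C}}\|v-w\|^2$ is the projection of $v$ onto $T_x\mathcal{C}$. Optimization problem: minimize $f(x)$ subject to $g(x)\le0$, $x\in\mathcal{X}$. Slater's condition: there is $\bar x\in\mathcal{X}$ with $g_i(\bar x)<0$ for all $i$. A (primal-dual) solution is a pair $(x^\star,\mu^\star)$ with $x^\star\in\mathcal{X}$, $g(x^\star)\le0$, $\mu^\star\in\mathbb{R}^m_{\ge0}$, $\nabla f(x^\star)+\nabla g(x^\star)\mu^\star\in-N_{x^\star}\mathcal{X}$, and for all $i$: $\mu_i^\star>0\Rightarrow g_i(x^\star)=0$. Saddle flow: $\mathcal{Z}:=\mathcal{X}\times\mathbb{R}^m_{\ge0}$, $z=(x,\mu)\in\mathcal{Z}$,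 and for the augmentation parameter $\rho\ge0$ the augmented partial Lagrangian is $L(x,\mu)=f(x)+\mu^Tg(x)+\tfrac{\rho}{2}\|\max\{0,g(x)\}\|^2$. Set $F(z):=(-\nabla_xL(x,\mu),\ \nabla_\mu L(x,\mu))=\big(-\nabla f(x)-\nabla g(x)(\mu+\rho\max\{0,g(x)\}),\ g(x)\big)$. The projected saddle flow is $\dot z=[F(z)]^z_{\mathcal{Z}}$. A (complete Carathéodory) solution or trajectory is an absolutely continuous $z:[0,\infty)\to\mathcal{Z}$ satisfying this equation for almost every $t\ge0$. An equilibrium is a point $z$ with $[F(z)]^z_{\mathcal{Z}}=0$. A set $S\subseteq\mathcal{Z}$ is invariant if every trajectory starting in $S$ remains in $S$ for all $t\ge0$. Convergence to a set means that the distance to the set tends to $0$ as $t\to\infty$. *)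

theory Defs
  imports "HOL-Analysis.Analysis"
begin

definition tangent_cone :: "'a::euclidean_space set \<Rightarrow> 'a \<Rightarrow> 'a set" where
  "tangent_cone C x = closure {v. \<exists>c>0. x + c *\<^sub>R v \<in> C}"

definition normal_cone :: "'a::euclidean_space set \<Rightarrow> 'a \<Rightarrow> 'a set" where
  "normal_cone C x = {\<eta>. \<forall>v\<in>tangent_cone C x. v \<bullet> \<eta> \<le> 0}"

definition tangent_proj :: "'a::euclidean_space set \<Rightarrow> 'a \<Rightarrow> 'a \<Rightarrow> 'a" where
  "tangent_proj C x v = arg_min_on (\<lambda>w. (norm (v - w))\<^sup>2) (tangent_cone C x)"

lemma tangent_proj_eq_closest_point:
  "tangent_proj C x v = closest_point (tangent_cone C x) v"
proof -
  have "((norm (v - y))\<^sup>2 < (norm (v - w))\<^sup>2) \<longleftrightarrow> \<not> dist v w \<le> dist v y" for w y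
    by (auto simp: dist_norm not_le intro: power_strict_mono dest: power_less_imp_less_base)
  then show ?thesis
    unfolding tangent_proj_def arg_min_on_def arg_min_def is_arg_min_def closest_point_def
    by (intro arg_cong[where f = Eps] ext) auto
qed

text \<open>The value of \<open>gradient f x\<close> is meaningful only where \<open>f\<close> is differentiable.\<close>

definition gradient :: "('a::euclidean_space \<Rightarrow> real) \<Rightarrow> 'a \<Rightarrow> 'a" where
  "gradient f x = (THE D. GDERIV f x :> D)"

text \<open>The transposed Jacobian: column \<open>i\<close> is the gradient of the \<open>i\<close>-th component.\<close>

definition grad_matrix :: "(real^'n \<Rightarrow> real^'m) \<Rightarrow> real^'n \<Rightarrow> real^'m^'n" where
  "grad_matrix g x = (\<chi> j i. gradient (\<lambda>y. g y $ i) x $ j)"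

text \<open>The order on \<^typ>\<open>real^'m\<close> is the componentwise one, so \<open>g x \<le> 0\<close> and \<open>0 \<le> \<mu>\<close>
  below are systems of \<open>m\<close> scalar inequalities.\<close>

definition is_optimizer ::
  "(real^'n) set \<Rightarrow> (real^'n \<Rightarrow> real) \<Rightarrow> (real^'n \<Rightarrow> real^'m) \<Rightarrow> real^'n \<Rightarrow> bool" where
  "is_optimizer X f g x \<longleftrightarrow> is_arg_min f (\<lambda>y. y \<in> X \<and> g y \<le> 0) x"

definition slater :: "(real^'n) set \<Rightarrow> (real^'n \<Rightarrow> real^'m) \<Rightarrow> bool" where
  "slater X g \<longleftrightarrow> (\<exists>x\<in>X. \<forall>i. g x $ i < 0)"

definition primal_dual_solutions ::
  "(real^'n) set \<Rightarrow> (real^'n \<Rightarrow> real) \<Rightarrow> (real^'n \<Rightarrow> real^'m) \<Rightarrow> ((real^'n) \<times> (real^'m)) set" where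
  "primal_dual_solutions X f g =
    {(x, \<mu>). x \<in> X \<and> g x \<le> 0 \<and> 0 \<le> \<mu>
       \<and> gradient f x + grad_matrix g x *v \<mu> \<in> uminus ` normal_cone X x
       \<and> (\<forall>i. \<mu> $ i > 0 \<longrightarrow> g x $ i = 0)}"

definition strictly_complementary ::
  "(real^'n \<Rightarrow> real^'m) \<Rightarrow> (real^'n) \<times> (real^'m) \<Rightarrow> bool" where
  "strictly_complementary g z \<longleftrightarrow> (\<forall>i. g (fst z) $ i = 0 \<longrightarrow> snd z $ i > 0)"

definition pos_part :: "real^'m \<Rightarrow> real^'m" where
  "pos_part y = (\<chi> i. max 0 (y $ i))"

definition aug_lagrangian ::
  "(real^'n \<Rightarrow> real) \<Rightarrow> (real^'n \<Rightarrow> real^'m) \<Rightarrow> real \<Rightarrow> real^'n \<Rightarrow> real^'m \<Rightarrow> real" where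
  "aug_lagrangian f g \<rho> x \<mu> = f x + \<mu> \<bullet> g x + \<rho> / 2 * (norm (pos_part (g x)))\<^sup>2"

definition saddle_domain :: "(real^'n) set \<Rightarrow> ((real^'n) \<times> (real^'m)) set" where
  "saddle_domain X = X \<times> {\<mu>. 0 \<le> \<mu>}"

definition saddle_field ::
  "(real^'n \<Rightarrow> real) \<Rightarrow> (real^'n \<Rightarrow> real^'m) \<Rightarrow> real \<Rightarrow> (real^'n) \<times> (real^'m) \<Rightarrow> (real^'n) \<times> (real^'m)" where
  "saddle_field f g \<rho> z =
    (- gradient (\<lambda>x. aug_lagrangian f g \<rho> x (snd z)) (fst z),
     gradient (\<lambda>\<mu>. aug_lagrangian f g \<rho> (fst z) \<mu>) (snd z))"

definition projected_field ::
  "'a::euclidean_space set \<Rightarrow> ('a \<Rightarrow> 'a) \<Rightarrow> 'a \<Rightarrow> 'a" where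
  "projected_field Z F z = tangent_proj Z z (F z)"

text \<open>Degenerate intervals with \<open>a k = b k\<close> are harmless: they contribute zero to both sums.\<close>

definition abs_continuous_on :: "real set \<Rightarrow> (real \<Rightarrow> 'a::metric_space) \<Rightarrow> bool" where
  "abs_continuous_on I z \<longleftrightarrow>
    (\<forall>\<epsilon>>0. \<exists>\<delta>>0. \<forall>(N::nat) a b.
       (\<forall>k<N. a k \<le> b k \<and> {a k..b k} \<subseteq> I)
       \<and> disjoint_family_on (\<lambda>k. {a k<..<b k}) {..<N}
       \<and> (\<Sum>k<N. b k - a k) < \<delta>
       \<longrightarrow> (\<Sum>k<N. dist (z (a k)) (z (b k))) < \<epsilon>)"

text \<open>Complete Caratheodory solutions of the projected system. On the unbounded time axis,
  absolute continuity is understood, as usual, on every compact interval. Only the values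
  \<open>z t\<close> with \<open>t \<ge> 0\<close> matter.\<close>

definition trajectory ::
  "'a::euclidean_space set \<Rightarrow> ('a \<Rightarrow> 'a) \<Rightarrow> (real \<Rightarrow> 'a) \<Rightarrow> bool" where
  "trajectory Z F z \<longleftrightarrow>
    (\<forall>T\<ge>0. abs_continuous_on {0..T} z) \<and> (\<forall>t\<ge>0. z t \<in> Z)
    \<and> (AE t in lebesgue. t \<ge> 0 \<longrightarrow>
         (z has_vector_derivative projected_field Z F (z t)) (at t within {0..}))"

definition equilibria :: "'a::euclidean_space set \<Rightarrow> ('a \<Rightarrow> 'a) \<Rightarrow> 'a set" where
  "equilibria Z F = {z\<in>Z. projected_field Z F z = 0}"

definition invariant_set :: "'a::euclidean_space set \<Rightarrow> ('a \<Rightarrow> 'a) \<Rightarrow> 'a set \<Rightarrow> bool" where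
  "invariant_set Z F S \<longleftrightarrow>
    S \<subseteq> Z \<and> (\<forall>z. trajectory Z F z \<longrightarrow> z 0 \<in> S \<longrightarrow> (\<forall>t\<ge>0. z t \<in> S))"

definition largest_invariant_subset ::
  "'a::euclidean_space set \<Rightarrow> ('a \<Rightarrow> 'a) \<Rightarrow> 'a set \<Rightarrow> 'a set" where
  "largest_invariant_subset Z F A = \<Union>{S. S \<subseteq> A \<and> invariant_set Z F S}"

lemma largest_invariant_subset_iff:
  "S = largest_invariant_subset Z F A \<longleftrightarrow>
    S \<subseteq> A \<and> invariant_set Z F S \<and> (\<forall>S'. S' \<subseteq> A \<and> invariant_set Z F S' \<longrightarrow> S' \<subseteq> S)"
proof -
  have "invariant_set Z F (largest_invariant_subset Z F A)"
    unfolding invariant_set_def largest_invariant_subset_def by blast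
  moreover have "largest_invariant_subset Z F A \<subseteq> A"
    by (auto simp: largest_invariant_subset_def)
  moreover have "S' \<subseteq> largest_invariant_subset Z F A" if "S' \<subseteq> A" "invariant_set Z F S'" for S'
    using that by (auto simp: largest_invariant_subset_def)
  ultimately show ?thesis by (metis subset_antisym)
qed

definition stationary_set ::
  "'a::euclidean_space set \<Rightarrow> ('a \<Rightarrow> 'a) \<Rightarrow> 'a \<Rightarrow> 'a set" where
  "stationary_set Z F zs = closure {z\<in>Z. (z - zs) \<bullet> projected_field Z F z = 0}"

lemma gradient_eqI: "GDERIV f x :> D \<Longrightarrow> gradient f x = D"
  unfolding gradient_def
proof (rule the_equality)
  fix D' assume "GDERIV f x :> D" "GDERIV f x :> D'"
  then have "(\<lambda>h. h \<bullet> D) = (\<lambda>h. h \<bullet> D')"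
    unfolding gderiv_def by (rule has_derivative_unique)
  then have "\<forall>h. h \<bullet> D = h \<bullet> D'" by (simp add: fun_eq_iff)
  then show "D' = D" unfolding vector_eq_ldot by simp
qed

lemma GDERIV_gradient:
  assumes "f differentiable (at x)"
  shows "GDERIV f x :> gradient f x"
proof -
  obtain f' where f': "(f has_derivative f') (at x)"
    using assms by (auto simp: differentiable_def)
  then interpret bounded_linear f' by (rule has_derivative_bounded_linear)
  have "f' = (\<lambda>h. h \<bullet> (\<Sum>b\<in>Basis. f' b *\<^sub>R b))"
  proof
    fix h
    have "f' h = f' (\<Sum>b\<in>Basis. (h \<bullet> b) *\<^sub>R b)" by (simp add: euclidean_representation)
    also have "\<dots> = h \<bullet> (\<Sum>b\<in>Basis. f' b *\<^sub>R b)"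
      by (simp add: sum scaleR inner_sum_right mult.commute)
    finally show "f' h = h \<bullet> (\<Sum>b\<in>Basis. f' b *\<^sub>R b)" .
  qed
  with f' have "GDERIV f x :> (\<Sum>b\<in>Basis. f' b *\<^sub>R b)" by (metis gderiv_def)
  then show ?thesis using gradient_eqI by metis
qed

lemma DERIV_max_square: "((\<lambda>t::real. (max 0 t)\<^sup>2) has_real_derivative 2 * max 0 t) (at t)"
proof -
  consider "t > 0" | "t < 0" | "t = 0" by linarith
  then show ?thesis
  proof cases
    case 1
    have "((\<lambda>t::real. t\<^sup>2) has_real_derivative 2 * t) (at t)"
      by (auto intro!: derivative_eq_intros)
    then show ?thesis
      using 1 by (subst DERIV_cong_ev[OF refl _ refl, where g = "\<lambda>t. t\<^sup>2"])
        (auto intro: eventually_mono[OF eventually_nhds_in_open[of "{0<..}"]])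
  next
    case 2
    then show ?thesis
      by (subst DERIV_cong_ev[OF refl _ refl, where g = "\<lambda>t. 0"])
        (auto intro: eventually_mono[OF eventually_nhds_in_open[of "{..<0}"]])
  next
    case 3
    have "(\<lambda>h. (max 0 h)\<^sup>2 / h) = (\<lambda>h::real. max 0 h)"
      by (auto simp: max_def power2_eq_square)
    moreover have "((\<lambda>h::real. max 0 h) \<longlongrightarrow> max 0 0) (at 0)"
      by (intro tendsto_intros)
    ultimately show ?thesis using 3 by (simp add: DERIV_def)
  qed
qed

lemma saddle_field_eq:
  fixes f :: "real^'n \<Rightarrow> real" and g :: "real^'n \<Rightarrow> real^'m"
  assumes f: "f differentiable (at x)" and g: "g differentiable (at x)"
  shows "saddle_field f g \<rho> (x, \<mu>) =
    (- gradient f x - grad_matrix g x *v (\<mu> + \<rho> *\<^sub>R pos_part (g x)), g x)"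
proof -
  have gi: "GDERIV (\<lambda>y. g y $ i) x :> gradient (\<lambda>y. g y $ i) x" for i
    using g by (intro GDERIV_gradient)
      (auto simp: differentiable_def intro: bounded_linear.has_derivative[OF bounded_linear_vec_nth])
  have L: "aug_lagrangian f g \<rho> y \<mu> =
      f y + (\<Sum>i\<in>UNIV. \<mu> $ i * g y $ i + \<rho> / 2 * (max 0 (g y $ i))\<^sup>2)" for y
    unfolding aug_lagrangian_def pos_part_def
    unfolding power2_norm_eq_inner
    by (simp add: inner_vec_def sum.distrib sum_distrib_left power2_eq_square)
  have max2: "((\<lambda>y. (max 0 (g y $ i))\<^sup>2) has_derivative
      (\<lambda>h. 2 * max 0 (g x $ i) * (h \<bullet> gradient (\<lambda>y. g y $ i) x))) (at x)" for i
    using has_derivative_compose[OF gi[unfolded gderiv_def]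
        DERIV_max_square[unfolded has_field_derivative_def], of i]
    by (simp add: mult.commute)
  have "(\<lambda>y. aug_lagrangian f g \<rho> y \<mu>) = (\<lambda>y. f y +
      (\<Sum>i\<in>UNIV. \<mu> $ i * g y $ i + \<rho> / 2 * (max 0 (g y $ i))\<^sup>2))"
    using L by (rule ext)
  moreover have "((\<lambda>y. f y + (\<Sum>i\<in>UNIV. \<mu> $ i * g y $ i + \<rho> / 2 * (max 0 (g y $ i))\<^sup>2))
      has_derivative (\<lambda>h. h \<bullet> gradient f x + (\<Sum>i\<in>UNIV.
        \<mu> $ i * (h \<bullet> gradient (\<lambda>y. g y $ i) x)
        + \<rho> / 2 * (2 * max 0 (g x $ i) * (h \<bullet> gradient (\<lambda>y. g y $ i) x))))) (at x)"
    by (intro has_derivative_add has_derivative_sum has_derivative_mult_right max2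
        GDERIV_gradient[OF f, unfolded gderiv_def] gi[unfolded gderiv_def])
  moreover have "grad_matrix g x *v v = (\<Sum>i\<in>UNIV. v $ i *\<^sub>R gradient (\<lambda>y. g y $ i) x)" for v
    by (simp add: grad_matrix_def matrix_vector_mult_def vec_eq_iff mult.commute)
  then have "h \<bullet> (gradient f x + grad_matrix g x *v (\<mu> + \<rho> *\<^sub>R pos_part (g x))) =
      h \<bullet> gradient f x + (\<Sum>i\<in>UNIV.
        \<mu> $ i * (h \<bullet> gradient (\<lambda>y. g y $ i) x)
        + \<rho> / 2 * (2 * max 0 (g x $ i) * (h \<bullet> gradient (\<lambda>y. g y $ i) x)))" for h
    by (simp add: pos_part_def inner_add_right inner_sum_right sum.distrib sum_distrib_left algebra_simps)
  ultimately have "GDERIV (\<lambda>y. aug_lagrangian f g \<rho> y \<mu>) x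
      :> gradient f x + grad_matrix g x *v (\<mu> + \<rho> *\<^sub>R pos_part (g x))"
    by (simp add: gderiv_def)
  moreover have "GDERIV (\<lambda>\<mu>. aug_lagrangian f g \<rho> x \<mu>) \<mu> :> g x"
    unfolding aug_lagrangian_def gderiv_def by (auto intro!: derivative_eq_intros)
  ultimately show ?thesis
    by (simp add: saddle_field_def gradient_eqI)
qed

end

theory Submission
  imports Defs "HOL-Complex_Analysis.Great_Picard"
begin

text \<open>The convex-concave field is monotone on the domain, so the projected flow is nonexpansive, and
  the distance to the equilibrium \<open>zs\<close> decreases at least at the rate of the gap
  \<open>- (z - zs) \<bullet> F z \<ge> 0\<close>. The gap therefore tends to \<open>0\<close> along every trajectory, and where it
  vanishes \<open>x\<close> is feasible and minimizes the Lagrangian with multiplier \<open>ms\<close>; this is where \<open>\<rho> > 0\<close>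
  enters. A trajectory of vanishing gap has nonincreasing multipliers. Its limit points are equilibria,
  and strict complementarity makes its distance to such a limit point constant, so it is itself
  constant. Both claims follow, the second because nonexpansiveness turns a limit point of a
  trajectory into the starting point of a trajectory of vanishing gap.

  Since a point from which no trajectory starts would be vacuously invariant, both claims also
  need existence of trajectories. It is obtained from Euler polygons: the field is only continuous.\<close>

section \<open>Absolutely continuous functions\<close>

text \<open>Two difficulties shape the proof. The projected field jumps where a multiplier reaches
  \<open>0\<close>, so derivatives along a trajectory are never integrated themselves: they are
  compared almost everywhere with continuous majorants, and the gap is formed with the continuous
  \<open>F\<close>, which dominates its projected version. Moreover, a vanishing gap does not by
  itself stop the motion: the unprojected flow of a bilinear Lagrangian circles round its saddle
  point with zero gap. Here the sign of \<open>g x\<close> on the gap zeros breaks the circle,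
  because multipliers can then only decrease. Strict complementarity concerns the constraints with
  \<open>ms $ i = 0\<close>. They are inactive at \<open>xs\<close>, so their multipliers vanish on
  the gap zeros. Every other constraint has positive weight in the Lagrangian and is affine between
  its minimizers, so the tangent inequalities that enter the energies become identities.\<close>

lemma abs_continuous_on_finite:
  assumes "abs_continuous_on I z" and "e > 0"
  shows "\<exists>d>0. \<forall>D l r. finite D \<longrightarrow> (\<forall>i\<in>D. l i \<le> r i \<and> {l i..r i} \<subseteq> I) \<longrightarrow>
    disjoint_family_on (\<lambda>i. {l i<..<r i}) D \<longrightarrow> (\<Sum>i\<in>D. r i - l i) < d \<longrightarrow>
    (\<Sum>i\<in>D. dist (z (l i)) (z (r i))) < e"
proof -
  obtain d where "d > 0" and "\<forall>(N::nat) a b. (\<forall>k<N. a k \<le> b k \<and> {a k..b k} \<subseteq> I)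
       \<and> disjoint_family_on (\<lambda>k. {a k<..<b k}) {..<N}
       \<and> (\<Sum>k<N. b k - a k) < d \<longrightarrow> (\<Sum>k<N. dist (z (a k)) (z (b k))) < e"
    using assms unfolding abs_continuous_on_def by blast
  then have d: "(\<Sum>k<N. dist (z (a k)) (z (b k))) < e"
    if "\<forall>k<N. a k \<le> b k \<and> {a k..b k} \<subseteq> I" "disjoint_family_on (\<lambda>k. {a k<..<b k}) {..<N}"
      "(\<Sum>k<N. b k - a k) < d" for N :: nat and a b
    using that by blast
  show ?thesis
  proof (intro exI[of _ d] conjI allI impI \<open>d > 0\<close>)
    fix D :: "'b set" and l r
    assume fin: "finite D" and lr: "\<forall>i\<in>D. l i \<le> r i \<and> {l i..r i} \<subseteq> I"
      and disj: "disjoint_family_on (\<lambda>i. {l i<..<r i}) D"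
      and sum: "(\<Sum>i\<in>D. r i - l i) < d"
    obtain h where h: "bij_betw h {..<card D} D"
      using ex_bij_betw_nat_finite[OF fin] by (auto simp: atLeast0LessThan)
    have "(\<Sum>k<card D. dist (z ((l \<circ> h) k)) (z ((r \<circ> h) k))) < e"
    proof (rule d)
      show "\<forall>k<card D. (l \<circ> h) k \<le> (r \<circ> h) k \<and> {(l \<circ> h) k..(r \<circ> h) k} \<subseteq> I"
        using lr bij_betwE[OF h] by simp
      show "disjoint_family_on (\<lambda>k. {(l \<circ> h) k<..<(r \<circ> h) k}) {..<card D}"
        unfolding disjoint_family_on_def comp_def
      proof (intro ballI impI)
        fix m n assume "m \<in> {..<card D}" "n \<in> {..<card D}" "m \<noteq> n"
        then have "h m \<in> D" "h n \<in> D" "h m \<noteq> h n"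
          using h by (auto simp: bij_betw_def inj_on_def)
        then show "{l (h m)<..<r (h m)} \<inter> {l (h n)<..<r (h n)} = {}"
          using disj unfolding disjoint_family_on_def by blast
      qed
      show "(\<Sum>k<card D. (r \<circ> h) k - (l \<circ> h) k) < d"
        using sum sum.reindex_bij_betw[OF h, of "\<lambda>i. r i - l i"] by simp
    qed
    then show "(\<Sum>i\<in>D. dist (z (l i)) (z (r i))) < e"
      using sum.reindex_bij_betw[OF h, of "\<lambda>i. dist (z (l i)) (z (r i))"] by simp
  qed
qed

text \<open>Cousin's lemma replaces a covering argument: on a fine tagged division the intervals tagged
  outside the exceptional null set are controlled by the derivative, the others by absolute
  continuity.\<close>

lemma abs_continuous_on_AE_deriv_nonpos:
  fixes \<phi> :: "real \<Rightarrow> real"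
  assumes ac: "abs_continuous_on {a..b} \<phi>" and "a \<le> b"
    and der: "AE t in lebesgue. t \<in> {a..b} \<longrightarrow> (\<exists>D\<le>0. (\<phi> has_vector_derivative D) (at t within {a..b}))"
  shows "\<phi> b \<le> \<phi> a"
proof -
  have "\<phi> b \<le> \<phi> a + e * (b - a) + e" if "e > 0" for e
  proof -
    obtain N where N: "N \<in> null_sets lebesgue"
      and N': "\<And>t. t \<in> {a..b} \<Longrightarrow> t \<notin> N \<Longrightarrow> \<exists>D\<le>0. (\<phi> has_vector_derivative D) (at t within {a..b})"
      using der by (auto elim!: AE_E3)
    obtain d where "d > 0" and d: "\<forall>(D::(real \<times> real set) set) l r. finite D \<longrightarrow>
        (\<forall>i\<in>D. l i \<le> r i \<and> {l i..r i} \<subseteq> {a..b}) \<longrightarrow> disjoint_family_on (\<lambda>i. {l i<..<r i}) D \<longrightarrow>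
        (\<Sum>i\<in>D. r i - l i) < d \<longrightarrow> (\<Sum>i\<in>D. dist (\<phi> (l i)) (\<phi> (r i))) < e"
      using abs_continuous_on_finite[OF ac \<open>e > 0\<close>] by blast
    obtain U where "open U" "N \<subseteq> U" and UN: "U - N \<in> lmeasurable" "emeasure lebesgue (U - N) < ennreal d"
      using sets_lebesgue_outer_open[of N d] N \<open>d > 0\<close> by (auto simp: null_sets_def)
    have N_lm: "N \<in> lmeasurable" "measure lebesgue N = 0"
      using N negligible_iff_null_sets negligible_imp_measurable negligible_imp_measure0 by auto
    have U_lm: "U \<in> lmeasurable"
      using UN(1) N_lm(1) \<open>N \<subseteq> U\<close> by (metis Diff_partition fmeasurable.Un)
    have "measure lebesgue U = measure lebesgue (U - N)"
      using measure_Diff_null_set[OF fmeasurableD[OF U_lm] N] by simp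
    also have "\<dots> < d"
      using UN \<open>d > 0\<close> by (simp add: emeasure_eq_measure2 ennreal_less_iff)
    finally have mU: "measure lebesgue U < d" .
    \<comment> \<open>A tag in \<open>N\<close> only needs its interval to lie in \<open>U\<close>.
      Any other tag carries one-sided bounds on both sides of \<open>t\<close>; as a tag lies
      between the endpoints of its interval, they add up to slope at most \<open>e\<close> over the
      whole interval.\<close>
    define good where "good t \<eta> \<longleftrightarrow> \<eta> > 0 \<and> (if t \<in> N then ball t \<eta> \<subseteq> U else
        (\<forall>u\<in>{a..b}. \<bar>u - t\<bar> < \<eta> \<longrightarrow> (u \<ge> t \<longrightarrow> \<phi> u - \<phi> t \<le> e * (u - t)) \<and>
          (u \<le> t \<longrightarrow> \<phi> t - \<phi> u \<le> e * (t - u))))" for t \<eta>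
    have "\<exists>\<eta>. good t \<eta>" if t: "t \<in> {a..b}" for t
    proof (cases "t \<in> N")
      case True
      then show ?thesis using \<open>open U\<close> \<open>N \<subseteq> U\<close> by (auto simp: good_def open_contains_ball)
    next
      case False
      then obtain D where "D \<le> 0" and D: "(\<phi> has_vector_derivative D) (at t within {a..b})"
        using N' t by blast
      from D have "\<forall>e>0. \<exists>d>0. \<forall>u\<in>{a..b}. norm (u - t) < d \<longrightarrow>
          norm (\<phi> u - \<phi> t - (u - t) *\<^sub>R D) \<le> e * norm (u - t)"
        unfolding has_vector_derivative_def has_derivative_within_alt by (rule conjunct2)
      from this[rule_format, OF \<open>e > 0\<close>] obtain \<eta> where "\<eta> > 0" and
        "\<forall>u\<in>{a..b}. norm (u - t) < \<eta> \<longrightarrow> norm (\<phi> u - \<phi> t - (u - t) *\<^sub>R D) \<le> e * norm (u - t)"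
        by (elim exE conjE)
      then have \<eta>: "\<bar>\<phi> u - \<phi> t - (u - t) * D\<bar> \<le> e * \<bar>u - t\<bar>" if "u \<in> {a..b}" "\<bar>u - t\<bar> < \<eta>" for u
        using that by simp
      have "(u \<ge> t \<longrightarrow> \<phi> u - \<phi> t \<le> e * (u - t)) \<and> (u \<le> t \<longrightarrow> \<phi> t - \<phi> u \<le> e * (t - u))"
        if "u \<in> {a..b}" "\<bar>u - t\<bar> < \<eta>" for u
      proof -
        have "(u - t) * D \<le> 0" if "u \<ge> t" using that \<open>D \<le> 0\<close> by (simp add: mult_nonneg_nonpos)
        moreover have "(u - t) * D \<ge> 0" if "u \<le> t" using that \<open>D \<le> 0\<close> by (simp add: mult_nonpos_nonpos)
        ultimately show ?thesis using \<eta>[OF that] by (auto simp: abs_le_iff)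
      qed
      then show ?thesis using False \<open>\<eta> > 0\<close> by (auto simp: good_def)
    qed
    then obtain \<eta> where \<eta>: "\<And>t. t \<in> {a..b} \<Longrightarrow> good t (\<eta> t)" by metis
    define \<gamma> where "\<gamma> t = ball t (if t \<in> {a..b} then \<eta> t else 1)" for t
    have "gauge \<gamma>"
      unfolding gauge_def \<gamma>_def using \<eta> by (auto simp: good_def)
    then obtain p where p: "p tagged_division_of {a..b}" and fine: "\<gamma> fine p"
      using fine_division_exists_real by blast
    have K: "\<exists>l r. K = {l..r} \<and> l \<le> r \<and> t \<in> {l..r} \<and> {l..r} \<subseteq> {a..b} \<and> {l..r} \<subseteq> ball t (\<eta> t)"
      if tK: "(t, K) \<in> p" for t K
    proof -
      obtain l r where "K = {l..r}" using tagged_division_ofD(4)[OF p tK] by auto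
      moreover have "t \<in> K" "K \<subseteq> {a..b}" using tagged_division_ofD(2,3)[OF p tK] by auto
      moreover have "K \<subseteq> ball t (\<eta> t)" using fine tK \<open>t \<in> K\<close> \<open>K \<subseteq> {a..b}\<close>
        unfolding fine_def \<gamma>_def by fastforce
      ultimately show ?thesis by (metis atLeastAtMost_iff order_trans)
    qed
    have fin: "finite p" using p by (rule tagged_division_of_finite)
    define p1 p2 where "p1 = {i\<in>p. fst i \<in> N}" and "p2 = {i\<in>p. fst i \<notin> N}"
    let ?l = "\<lambda>i::real \<times> real set. Inf (snd i)" and ?r = "\<lambda>i::real \<times> real set. Sup (snd i)"
    have K': "?l i \<le> ?r i \<and> fst i \<in> {?l i..?r i} \<and> ?l i \<in> {a..b} \<and> ?r i \<in> {a..b}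
        \<and> {?l i..?r i} \<subseteq> ball (fst i) (\<eta> (fst i)) \<and> snd i = {?l i..?r i}" if i: "i \<in> p" for i
    proof -
      obtain l r where "snd i = {l..r}" "l \<le> r" "fst i \<in> {l..r}" "{l..r} \<subseteq> {a..b}"
        "{l..r} \<subseteq> ball (fst i) (\<eta> (fst i))"
        using K[of "fst i" "snd i"] i by auto
      then show ?thesis by auto
    qed
    have 2: "(\<Sum>i\<in>p2. \<phi> (?r i) - \<phi> (?l i)) \<le> (\<Sum>i\<in>p2. e * (?r i - ?l i))"
    proof (rule sum_mono)
      fix i assume "i \<in> p2"
      then have i: "i \<in> p" "fst i \<notin> N" by (auto simp: p2_def)
      define t l r where "t = fst i" and "l = ?l i" and "r = ?r i"
      have lr: "l \<le> r" "t \<in> {l..r}" "l \<in> {a..b}" "r \<in> {a..b}" "{l..r} \<subseteq> ball t (\<eta> t)"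
        using K'[OF i(1)] by (auto simp: t_def l_def r_def)
      then have "good t (\<eta> t)" using \<eta> by auto
      moreover have "l \<in> ball t (\<eta> t)" "r \<in> ball t (\<eta> t)" using lr(1) by (intro subsetD[OF lr(5)]; simp)+
      then have "\<bar>l - t\<bar> < \<eta> t" "\<bar>r - t\<bar> < \<eta> t"
        by (auto simp: dist_real_def abs_minus_commute)
      ultimately have "\<phi> r - \<phi> t \<le> e * (r - t)" "\<phi> t - \<phi> l \<le> e * (t - l)"
        using i(2) lr(2-4) by (auto simp: good_def t_def)
      then show "\<phi> (?r i) - \<phi> (?l i) \<le> e * (?r i - ?l i)"
        unfolding l_def[symmetric] r_def[symmetric] by (simp add: algebra_simps)
    qed
    have disj: "disjoint_family_on (\<lambda>i. {?l i<..<?r i}) p"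
      unfolding disjoint_family_on_def
    proof (intro ballI impI)
      fix i j assume ij: "i \<in> p" "j \<in> p" "i \<noteq> j"
      have "interior (snd i) \<inter> interior (snd j) = {}"
        using tagged_division_ofD(5)[OF p, of "fst i" "snd i" "fst j" "snd j"] ij by (simp add: prod_eq_iff)
      moreover have "interior (snd k) = {?l k<..<?r k}" if "k \<in> p" for k
        using K'[OF that] by (metis interior_atLeastAtMost_real)
      ultimately show "{?l i<..<?r i} \<inter> {?l j<..<?r j} = {}"
        using ij by simp
    qed
    have p_sub: "p1 \<subseteq> p" by (auto simp: p1_def)
    have 1: "(\<Sum>i\<in>p1. dist (\<phi> (?l i)) (\<phi> (?r i))) < e"
    proof (rule d[rule_format])
      show "finite p1" using fin p_sub finite_subset by blast
      show d1: "disjoint_family_on (\<lambda>i. {?l i<..<?r i}) p1"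
        using disjoint_family_on_mono[OF p_sub disj] .
      show "?l i \<le> ?r i \<and> {?l i..?r i} \<subseteq> {a..b}" if "i \<in> p1" for i
        using K'[of i] that p_sub by auto
      \<comment> \<open>The intervals tagged in \<open>N\<close> are disjoint and lie in
        \<open>U\<close>, so their total length is below the modulus \<open>d\<close> of absolute
        continuity.\<close>
      have "(\<Sum>i\<in>p1. ?r i - ?l i) = (\<Sum>i\<in>p1. measure lebesgue {?l i<..<?r i})"
        using K' p_sub by (intro sum.cong) (auto simp: measure_completion)
      also have "\<dots> = measure lebesgue (\<Union>i\<in>p1. {?l i<..<?r i})"
      proof (intro measure_finite_Union[symmetric])
        show "emeasure lebesgue {?l i<..<?r i} \<noteq> \<infinity>" if "i \<in> p1" for i
          using emeasure_lborel_box_finite[of "?l i" "?r i"] by simp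
      qed (use \<open>finite p1\<close> d1 in auto)
      also have "\<dots> \<le> measure lebesgue U"
      proof (rule measure_mono_fmeasurable[OF _ _ U_lm])
        show "(\<Union>i\<in>p1. {?l i<..<?r i}) \<subseteq> U"
        proof clarify
          fix u and i :: "real \<times> real set" assume *: "i \<in> p1" "u \<in> {?l i<..<?r i}"
          then have i: "i \<in> p" "fst i \<in> N" by (auto simp: p1_def)
          have "{?l i..?r i} \<subseteq> ball (fst i) (\<eta> (fst i))" using K'[OF i(1)] by (elim conjE)
          moreover have "u \<in> {?l i..?r i}" using *(2) by simp
          ultimately have "u \<in> ball (fst i) (\<eta> (fst i))" by (rule subsetD)
          moreover have "good (fst i) (\<eta> (fst i))" using K'[OF i(1)] \<eta> by auto
          ultimately show "u \<in> U" using i(2) by (auto simp: good_def)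
        qed
      qed (auto intro!: sets.finite_UN \<open>finite p1\<close>)
      finally show "(\<Sum>i\<in>p1. ?r i - ?l i) < d" using mU by simp
    qed
    have split: "(\<Sum>i\<in>p. h i) = (\<Sum>i\<in>p1. h i) + (\<Sum>i\<in>p2. h i)" for h :: "_ \<Rightarrow> real"
    proof -
      have "p = p1 \<union> p2" "p1 \<inter> p2 = {}" by (auto simp: p1_def p2_def)
      then show ?thesis using fin by (metis finite_Un sum.union_disjoint)
    qed
    have tel: "(\<Sum>i\<in>p. h (?r i) - h (?l i)) = h b - h a" for h :: "real \<Rightarrow> real"
      using additive_tagged_division_1[OF \<open>a \<le> b\<close> p, of h] by (simp add: case_prod_unfold)
    have "\<phi> b - \<phi> a = (\<Sum>i\<in>p1. \<phi> (?r i) - \<phi> (?l i)) + (\<Sum>i\<in>p2. \<phi> (?r i) - \<phi> (?l i))"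
      using tel[of \<phi>] split by simp
    also have "(\<Sum>i\<in>p1. \<phi> (?r i) - \<phi> (?l i)) \<le> (\<Sum>i\<in>p1. dist (\<phi> (?l i)) (\<phi> (?r i)))"
      by (intro sum_mono) (auto simp: dist_real_def)
    also have "(\<Sum>i\<in>p2. \<phi> (?r i) - \<phi> (?l i)) \<le> (\<Sum>i\<in>p. e * (?r i - ?l i))"
    proof -
      have "(\<Sum>i\<in>p1. e * (?r i - ?l i)) \<ge> 0"
        using K' p_sub \<open>e > 0\<close> by (intro sum_nonneg) auto
      then show ?thesis using 2 split[of "\<lambda>i. e * (?r i - ?l i)"] by simp
    qed
    also have "(\<Sum>i\<in>p. e * (?r i - ?l i)) = e * (b - a)"
      using tel[of "\<lambda>x. x"] by (simp add: sum_distrib_left[symmetric])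
    finally show ?thesis using 1 by linarith
  qed
  note le = this
  show ?thesis
  proof (rule field_le_epsilon)
    fix e :: real assume "e > 0"
    \<comment> \<open>Rescaling absorbs both errors, the one proportional to \<open>b - a\<close>
      from the regular tags and the constant one from the exceptional tags.\<close>
    have "\<phi> b \<le> \<phi> a + e / (b - a + 1) * (b - a) + e / (b - a + 1)"
      using le[of "e / (b - a + 1)"] \<open>e > 0\<close> \<open>a \<le> b\<close> by simp
    also have "\<dots> = \<phi> a + e / (b - a + 1) * (b - a + 1)" by (simp add: distrib_left)
    also have "\<dots> = \<phi> a + e" using \<open>a \<le> b\<close> by simp
    finally show "\<phi> b \<le> \<phi> a + e" .
  qed
qed

lemma abs_continuous_on_dist_le:
  fixes z1 :: "real \<Rightarrow> 'a::metric_space" and z2 :: "real \<Rightarrow> 'b::metric_space"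
  assumes 1: "abs_continuous_on I z1" and 2: "abs_continuous_on I z2"
    and le: "\<And>s t. s \<in> I \<Longrightarrow> t \<in> I \<Longrightarrow> dist (\<phi> s) (\<phi> t) \<le> C * (dist (z1 s) (z1 t) + dist (z2 s) (z2 t))"
  shows "abs_continuous_on I \<phi>"
  unfolding abs_continuous_on_def
proof (intro allI impI)
  fix e :: real assume "e > 0"
  \<comment> \<open>\<open>C\<close> may be zero or negative, and the modulus is found by dividing
    by \<open>C'\<close>.\<close>
  define C' where "C' = max C 1"
  have "C' > 0" "C \<le> C'" by (auto simp: C'_def)
  define e' where "e' = e / (2 * C')"
  have "e' > 0" using \<open>e > 0\<close> \<open>C' > 0\<close> by (simp add: e'_def)
  obtain d1 where "d1 > 0" and d1: "\<forall>(N::nat) a b. (\<forall>k<N. a k \<le> b k \<and> {a k..b k} \<subseteq> I)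
       \<and> disjoint_family_on (\<lambda>k. {a k<..<b k}) {..<N} \<and> (\<Sum>k<N. b k - a k) < d1
       \<longrightarrow> (\<Sum>k<N. dist (z1 (a k)) (z1 (b k))) < e'"
    using 1 \<open>e' > 0\<close> unfolding abs_continuous_on_def by blast
  obtain d2 where "d2 > 0" and d2: "\<forall>(N::nat) a b. (\<forall>k<N. a k \<le> b k \<and> {a k..b k} \<subseteq> I)
       \<and> disjoint_family_on (\<lambda>k. {a k<..<b k}) {..<N} \<and> (\<Sum>k<N. b k - a k) < d2
       \<longrightarrow> (\<Sum>k<N. dist (z2 (a k)) (z2 (b k))) < e'"
    using 2 \<open>e' > 0\<close> unfolding abs_continuous_on_def by blast
  show "\<exists>d>0. \<forall>(N::nat) a b. (\<forall>k<N. a k \<le> b k \<and> {a k..b k} \<subseteq> I)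
       \<and> disjoint_family_on (\<lambda>k. {a k<..<b k}) {..<N} \<and> (\<Sum>k<N. b k - a k) < d
       \<longrightarrow> (\<Sum>k<N. dist (\<phi> (a k)) (\<phi> (b k))) < e"
  proof (intro exI[of _ "min d1 d2"] conjI allI impI)
    show "min d1 d2 > 0" using \<open>d1 > 0\<close> \<open>d2 > 0\<close> by simp
    fix N :: nat and a b :: "nat \<Rightarrow> real"
    assume *: "(\<forall>k<N. a k \<le> b k \<and> {a k..b k} \<subseteq> I)
       \<and> disjoint_family_on (\<lambda>k. {a k<..<b k}) {..<N} \<and> (\<Sum>k<N. b k - a k) < min d1 d2"
    have "(\<Sum>k<N. dist (\<phi> (a k)) (\<phi> (b k)))
        \<le> (\<Sum>k<N. C' * (dist (z1 (a k)) (z1 (b k)) + dist (z2 (a k)) (z2 (b k))))"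
    proof (rule sum_mono)
      fix k assume "k \<in> {..<N}"
      then have "a k \<in> {a k..b k}" "b k \<in> {a k..b k}" "{a k..b k} \<subseteq> I" using * by auto
      then have "dist (\<phi> (a k)) (\<phi> (b k)) \<le> C * (dist (z1 (a k)) (z1 (b k)) + dist (z2 (a k)) (z2 (b k)))"
        using le by blast
      also have "\<dots> \<le> C' * (dist (z1 (a k)) (z1 (b k)) + dist (z2 (a k)) (z2 (b k)))"
        using \<open>C \<le> C'\<close> by (intro mult_right_mono) auto
      finally show "dist (\<phi> (a k)) (\<phi> (b k)) \<le> \<dots>" .
    qed
    also have "\<dots> = C' * ((\<Sum>k<N. dist (z1 (a k)) (z1 (b k))) + (\<Sum>k<N. dist (z2 (a k)) (z2 (b k))))"
      by (simp add: sum_distrib_left[symmetric] sum.distrib)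
    also have "\<dots> < C' * (e' + e')"
    proof -
      have "(\<Sum>k<N. dist (z1 (a k)) (z1 (b k))) < e'" "(\<Sum>k<N. dist (z2 (a k)) (z2 (b k))) < e'"
        using d1 d2 * by auto
      then show ?thesis using \<open>C' > 0\<close> by simp
    qed
    also have "\<dots> = e" using \<open>C' > 0\<close> by (simp add: e'_def)
    finally show "(\<Sum>k<N. dist (\<phi> (a k)) (\<phi> (b k))) < e" .
  qed
qed

lemma abs_continuous_on_lipschitz:
  assumes le: "\<And>s t. s \<in> I \<Longrightarrow> t \<in> I \<Longrightarrow> dist (\<phi> s) (\<phi> t) \<le> C * dist s t"
  shows "abs_continuous_on I \<phi>"
proof -
  have "abs_continuous_on I (\<lambda>t::real. t)"
    unfolding abs_continuous_on_def
  proof (intro allI impI exI conjI)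
    fix e :: real and N :: nat and a b :: "nat \<Rightarrow> real"
    assume *: "(\<forall>k<N. a k \<le> b k \<and> {a k..b k} \<subseteq> I)
       \<and> disjoint_family_on (\<lambda>k. {a k<..<b k}) {..<N} \<and> (\<Sum>k<N. b k - a k) < e"
    have "(\<Sum>k<N. dist (a k) (b k)) = (\<Sum>k<N. b k - a k)"
      using * by (intro sum.cong) (auto simp: dist_real_def)
    then show "(\<Sum>k<N. dist (a k) (b k)) < e" using * by simp
  qed auto
  \<comment> \<open>The identity serves as both controlling functions, so its distance is counted
    twice; hence \<open>C / 2\<close>.\<close>
  from abs_continuous_on_dist_le[OF this this, of \<phi> "C / 2"] show ?thesis
    using le by simp
qed

lemma abs_continuous_on_imp_continuous_on:
  assumes "abs_continuous_on {a..b} z"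
  shows "continuous_on {a..b} z"
  unfolding continuous_on_iff
proof (intro ballI allI impI)
  fix t and e :: real assume t: "t \<in> {a..b}" and "e > 0"
  obtain d where "d > 0" and d: "\<forall>(N::nat) l r. (\<forall>k<N. l k \<le> r k \<and> {l k..r k} \<subseteq> {a..b})
       \<and> disjoint_family_on (\<lambda>k. {l k<..<r k}) {..<N} \<and> (\<Sum>k<N. r k - l k) < d
       \<longrightarrow> (\<Sum>k<N. dist (z (l k)) (z (r k))) < e"
    using assms \<open>e > 0\<close> unfolding abs_continuous_on_def by blast
  have le: "dist (z l) (z r) < e" if "l \<le> r" "l \<in> {a..b}" "r \<in> {a..b}" "r - l < d" for l r
    using d[rule_format, of 1 "\<lambda>_. l" "\<lambda>_. r"] that by (simp add: disjoint_family_on_def)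
  have "dist (z s) (z t) < e" if "s \<in> {a..b}" "dist s t < d" for s
  proof (cases "s \<le> t")
    case True
    then show ?thesis using that t le[of s t] by (simp add: dist_real_def)
  next
    case False
    then show ?thesis using that t le[of t s] by (simp add: dist_real_def dist_commute)
  qed
  then show "\<exists>d>0. \<forall>s\<in>{a..b}. dist s t < d \<longrightarrow> dist (z s) (z t) < e"
    using \<open>d > 0\<close> by blast
qed

lemma abs_continuous_on_subset:
  assumes "abs_continuous_on I z" and "J \<subseteq> I"
  shows "abs_continuous_on J z"
  using assms unfolding abs_continuous_on_def by (meson order_trans)

text \<open>On a compact interval the difference is bounded by some \<open>M\<close>, and half the
  difference of two squared norms factors into the difference of the norms times their mean, which
  is at most \<open>M\<close>.\<close>

lemma abs_continuous_on_half_sq_norm: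
  fixes z1 z2 :: "real \<Rightarrow> 'a::real_inner"
  assumes 1: "abs_continuous_on {a..b} z1" and 2: "abs_continuous_on {a..b} z2"
  shows "abs_continuous_on {a..b} (\<lambda>t. (norm (z1 t - z2 t))\<^sup>2 / 2)"
proof -
  have "continuous_on {a..b} (\<lambda>t. z1 t - z2 t)"
    using assms by (intro continuous_intros abs_continuous_on_imp_continuous_on)
  then have "bounded ((\<lambda>t. z1 t - z2 t) ` {a..b})"
    by (intro compact_imp_bounded compact_continuous_image) auto
  then obtain M where M: "\<And>t. t \<in> {a..b} \<Longrightarrow> norm (z1 t - z2 t) \<le> M"
    unfolding bounded_iff by blast
  show ?thesis
  proof (rule abs_continuous_on_dist_le[OF 1 2])
    fix s t assume st: "s \<in> {a..b}" "t \<in> {a..b}"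
    let ?u = "z1 s - z2 s" and ?v = "z1 t - z2 t"
    have "dist ((norm ?u)\<^sup>2 / 2) ((norm ?v)\<^sup>2 / 2) = \<bar>norm ?u - norm ?v\<bar> * ((norm ?u + norm ?v) / 2)"
    proof -
      have eq: "(norm ?u)\<^sup>2 / 2 - (norm ?v)\<^sup>2 / 2 = (norm ?u - norm ?v) * ((norm ?u + norm ?v) / 2)"
        by (simp add: power2_eq_square algebra_simps)
      show ?thesis unfolding dist_real_def eq by (subst abs_mult) simp
    qed
    also have "\<dots> \<le> norm (?u - ?v) * M"
      using M[OF st(1)] M[OF st(2)] norm_triangle_ineq3[of ?u ?v] by (intro mult_mono) auto
    also have "\<dots> \<le> (dist (z1 s) (z1 t) + dist (z2 s) (z2 t)) * M"
    proof (rule mult_right_mono)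
      have "?u - ?v = (z1 s - z1 t) - (z2 s - z2 t)" by simp
      then show "norm (?u - ?v) \<le> dist (z1 s) (z1 t) + dist (z2 s) (z2 t)"
        unfolding dist_norm by (metis norm_triangle_ineq4)
      show "M \<ge> 0" using M[OF st(1)] norm_ge_zero order_trans by blast
    qed
    finally show "dist ((norm ?u)\<^sup>2 / 2) ((norm ?v)\<^sup>2 / 2) \<le> M * (dist (z1 s) (z1 t) + dist (z2 s) (z2 t))"
      by (simp add: mult.commute)
  qed
qed

text \<open>Only the majorant \<open>c\<close> has to be continuous. Its primitive is then a
  classical one and Lipschitz, and subtracting it reduces the claim to a nonpositive derivative
  almost everywhere.\<close>

lemma abs_continuous_on_increment_le:
  fixes \<phi> c :: "real \<Rightarrow> real"
  assumes ac: "abs_continuous_on {a..b} \<phi>" and "a \<le> b" and c: "continuous_on {a..b} c"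
    and der: "AE t in lebesgue. t \<in> {a..b} \<longrightarrow> (\<exists>D\<le>c t. (\<phi> has_vector_derivative D) (at t within {a..b}))"
  shows "\<phi> b - \<phi> a \<le> integral {a..b} c"
proof -
  define H where "H t = integral {a..t} c" for t
  have H: "(H has_vector_derivative c t) (at t within {a..b})" if "t \<in> {a..b}" for t
    unfolding H_def using c that by (rule integral_has_vector_derivative)
  have "bounded (c ` {a..b})"
    using c by (intro compact_imp_bounded compact_continuous_image) auto
  then obtain M where M: "\<And>t. t \<in> {a..b} \<Longrightarrow> norm (c t) \<le> M"
    unfolding bounded_iff by blast
  have "abs_continuous_on {a..b} H"
  proof (rule abs_continuous_on_lipschitz)
    fix s t assume "s \<in> {a..b}" "t \<in> {a..b}"
    then have "norm (H t - H s) \<le> M * norm (t - s)"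
      by (intro field_differentiable_bound[of "{a..b}" H c])
        (use M in \<open>auto intro!: H simp: has_real_derivative_iff_has_vector_derivative\<close>)
    then show "dist (H s) (H t) \<le> M * dist s t" by (metis dist_norm dist_commute)
  qed
  with ac have "abs_continuous_on {a..b} (\<lambda>t. \<phi> t - H t)"
    by (rule abs_continuous_on_dist_le[where C = 1]) (simp add: dist_real_def)
  moreover have "AE t in lebesgue. t \<in> {a..b} \<longrightarrow>
      (\<exists>D\<le>0. ((\<lambda>t. \<phi> t - H t) has_vector_derivative D) (at t within {a..b}))"
    using der
  proof (rule AE_mp, intro AE_I2 impI)
    fix t assume t: "t \<in> {a..b}" "t \<in> {a..b} \<longrightarrow> (\<exists>D\<le>c t. (\<phi> has_vector_derivative D) (at t within {a..b}))"
    then obtain D where "D \<le> c t" "(\<phi> has_vector_derivative D) (at t within {a..b})" by blast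
    then show "\<exists>D\<le>0. ((\<lambda>t. \<phi> t - H t) has_vector_derivative D) (at t within {a..b})"
      using H[OF t(1)] by (intro exI[of _ "D - c t"]) (auto intro: has_vector_derivative_diff)
  qed
  ultimately have "\<phi> b - H b \<le> \<phi> a - H a"
    using \<open>a \<le> b\<close> abs_continuous_on_AE_deriv_nonpos[of a b "\<lambda>t. \<phi> t - H t"] by blast
  then show ?thesis by (simp add: H_def)
qed

text \<open>Barbalat's lemma. The increment of \<open>u\<close> over a window of fixed length tends
  to \<open>0\<close>, so by the mean value theorem \<open>q\<close> is small somewhere in the
  window, and uniform continuity carries this to the left end.\<close>

lemma deriv_tendsto_0_of_tendsto:
  fixes u q :: "real \<Rightarrow> real"
  assumes der: "\<And>t. t \<ge> 0 \<Longrightarrow> (u has_vector_derivative q t) (at t within {0..})"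
    and uc: "uniformly_continuous_on {0..} q" and lim: "(u \<longlongrightarrow> l) at_top"
  shows "(q \<longlongrightarrow> 0) at_top"
proof (rule tendstoI)
  fix e :: real assume "e > 0"
  then obtain d where "d > 0" and "\<forall>s\<in>{0..}. \<forall>t\<in>{0..}. dist t s < d \<longrightarrow> dist (q t) (q s) < e / 2"
    using uc[unfolded uniformly_continuous_on_def, rule_format, of "e / 2"] by auto
  then have d: "dist (q s) (q t) < e / 2" if "s \<ge> 0" "t \<ge> 0" "dist s t < d" for s t
    using that by simp
  define h where "h = d / 2"
  have h: "h > 0" "h < d" using \<open>d > 0\<close> by (auto simp: h_def)
  have "((\<lambda>t. u (h + t)) \<longlongrightarrow> l) at_top"
    by (rule filterlim_compose[OF lim filterlim_tendsto_add_at_top[OF tendsto_const filterlim_ident]])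
  then have "((\<lambda>t. u (h + t) - u t) \<longlongrightarrow> l - l) at_top"
    by (intro tendsto_diff lim)
  then have "\<forall>\<^sub>F t in at_top. dist (u (h + t) - u t) 0 < h * (e / 2)"
    using \<open>e > 0\<close> h by (intro tendstoD) auto
  then show "\<forall>\<^sub>F t in at_top. dist (q t) 0 < e"
    using eventually_ge_at_top[of 0]
  proof eventually_elim
    fix t assume small: "dist (u (h + t) - u t) 0 < h * (e / 2)" and "t \<ge> 0"
    have "\<exists>\<xi>\<in>{t<..<t + h}. u (t + h) - u t = (t + h - t) * q \<xi>"
    proof -
      have "(u has_derivative (\<lambda>s. s * q \<xi>)) (at \<xi> within {t..t + h})" if "\<xi> \<in> {t..t + h}" for \<xi>
        using der[of \<xi>] that \<open>t \<ge> 0\<close> unfolding has_vector_derivative_def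
        by (auto elim!: has_derivative_subset)
      with h show ?thesis
        using mvt_simple[of t "t + h" u "\<lambda>\<xi> s. s * q \<xi>"] by auto
    qed
    then obtain \<xi> where \<xi>: "\<xi> \<in> {t<..<t + h}" "u (t + h) - u t = h * q \<xi>" by auto
    then have "h * \<bar>q \<xi>\<bar> < h * (e / 2)" using small h by (simp add: abs_mult add.commute)
    then have "\<bar>q \<xi>\<bar> < e / 2" using h by simp
    moreover have "dist (q t) (q \<xi>) < e / 2"
      using \<xi> h \<open>t \<ge> 0\<close> by (intro d) (auto simp: dist_real_def)
    ultimately show "dist (q t) 0 < e" unfolding dist_real_def by linarith
  qed
qed

text \<open>Barbalat's lemma in integral form: the integral of a nonnegative function is
  nondecreasing in its upper limit and, being bounded, converges.\<close>

lemma integrand_tendsto_0: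
  fixes q :: "real \<Rightarrow> real"
  assumes uc: "uniformly_continuous_on {0..} q" and pos: "\<And>t. t \<ge> 0 \<Longrightarrow> q t \<ge> 0"
    and bdd: "\<And>t. t \<ge> 0 \<Longrightarrow> integral {0..t} q \<le> C"
  shows "(q \<longlongrightarrow> 0) at_top"
proof -
  define u where "u t = integral {0..t} q" for t
  have cont: "continuous_on {0..} q" using uc by (rule uniformly_continuous_imp_continuous)
  have int: "q integrable_on {s..t}" if "s \<ge> 0" for s t
    using cont that by (intro integrable_continuous_real continuous_on_subset[OF cont]) auto
  have der: "(u has_vector_derivative q t) (at t within {0..})" if "t \<ge> 0" for t
  proof -
    have "(u has_vector_derivative q t) (at t within {0..t + 1})"
      unfolding u_def using that cont by (intro integral_has_vector_derivative continuous_on_subset[OF cont]) auto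
    moreover have "{0..t + 1} \<inter> {..<t + 1} - {t} = {0..} \<inter> {..<t + 1} - {t}" by auto
    then have "at t within {0..t + 1} = at t within {0..}"
      by (intro at_within_nhd[of t "{..<t + 1}"]) auto
    ultimately show ?thesis by simp
  qed
  have mono: "u s \<le> u t" if "0 \<le> s" "s \<le> t" for s t
    unfolding u_def using that int pos by (intro integral_subset_le) auto
  define l where "l = Sup (u ` {0..})"
  have bdd': "bdd_above (u ` {0..})" using bdd by (intro bdd_aboveI[of _ C]) (auto simp: u_def)
  have "(u \<longlongrightarrow> l) at_top"
  proof (rule order_tendstoI)
    fix a assume "a < l"
    then obtain s where "s \<ge> 0" "a < u s"
      unfolding l_def using less_cSup_iff[OF _ bdd'] by auto
    then show "\<forall>\<^sub>F t in at_top. a < u t"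
      using mono by (intro eventually_mono[OF eventually_ge_at_top[of s]]) fastforce
  next
    fix a assume "l < a"
    have "\<forall>\<^sub>F t in at_top. t \<ge> (0::real)" by (rule eventually_ge_at_top)
    then show "\<forall>\<^sub>F t in at_top. u t < a"
    proof eventually_elim
      fix t :: real assume "t \<ge> 0"
      then have "u t \<le> l" unfolding l_def by (intro cSup_upper bdd') auto
      then show "u t < a" using \<open>l < a\<close> by simp
    qed
  qed
  with der uc show ?thesis by (rule deriv_tendsto_0_of_tendsto)
qed

section \<open>The projected field on the saddle domain\<close>

lemma matrix_vector_mult_grad_matrix:
  "grad_matrix g x *v v = (\<Sum>i\<in>UNIV. v $ i *\<^sub>R gradient (\<lambda>y. g y $ i) x)"
  by (simp add: grad_matrix_def matrix_vector_mult_def vec_eq_iff mult.commute)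

lemma convex_saddle_domain: "convex (saddle_domain UNIV)"
  unfolding saddle_domain_def convex_def by (auto simp: less_eq_vec_def)

lemma closed_saddle_domain: "closed (saddle_domain UNIV :: ((real^'n) \<times> (real^'m)) set)"
proof -
  have "closed (\<Inter>i. {\<mu>::real^'m. 0 \<le> \<mu> $ i})"
    by (intro closed_INT closed_Collect_le continuous_intros ballI)
  also have "(\<Inter>i. {\<mu>::real^'m. 0 \<le> \<mu> $ i}) = {\<mu>. 0 \<le> \<mu>}" by (auto simp: less_eq_vec_def)
  finally show ?thesis unfolding saddle_domain_def by (intro closed_Times) auto
qed

text \<open>The domain is polyhedral, so the feasible directions already form a closed set and the
  closure adds nothing. One small \<open>c\<close> serves all coordinates because there are finitely
  many.\<close>

lemma tangent_cone_saddle_domain: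
  fixes z :: "(real^'n) \<times> (real^'m)"
  assumes z: "z \<in> saddle_domain UNIV"
  shows "tangent_cone (saddle_domain UNIV) z = UNIV \<times> {w. \<forall>i. snd z $ i = 0 \<longrightarrow> 0 \<le> w $ i}" (is "_ = ?T")
proof -
  have nonneg: "0 \<le> snd z $ i" for i using z by (auto simp: saddle_domain_def less_eq_vec_def)
  have "{v. \<exists>c>0. z + c *\<^sub>R v \<in> saddle_domain UNIV} = ?T"
  proof (intro equalityI subsetI)
    fix v assume "v \<in> {v. \<exists>c>0. z + c *\<^sub>R v \<in> saddle_domain UNIV}"
    then obtain c where "c > 0" "z + c *\<^sub>R v \<in> saddle_domain UNIV" by blast
    then have "0 \<le> snd z $ i + c * snd v $ i" for i
      by (auto simp: saddle_domain_def less_eq_vec_def mem_Times_iff)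
    then have "\<forall>i. snd z $ i = 0 \<longrightarrow> 0 \<le> snd v $ i"
      using \<open>c > 0\<close> by (metis add_0 zero_le_mult_iff not_less)
    then show "v \<in> ?T" by (cases v) auto
  next
    fix v assume "v \<in> ?T"
    then have v: "0 \<le> snd v $ i" if "snd z $ i = 0" for i using that by auto
    have "\<forall>\<^sub>F c in at_right 0. 0 \<le> snd z $ i + c * snd v $ i" for i
    proof (cases "snd z $ i = 0")
      case True
      then show ?thesis using v[of i] eventually_at_right_less[of "0::real"] by (auto elim!: eventually_mono)
    next
      case False
      have "((\<lambda>c. snd z $ i + c * snd v $ i) \<longlongrightarrow> snd z $ i + 0 * snd v $ i) (at_right 0)"
        by (intro tendsto_intros)
      then have "\<forall>\<^sub>F c in at_right 0. 0 < snd z $ i + c * snd v $ i"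
        using nonneg[of i] False by (intro order_tendstoD) auto
      then show ?thesis by (rule eventually_mono) simp
    qed
    then have "\<forall>\<^sub>F c in at_right 0. \<forall>i. 0 \<le> snd z $ i + c * snd v $ i"
      by (rule eventually_all_finite)
    then have "\<forall>\<^sub>F c in at_right 0. c > 0 \<and> (\<forall>i. 0 \<le> snd z $ i + c * snd v $ i)"
      using eventually_at_right_less[of "0::real"] by eventually_elim simp
    then obtain c where "c > 0" "\<forall>i. 0 \<le> snd z $ i + c * snd v $ i"
      using eventually_happens'[OF trivial_limit_at_right_real] by blast
    then show "v \<in> {v. \<exists>c>0. z + c *\<^sub>R v \<in> saddle_domain UNIV}"
      by (auto simp: saddle_domain_def less_eq_vec_def mem_Times_iff)
  qed
  moreover have "closed ?T"
  proof -
    have "{w::real^'m. \<forall>i. snd z $ i = 0 \<longrightarrow> 0 \<le> w $ i} = (\<Inter>i\<in>{i. snd z $ i = 0}. {w. 0 \<le> w $ i})" by auto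
    then have "closed {w::real^'m. \<forall>i. snd z $ i = 0 \<longrightarrow> 0 \<le> w $ i}"
      by (auto intro!: closed_INT closed_Collect_le continuous_intros)
    then show ?thesis by (intro closed_Times) auto
  qed
  ultimately show ?thesis by (simp add: tangent_cone_def closure_closed)
qed

lemma convex_tangent_cone_saddle_domain:
  assumes "z \<in> saddle_domain UNIV"
  shows "convex (tangent_cone (saddle_domain UNIV) z)"
  unfolding tangent_cone_saddle_domain[OF assms] by (auto simp: convex_def)

text \<open>The cone is a product of lines and half-lines, so the candidate is nearest in every
  coordinate separately and hence in norm; convexity of the cone makes the nearest point
  unique.\<close>

lemma projected_field_saddle_domain:
  fixes z :: "(real^'n) \<times> (real^'m)"
  assumes z: "z \<in> saddle_domain UNIV"
  shows "projected_field (saddle_domain UNIV) F z =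
    (fst (F z), \<chi> i. if snd z $ i = 0 then max 0 (snd (F z) $ i) else snd (F z) $ i)" (is "_ = ?p")
proof -
  let ?T = "tangent_cone (saddle_domain UNIV) z"
  have T: "?T = UNIV \<times> {w. \<forall>i. snd z $ i = 0 \<longrightarrow> 0 \<le> w $ i}"
    using tangent_cone_saddle_domain[OF z] .
  have "?p = closest_point ?T (F z)"
  proof (rule closest_point_unique)
    show "?p \<in> ?T" by (auto simp: T)
    show "\<forall>w\<in>?T. dist (F z) ?p \<le> dist (F z) w"
    proof
      fix w assume w: "w \<in> ?T"
      have "dist (F z) ?p = norm (snd (F z) - snd ?p)"
        by (cases "F z") (simp add: dist_norm norm_Pair)
      also have "\<dots> \<le> norm (snd (F z) - snd w)"
      proof (rule norm_le_componentwise_cart)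
        fix i
        have "snd z $ i = 0 \<Longrightarrow> 0 \<le> snd w $ i" using w T by auto
        then show "norm ((snd (F z) - snd ?p) $ i) \<le> norm ((snd (F z) - snd w) $ i)"
          by (auto simp: max_def)
      qed
      also have "\<dots> \<le> norm (F z - w)"
        using norm_snd_le[of "snd (F z - w)" "fst (F z - w)"] by (simp del: fst_diff snd_diff) simp
      finally show "dist (F z) ?p \<le> dist (F z) w" by (simp add: dist_norm)
    qed
  qed (rule convex_tangent_cone_saddle_domain[OF z], simp add: tangent_cone_def)
  then show ?thesis by (simp add: projected_field_def tangent_proj_eq_closest_point)
qed

lemma norm_projected_field_le:
  assumes z: "z \<in> saddle_domain UNIV"
  shows "norm (projected_field (saddle_domain UNIV) F z) \<le> norm (F z)"
proof -
  have "norm (snd (projected_field (saddle_domain UNIV) F z)) \<le> norm (snd (F z))"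
    by (intro norm_le_componentwise_cart) (auto simp: projected_field_saddle_domain[OF z])
  then show ?thesis
    by (simp add: projected_field_saddle_domain[OF z] norm_prod_def power_mono)
qed

text \<open>The projection changes a coordinate only where \<open>snd z $ i = 0\<close>. There it
  raises the field, while \<open>snd (z - w) $ i\<close> is at most \<open>0\<close>. In other
  words, the removed part lies in the normal cone at \<open>z\<close>.\<close>

lemma inner_projected_field_le:
  fixes z :: "(real^'n) \<times> (real^'m)"
  assumes z: "z \<in> saddle_domain UNIV" and w: "w \<in> saddle_domain UNIV"
  shows "(z - w) \<bullet> projected_field (saddle_domain UNIV) F z \<le> (z - w) \<bullet> F z"
proof -
  have "snd (z - w) \<bullet> snd (projected_field (saddle_domain UNIV) F z) \<le> snd (z - w) \<bullet> snd (F z)"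
    unfolding inner_vec_def
  proof (rule sum_mono)
    fix i
    have "0 \<le> snd z $ i" "0 \<le> snd w $ i" using z w by (auto simp: saddle_domain_def less_eq_vec_def)
    then show "snd (z - w) $ i \<bullet> snd (projected_field (saddle_domain UNIV) F z) $ i
        \<le> snd (z - w) $ i \<bullet> snd (F z) $ i"
      by (auto simp: projected_field_saddle_domain[OF z] mult_left_mono)
  qed
  then show ?thesis
    by (simp add: inner_prod_def projected_field_saddle_domain[OF z])
qed

text \<open>For the saddle field the right-hand side consists of stationarity, primal feasibility
  and complementary slackness.\<close>

lemma projected_field_eq_0_iff:
  fixes z :: "(real^'n) \<times> (real^'m)"
  assumes z: "z \<in> saddle_domain UNIV"
  shows "projected_field (saddle_domain UNIV) F z = 0 \<longleftrightarrow>
    fst (F z) = 0 \<and> snd (F z) \<le> 0 \<and> (\<forall>i. snd z $ i > 0 \<longrightarrow> snd (F z) $ i = 0)"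
proof -
  have nonneg: "0 \<le> snd z $ i" for i using z by (auto simp: saddle_domain_def less_eq_vec_def)
  have "(if snd z $ i = 0 then max 0 (snd (F z) $ i) else snd (F z) $ i) = 0 \<longleftrightarrow>
      snd (F z) $ i \<le> 0 \<and> (snd z $ i > 0 \<longrightarrow> snd (F z) $ i = 0)" for i
    using nonneg[of i] by (auto simp: max_def)
  then show ?thesis
    unfolding projected_field_saddle_domain[OF z]
    by (auto simp: prod_eq_iff vec_eq_iff less_eq_vec_def)
qed

section \<open>Gradients of convex functions\<close>

text \<open>Restriction to the line through \<open>x\<close> and \<open>y\<close> reduces the claim
  to a convex function of one real variable.\<close>

lemma convex_on_ge_tangent:
  fixes f :: "'a::euclidean_space \<Rightarrow> real"
  assumes conv: "convex_on UNIV f" and diff: "f differentiable (at x)"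
  shows "f y \<ge> f x + (y - x) \<bullet> gradient f x"
proof -
  define u where "u t = f (x + t *\<^sub>R (y - x))" for t
  have "convex_on UNIV u"
  proof (rule convex_onI)
    fix t a b :: real assume t: "0 < t" "t < 1"
    have "x + ((1 - t) *\<^sub>R a + t *\<^sub>R b) *\<^sub>R (y - x)
        = (1 - t) *\<^sub>R (x + a *\<^sub>R (y - x)) + t *\<^sub>R (x + b *\<^sub>R (y - x))"
      by (simp add: algebra_simps)
    then show "u ((1 - t) *\<^sub>R a + t *\<^sub>R b) \<le> (1 - t) * u a + t * u b"
      using convex_onD[OF conv, of t] t by (simp add: u_def)
  qed simp
  moreover have "(u has_real_derivative (y - x) \<bullet> gradient f x) (at 0 within UNIV)"
  proof -
    have "(f has_derivative (\<lambda>h. h \<bullet> gradient f x)) (at (x + 0 *\<^sub>R (y - x)))"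
      using GDERIV_gradient[OF diff] by (simp add: gderiv_def)
    moreover have "((\<lambda>t. x + t *\<^sub>R (y - x)) has_derivative (\<lambda>t. t *\<^sub>R (y - x))) (at 0)"
      by (auto intro!: derivative_eq_intros)
    ultimately have "(u has_derivative (\<lambda>t. (t *\<^sub>R (y - x)) \<bullet> gradient f x)) (at 0)"
      unfolding u_def by (rule has_derivative_compose[rotated])
    then show ?thesis by (simp add: has_field_derivative_def mult.commute[of _ "_ \<bullet> _"])
  qed
  ultimately have "u 1 - u 0 \<ge> (y - x) \<bullet> gradient f x * (1 - 0)"
    by (intro convex_on_imp_above_tangent[of UNIV]) auto
  then show ?thesis by (simp add: u_def)
qed

text \<open>Convexity upgrades differentiability to continuous differentiability. If the gradient at
  a nearby \<open>y\<close> were far from \<open>D\<close>, the tangent plane at \<open>y\<close>,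
  evaluated at distance \<open>r\<close> from \<open>x\<close> in the direction of the difference,
  would exceed what differentiability at \<open>x\<close> allows for \<open>f\<close>.\<close>

lemma continuous_on_gradient_convex:
  fixes f :: "'a::euclidean_space \<Rightarrow> real"
  assumes conv: "convex_on UNIV f" and diff: "\<And>x. f differentiable (at x)"
  shows "continuous_on UNIV (gradient f)"
  unfolding continuous_on_iff
proof (intro ballI allI impI)
  fix x :: 'a and e :: real assume "e > 0"
  define D where "D = gradient f x"
  \<comment> \<open>The estimate ends with \<open>4 * e'\<close>, which has to stay strictly below
    \<open>e\<close>.\<close>
  define e' where "e' = e / 5"
  have "e' > 0" using \<open>e > 0\<close> by (simp add: e'_def)
  have "(f has_derivative (\<lambda>h. h \<bullet> D)) (at x)"
    using GDERIV_gradient[OF diff] by (simp add: gderiv_def D_def)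
  then have "\<forall>e>0. \<exists>d>0. \<forall>y. norm (y - x) < d \<longrightarrow> norm (f y - f x - (y - x) \<bullet> D) \<le> e * norm (y - x)"
    unfolding has_derivative_at_alt by blast
  then obtain d where "d > 0"
    and d: "\<And>y. norm (y - x) < d \<Longrightarrow> norm (f y - f x - (y - x) \<bullet> D) \<le> e' * norm (y - x)"
    using \<open>e' > 0\<close> by blast
  define r where "r = d / 2"
  have "r > 0" "r < d" using \<open>d > 0\<close> by (auto simp: r_def)
  have "((\<lambda>y. \<bar>f x - f y\<bar> + norm D * norm (y - x)) \<longlongrightarrow> \<bar>f x - f x\<bar> + norm D * norm (x - x)) (at x)"
    using differentiable_imp_continuous_within[OF diff[of x]] unfolding continuous_within
    by (intro tendsto_intros)
  then have "\<forall>\<^sub>F y in at x. \<bar>f x - f y\<bar> + norm D * norm (y - x) < e' * r"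
    using \<open>e' > 0\<close> \<open>r > 0\<close> by (intro order_tendstoD) auto
  then obtain d1 where "d1 > 0"
    and d1: "\<And>y. y \<noteq> x \<Longrightarrow> dist y x < d1 \<Longrightarrow> \<bar>f x - f y\<bar> + norm D * norm (y - x) < e' * r"
    unfolding eventually_at by blast
  have "dist (gradient f y) D < e" if y: "dist y x < min d1 (r / 2)" for y
  proof (cases "gradient f y = D")
    case False
    then have "y \<noteq> x" by (auto simp: D_def)
    define p where "p = gradient f y"
    \<comment> \<open>The test displacement has length \<open>r\<close> and points along
      \<open>p - D\<close>, which makes \<open>h \<bullet> (p - D)\<close> as large as
      possible.\<close>
    define h where "h = (r / norm (p - D)) *\<^sub>R (p - D)"
    have "p - D \<noteq> 0" using False by (simp add: p_def)
    then have h: "norm h = r" "h \<bullet> (p - D) = r * norm (p - D)"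
      using \<open>r > 0\<close> by (simp_all add: h_def power2_norm_eq_inner[symmetric] power2_eq_square)
    have "norm (f (x + h) - f x - h \<bullet> D) \<le> e' * r"
      using d[of "x + h"] h \<open>r < d\<close> by simp
    moreover have "f (x + h) \<ge> f y + (x + h - y) \<bullet> p"
      unfolding p_def by (rule convex_on_ge_tangent[OF conv diff])
    ultimately have "h \<bullet> (p - D) \<le> f x - f y + (y - x) \<bullet> p + e' * r"
      by (simp add: inner_diff_left inner_diff_right inner_add_left)
    also have "(y - x) \<bullet> p \<le> norm (y - x) * norm p" by (rule norm_cauchy_schwarz)
    also have "norm p \<le> norm (p - D) + norm D" by (metis norm_triangle_sub add.commute)
    finally have "r * norm (p - D) \<le> f x - f y + norm (y - x) * (norm (p - D) + norm D) + e' * r"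
      using h by (simp add: mult_left_mono)
    moreover have "norm (y - x) * norm (p - D) \<le> r / 2 * norm (p - D)"
      using y by (intro mult_right_mono) (auto simp: dist_norm)
    moreover have "\<bar>f x - f y\<bar> + norm D * norm (y - x) < e' * r"
      using d1[OF \<open>y \<noteq> x\<close>] y by simp
    ultimately have "r / 2 * norm (p - D) \<le> 2 * e' * r"
      by (simp add: algebra_simps)
    then have "norm (p - D) \<le> 4 * e'" using \<open>r > 0\<close> by (simp add: field_simps)
    also have "\<dots> < e" using \<open>e > 0\<close> by (simp add: e'_def)
    finally show ?thesis by (simp add: p_def dist_norm)
  qed (use \<open>e > 0\<close> in simp)
  then show "\<exists>d>0. \<forall>y\<in>UNIV. dist y x < d \<longrightarrow> dist (gradient f y) (gradient f x) < e"
    using \<open>d1 > 0\<close> \<open>r > 0\<close> unfolding D_def by (intro exI[of _ "min d1 (r / 2)"]) auto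
qed

section \<open>Trajectories\<close>

lemma trajectory_increment_le:
  fixes \<phi> c :: "real \<Rightarrow> real"
  assumes traj: "trajectory Z F z" and st: "0 \<le> s" "s \<le> t"
    and ac: "abs_continuous_on {s..t} \<phi>" and c: "continuous_on {s..t} c"
    and der: "\<And>\<tau>. \<tau> \<in> {s..t} \<Longrightarrow> (z has_vector_derivative projected_field Z F (z \<tau>)) (at \<tau> within {s..t})
      \<Longrightarrow> \<exists>D\<le>c \<tau>. (\<phi> has_vector_derivative D) (at \<tau> within {s..t})"
  shows "\<phi> t - \<phi> s \<le> integral {s..t} c"
proof (rule abs_continuous_on_increment_le[OF ac st(2) c])
  have "AE \<tau> in lebesgue. \<tau> \<ge> 0 \<longrightarrow>
      (z has_vector_derivative projected_field Z F (z \<tau>)) (at \<tau> within {0..})"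
    using traj by (simp add: trajectory_def)
  then show "AE \<tau> in lebesgue. \<tau> \<in> {s..t} \<longrightarrow> (\<exists>D\<le>c \<tau>. (\<phi> has_vector_derivative D) (at \<tau> within {s..t}))"
  proof (rule eventually_mono, intro impI)
    fix \<tau> assume \<tau>: "\<tau> \<in> {s..t}"
      and "\<tau> \<ge> 0 \<longrightarrow> (z has_vector_derivative projected_field Z F (z \<tau>)) (at \<tau> within {0..})"
    then have "(z has_vector_derivative projected_field Z F (z \<tau>)) (at \<tau> within {s..t})"
      using st(1) has_vector_derivative_within_subset[of z _ \<tau> "{0..}" "{s..t}"] by auto
    with \<tau> show "\<exists>D\<le>c \<tau>. (\<phi> has_vector_derivative D) (at \<tau> within {s..t})"
      by (rule der)
  qed
qed

lemma trajectory_abs_continuous_on: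
  assumes "trajectory Z F z" and "0 \<le> s"
  shows "abs_continuous_on {s..t} z"
  using assms by (auto simp: trajectory_def intro: abs_continuous_on_subset[of "{0..max 0 t}" z])

lemma trajectory_in_domain: "trajectory Z F z \<Longrightarrow> 0 \<le> t \<Longrightarrow> z t \<in> Z"
  by (simp add: trajectory_def)

lemma trajectory_continuous_on:
  assumes "trajectory Z F z"
  shows "continuous_on {0..} z"
proof -
  have "continuous_on {0..T} z" for T
    using assms by (intro abs_continuous_on_imp_continuous_on trajectory_abs_continuous_on) auto
  then have "continuous (at t within {0..t + 1}) z" if "t \<ge> 0" for t
    using that by (auto simp: continuous_on_eq_continuous_within)
  moreover have "at t within {0..t + 1} = at t within {0..}" if "t \<ge> 0" for t :: real
    by (rule at_within_nhd[of t "{..<t + 1}"]) auto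
  ultimately show ?thesis by (auto simp: continuous_on_eq_continuous_within)
qed

text \<open>Scalar observations of a trajectory: axis vectors give its coordinates, and a unit
  vector along a displacement gives the length of the displacement.\<close>

lemma trajectory_inner_increment_le:
  assumes traj: "trajectory Z F z" and st: "0 \<le> s" "s \<le> t" and c: "continuous_on {s..t} c"
    and le: "\<And>\<tau>. \<tau> \<in> {s..t} \<Longrightarrow> projected_field Z F (z \<tau>) \<bullet> e \<le> c \<tau>"
  shows "z t \<bullet> e - z s \<bullet> e \<le> integral {s..t} c"
proof (rule trajectory_increment_le[OF traj st _ c])
  have ac: "abs_continuous_on {s..t} z" using trajectory_abs_continuous_on[OF traj st(1)] .
  show "abs_continuous_on {s..t} (\<lambda>t. z t \<bullet> e)"
  proof (rule abs_continuous_on_dist_le[OF ac ac])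
    fix s t
    have "dist (z s \<bullet> e) (z t \<bullet> e) \<le> norm (z s - z t) * norm e"
      unfolding dist_real_def inner_diff_left[symmetric] by (rule Cauchy_Schwarz_ineq2)
    then show "dist (z s \<bullet> e) (z t \<bullet> e) \<le> norm e / 2 * (dist (z s) (z t) + dist (z s) (z t))"
      by (simp add: dist_norm mult.commute)
  qed
  fix \<tau> assume "\<tau> \<in> {s..t}"
    and der: "(z has_vector_derivative projected_field Z F (z \<tau>)) (at \<tau> within {s..t})"
  have "((\<lambda>t. z t \<bullet> e) has_vector_derivative projected_field Z F (z \<tau>) \<bullet> e) (at \<tau> within {s..t})"
    using bounded_linear.has_vector_derivative[OF bounded_linear_inner_left der] .
  then show "\<exists>D\<le>c \<tau>. ((\<lambda>t. z t \<bullet> e) has_vector_derivative D) (at \<tau> within {s..t})"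
    using le[OF \<open>\<tau> \<in> {s..t}\<close>] by blast
qed

lemma has_vector_derivative_half_sq_norm:
  fixes u :: "real \<Rightarrow> 'a::real_inner"
  assumes "(u has_vector_derivative u') (at t within S)"
  shows "((\<lambda>t. (norm (u t))\<^sup>2 / 2) has_vector_derivative u t \<bullet> u') (at t within S)"
  using assms unfolding power2_norm_eq_inner has_vector_derivative_def
  by (auto intro!: derivative_eq_intros simp: inner_commute)

lemma trajectory_energy_le:
  assumes traj: "trajectory Z F z" and st: "0 \<le> s" "s \<le> t" and c: "continuous_on {s..t} c"
    and le: "\<And>\<tau>. \<tau> \<in> {s..t} \<Longrightarrow> (z \<tau> - v) \<bullet> projected_field Z F (z \<tau>) \<le> c \<tau>"
  shows "(norm (z t - v))\<^sup>2 / 2 - (norm (z s - v))\<^sup>2 / 2 \<le> integral {s..t} c"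
proof (rule trajectory_increment_le[OF traj st _ c])
  show "abs_continuous_on {s..t} (\<lambda>t. (norm (z t - v))\<^sup>2 / 2)"
    by (intro abs_continuous_on_half_sq_norm trajectory_abs_continuous_on[OF traj st(1)]
        abs_continuous_on_lipschitz[where C = 0]) auto
  fix \<tau> assume "\<tau> \<in> {s..t}"
    and der: "(z has_vector_derivative projected_field Z F (z \<tau>)) (at \<tau> within {s..t})"
  have "((\<lambda>t. (norm (z t - v))\<^sup>2 / 2) has_vector_derivative (z \<tau> - v) \<bullet> projected_field Z F (z \<tau>)) (at \<tau> within {s..t})"
    by (rule has_vector_derivative_half_sq_norm) (auto intro!: derivative_eq_intros der)
  then show "\<exists>D\<le>c \<tau>. ((\<lambda>t. (norm (z t - v))\<^sup>2 / 2) has_vector_derivative D) (at \<tau> within {s..t})"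
    using le[OF \<open>\<tau> \<in> {s..t}\<close>] by blast
qed

lemma trajectory_dist_nondecreasing:
  assumes traj: "trajectory Z F z" and st: "0 \<le> s" "s \<le> t"
    and ge: "\<And>\<tau>. \<tau> \<in> {s..t} \<Longrightarrow> (z \<tau> - v) \<bullet> projected_field Z F (z \<tau>) \<ge> 0"
  shows "norm (z s - v) \<le> norm (z t - v)"
proof -
  have ac: "abs_continuous_on {s..t} (\<lambda>t. (norm (z t - v))\<^sup>2 / 2)"
    by (intro abs_continuous_on_half_sq_norm trajectory_abs_continuous_on[OF traj st(1)]
        abs_continuous_on_lipschitz[where C = 0]) auto
  \<comment> \<open>The increment estimate bounds growth only from above, so it is applied to the
    negated energy.\<close>
  have "- ((norm (z t - v))\<^sup>2 / 2) - - ((norm (z s - v))\<^sup>2 / 2) \<le> integral {s..t} (\<lambda>_. 0)"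
  proof (rule trajectory_increment_le[OF traj st])
    show "abs_continuous_on {s..t} (\<lambda>t. - ((norm (z t - v))\<^sup>2 / 2))"
      by (rule abs_continuous_on_dist_le[OF ac ac, of _ "1 / 2"]) (simp add: dist_real_def abs_minus_commute)
    fix \<tau> assume "\<tau> \<in> {s..t}"
      and der: "(z has_vector_derivative projected_field Z F (z \<tau>)) (at \<tau> within {s..t})"
    have "((\<lambda>t. (norm (z t - v))\<^sup>2 / 2) has_vector_derivative (z \<tau> - v) \<bullet> projected_field Z F (z \<tau>)) (at \<tau> within {s..t})"
      by (rule has_vector_derivative_half_sq_norm) (auto intro!: derivative_eq_intros der)
    then have "((\<lambda>t. - ((norm (z t - v))\<^sup>2 / 2)) has_vector_derivative - ((z \<tau> - v) \<bullet> projected_field Z F (z \<tau>))) (at \<tau> within {s..t})"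
      by (rule has_vector_derivative_minus)
    then show "\<exists>D\<le>0. ((\<lambda>t. - ((norm (z t - v))\<^sup>2 / 2)) has_vector_derivative D) (at \<tau> within {s..t})"
      using ge[OF \<open>\<tau> \<in> {s..t}\<close>] by (intro exI[of _ "- ((z \<tau> - v) \<bullet> projected_field Z F (z \<tau>))"]) auto
  qed simp
  then have "(norm (z s - v))\<^sup>2 \<le> (norm (z t - v))\<^sup>2" by simp
  then show ?thesis by (rule power2_le_imp_le) simp
qed

lemma trajectory_lipschitz:
  assumes traj: "trajectory Z F z" and st: "0 \<le> s" "0 \<le> t"
    and le: "\<And>\<tau>. \<tau> \<ge> 0 \<Longrightarrow> norm (projected_field Z F (z \<tau>)) \<le> B"
  shows "norm (z t - z s) \<le> B * \<bar>t - s\<bar>"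
proof -
  have main: "norm (z t - z s) \<le> B * (t - s)" if "0 \<le> s" "s \<le> t" for s t
  proof (cases "z t = z s")
    case True
    have "B \<ge> 0" using le[of 0] norm_ge_zero order_trans by blast
    with True that show ?thesis by simp
  next
    case False
    \<comment> \<open>Testing the displacement with its own direction turns the scalar estimate into
      one for the norm.\<close>
    define e where "e = sgn (z t - z s)"
    have "norm e = 1" using False by (simp add: e_def norm_sgn)
    have "z t \<bullet> e - z s \<bullet> e \<le> integral {s..t} (\<lambda>_. B)"
    proof (rule trajectory_inner_increment_le[OF traj that])
      fix \<tau> assume "\<tau> \<in> {s..t}"
      then show "projected_field Z F (z \<tau>) \<bullet> e \<le> B"
        using norm_cauchy_schwarz[of "projected_field Z F (z \<tau>)" e] le[of \<tau>] that \<open>norm e = 1\<close> by auto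
    qed simp
    moreover have "z t \<bullet> e - z s \<bullet> e = norm (z t - z s)"
      unfolding inner_diff_left[symmetric] e_def sgn_div_norm
      using False by (simp add: power2_norm_eq_inner[symmetric] power2_eq_square)
    ultimately show ?thesis using that by (simp add: mult.commute)
  qed
  show ?thesis
  proof (cases "s \<le> t")
    case False
    then show ?thesis using main[of t s] st by (simp add: norm_minus_commute)
  qed (use main st in simp)
qed

text \<open>Although the field is discontinuous, its monotonicity gives half the squared distance of
  two solutions a nonpositive derivative almost everywhere. For equal initial values this is forward
  uniqueness.\<close>

lemma trajectory_dist_nonincreasing:
  assumes y: "trajectory Z F y" and z: "trajectory Z F z" and st: "0 \<le> s" "s \<le> t"
    and mono: "\<And>u v. u \<in> Z \<Longrightarrow> v \<in> Z \<Longrightarrow> (u - v) \<bullet> (projected_field Z F u - projected_field Z F v) \<le> 0"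
  shows "dist (y t) (z t) \<le> dist (y s) (z s)"
proof -
  have "(norm (y t - z t))\<^sup>2 / 2 \<le> (norm (y s - z s))\<^sup>2 / 2"
  proof (rule abs_continuous_on_AE_deriv_nonpos[of s t "\<lambda>t. (norm (y t - z t))\<^sup>2 / 2", OF _ st(2)])
    show "abs_continuous_on {s..t} (\<lambda>t. (norm (y t - z t))\<^sup>2 / 2)"
      by (intro abs_continuous_on_half_sq_norm trajectory_abs_continuous_on[OF y st(1)]
          trajectory_abs_continuous_on[OF z st(1)])
    have "AE \<tau> in lebesgue. (\<tau> \<ge> 0 \<longrightarrow> (y has_vector_derivative projected_field Z F (y \<tau>)) (at \<tau> within {0..}))
        \<and> (\<tau> \<ge> 0 \<longrightarrow> (z has_vector_derivative projected_field Z F (z \<tau>)) (at \<tau> within {0..}))"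
      using y z by (simp add: trajectory_def)
    then show "AE \<tau> in lebesgue. \<tau> \<in> {s..t} \<longrightarrow>
        (\<exists>D\<le>0. ((\<lambda>t. (norm (y t - z t))\<^sup>2 / 2) has_vector_derivative D) (at \<tau> within {s..t}))"
    proof (rule AE_mp, intro AE_I2 impI)
      fix \<tau> assume \<tau>: "\<tau> \<in> {s..t}"
        and der: "(\<tau> \<ge> 0 \<longrightarrow> (y has_vector_derivative projected_field Z F (y \<tau>)) (at \<tau> within {0..}))
        \<and> (\<tau> \<ge> 0 \<longrightarrow> (z has_vector_derivative projected_field Z F (z \<tau>)) (at \<tau> within {0..}))"
      have sub: "{s..t} \<subseteq> {0..}" and "\<tau> \<ge> 0" using st(1) \<tau> by auto
      have "((\<lambda>t. y t - z t) has_vector_derivative projected_field Z F (y \<tau>) - projected_field Z F (z \<tau>)) (at \<tau> within {s..t})"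
        using der \<open>\<tau> \<ge> 0\<close> by (intro has_vector_derivative_diff) (auto intro: has_vector_derivative_within_subset[OF _ sub])
      from has_vector_derivative_half_sq_norm[OF this]
      show "\<exists>D\<le>0. ((\<lambda>t. (norm (y t - z t))\<^sup>2 / 2) has_vector_derivative D) (at \<tau> within {s..t})"
        using mono[of "y \<tau>" "z \<tau>"] trajectory_in_domain[OF y \<open>\<tau> \<ge> 0\<close>] trajectory_in_domain[OF z \<open>\<tau> \<ge> 0\<close>] by blast
    qed
  qed
  then have "(norm (y t - z t))\<^sup>2 \<le> (norm (y s - z s))\<^sup>2" by simp
  then show ?thesis unfolding dist_norm by (rule power2_le_imp_le) simp
qed

lemma trajectory_const:
  assumes "p \<in> equilibria Z F"
  shows "trajectory Z F (\<lambda>_. p)"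
  using assms by (auto simp: trajectory_def equilibria_def intro!: abs_continuous_on_lipschitz[where C = 0])

lemma trajectory_shift:
  assumes traj: "trajectory Z F z" and "s \<ge> 0"
  shows "trajectory Z F (\<lambda>t. z (s + t))"
  unfolding trajectory_def
proof (intro conjI allI impI)
  show "z (s + t) \<in> Z" if "t \<ge> 0" for t
    using trajectory_in_domain[OF traj] that \<open>s \<ge> 0\<close> by simp
  show "abs_continuous_on {0..T} (\<lambda>t. z (s + t))" for T
    unfolding abs_continuous_on_def
  proof (intro allI impI)
    fix e :: real assume "e > 0"
    then obtain d where "d > 0" and d: "\<forall>(N::nat) a b. (\<forall>k<N. a k \<le> b k \<and> {a k..b k} \<subseteq> {s..s + T})
         \<and> disjoint_family_on (\<lambda>k. {a k<..<b k}) {..<N} \<and> (\<Sum>k<N. b k - a k) < d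
         \<longrightarrow> (\<Sum>k<N. dist (z (a k)) (z (b k))) < e"
      using trajectory_abs_continuous_on[OF assms] unfolding abs_continuous_on_def by blast
    show "\<exists>d>0. \<forall>(N::nat) a b. (\<forall>k<N. a k \<le> b k \<and> {a k..b k} \<subseteq> {0..T})
         \<and> disjoint_family_on (\<lambda>k. {a k<..<b k}) {..<N} \<and> (\<Sum>k<N. b k - a k) < d
         \<longrightarrow> (\<Sum>k<N. dist (z (s + a k)) (z (s + b k))) < e"
    proof (intro exI[of _ d] conjI allI impI \<open>d > 0\<close>)
      fix N :: nat and a b :: "nat \<Rightarrow> real"
      assume *: "(\<forall>k<N. a k \<le> b k \<and> {a k..b k} \<subseteq> {0..T})
         \<and> disjoint_family_on (\<lambda>k. {a k<..<b k}) {..<N} \<and> (\<Sum>k<N. b k - a k) < d"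
      have "disjoint_family_on (\<lambda>k. {s + a k<..<s + b k}) {..<N}"
        unfolding disjoint_family_on_def
      proof (intro ballI impI)
        fix m n assume "m \<in> {..<N}" "n \<in> {..<N}" "m \<noteq> n"
        then have "{a m<..<b m} \<inter> {a n<..<b n} = {}" using * unfolding disjoint_family_on_def by blast
        then have "(+) s ` ({a m<..<b m} \<inter> {a n<..<b n}) = {}" by (simp only: image_empty)
        then show "{s + a m<..<s + b m} \<inter> {s + a n<..<s + b n} = {}"
          by (simp add: image_Int)
      qed
      then show "(\<Sum>k<N. dist (z (s + a k)) (z (s + b k))) < e"
        using d[rule_format, of N "\<lambda>k. s + a k" "\<lambda>k. s + b k"] * by auto
    qed
  qed
  have "AE t in lebesgue. t \<ge> 0 \<longrightarrow> (z has_vector_derivative projected_field Z F (z t)) (at t within {0..})"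
    using traj by (simp add: trajectory_def)
  then obtain N where N: "negligible N"
    and der: "\<And>t. t \<ge> 0 \<Longrightarrow> t \<notin> N \<Longrightarrow> (z has_vector_derivative projected_field Z F (z t)) (at t within {0..})"
    by (auto elim!: AE_E3 simp: negligible_iff_null_sets)
  \<comment> \<open>The exceptional times of the shifted curve are those of \<open>z\<close> moved
    back by \<open>s\<close>.\<close>
  have "negligible ((+) (- s) ` N)" using N by (rule negligible_translation)
  then have null: "(+) (- s) ` N \<in> null_sets lebesgue" by (simp add: negligible_iff_null_sets)
  show "AE t in lebesgue. t \<ge> 0 \<longrightarrow>
      ((\<lambda>t. z (s + t)) has_vector_derivative projected_field Z F (z (s + t))) (at t within {0..})"
  proof (rule AE_I'[OF null], intro subsetI)
    fix t assume "t \<in> {t \<in> space lebesgue. \<not> (t \<ge> 0 \<longrightarrow>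
        ((\<lambda>t. z (s + t)) has_vector_derivative projected_field Z F (z (s + t))) (at t within {0..}))}"
    then have t: "t \<ge> 0" "\<not> ((\<lambda>t. z (s + t)) has_vector_derivative projected_field Z F (z (s + t))) (at t within {0..})"
      by auto
    have "s + t \<in> N"
    proof (rule ccontr)
      assume "s + t \<notin> N"
      then have "(z has_vector_derivative projected_field Z F (z (s + t))) (at (s + t) within {0..})"
        using der t(1) \<open>s \<ge> 0\<close> by simp
      then have "(z has_vector_derivative projected_field Z F (z (s + t))) (at (s + t) within (\<lambda>t. s + t) ` {0..})"
        by (rule has_vector_derivative_within_subset) (use \<open>s \<ge> 0\<close> in auto)
      moreover have "((\<lambda>t. s + t) has_vector_derivative 1) (at t within {0..})"
        by (auto intro!: derivative_eq_intros)
      ultimately show False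
        using vector_diff_chain_within[of "\<lambda>t. s + t" 1 t "{0..}" z "projected_field Z F (z (s + t))"] t(2)
        by (simp add: comp_def)
    qed
    then show "t \<in> (+) (- s) ` N" by (auto intro!: image_eqI[of _ _ "s + t"])
  qed
qed

section \<open>Existence of trajectories for bounded fields\<close>

lemma linear_recursion_bound:
  fixes x :: "nat \<Rightarrow> 'a::real_normed_vector"
  assumes "h \<ge> 0" and "\<And>l. l < k \<Longrightarrow> x (Suc l) = x l + h *\<^sub>R q l"
    and "\<And>l. l < k \<Longrightarrow> norm (q l - p) \<le> e"
  shows "norm (x k - x 0 - (real k * h) *\<^sub>R p) \<le> real k * h * e"
  using assms(2,3)
proof (induction k)
  case (Suc k)
  have "x (Suc k) - x 0 - (real (Suc k) * h) *\<^sub>R p = (x k - x 0 - (real k * h) *\<^sub>R p) + h *\<^sub>R (q k - p)"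
    using Suc.prems(1)[of k] by (simp add: algebra_simps)
  also have "norm \<dots> \<le> norm (x k - x 0 - (real k * h) *\<^sub>R p) + norm (h *\<^sub>R (q k - p))"
    by (rule norm_triangle_ineq)
  also have "\<dots> \<le> real k * h * e + h * e"
  proof (rule add_mono)
    show "norm (x k - x 0 - (real k * h) *\<^sub>R p) \<le> real k * h * e"
      using Suc.prems by (intro Suc.IH) auto
    show "norm (h *\<^sub>R (q k - p)) \<le> h * e"
      using Suc.prems(2)[of k] \<open>h \<ge> 0\<close> by (simp add: mult_left_mono)
  qed
  finally show ?case by (simp add: algebra_simps)
qed simp

text \<open>Reflection at \<open>0\<close> only pushes \<open>m\<close> upwards, which gives the
  lower bound. In the upper bound a negative slope may be lost to the reflection, so only
  \<open>max 0 p\<close> can be guaranteed.\<close>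

lemma reflected_recursion_bounds:
  fixes m :: "nat \<Rightarrow> real"
  assumes "h \<ge> 0" and m: "\<And>l. l < k \<Longrightarrow> m (Suc l) = max 0 (m l + h * q l)"
    and q: "\<And>l. l < k \<Longrightarrow> \<bar>q l - p\<bar> \<le> e" and "e \<ge> 0" and "m 0 \<ge> 0"
  shows "m k - m 0 \<ge> real k * h * (p - e)" and "m k - m 0 \<le> real k * h * (max 0 p + e)"
proof -
  show "m k - m 0 \<ge> real k * h * (p - e)"
    using m q
  proof (induction k)
    case (Suc k)
    have "m (Suc k) \<ge> m k + h * q k" using Suc.prems(1)[of k] by simp
    moreover have "h * q k \<ge> h * (p - e)"
      using Suc.prems(2)[of k] \<open>h \<ge> 0\<close> by (intro mult_left_mono) (auto simp: abs_le_iff)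
    moreover have "m k - m 0 \<ge> real k * h * (p - e)" using Suc.prems by (intro Suc.IH) auto
    ultimately show ?case by (simp add: algebra_simps)
  qed simp
  show "m k - m 0 \<le> real k * h * (max 0 p + e)"
    using m q
  proof (induction k)
    case (Suc k)
    have "m k \<ge> 0" using Suc.prems(1)[of "k - 1"] \<open>m 0 \<ge> 0\<close> by (cases k) auto
    have "h * q k \<le> h * (max 0 p + e)"
      using Suc.prems(2)[of k] \<open>h \<ge> 0\<close> by (intro mult_left_mono) (auto simp: abs_le_iff)
    moreover have "0 \<le> h * (max 0 p + e)" using \<open>h \<ge> 0\<close> \<open>e \<ge> 0\<close> by simp
    ultimately have "m (Suc k) \<le> m k + h * (max 0 p + e)" using Suc.prems(1)[of k] \<open>m k \<ge> 0\<close> by simp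
    moreover have "m k - m 0 \<le> real k * h * (max 0 p + e)" using Suc.prems by (intro Suc.IH) auto
    ultimately show ?case by (simp add: algebra_simps)
  qed simp
qed

text \<open>The increments are linearized at the left end of each interval. To the right of
  \<open>t\<close> this end is \<open>t\<close> itself; to the left it is the moving point
  \<open>u\<close>, and continuity of \<open>p\<close> replaces \<open>p u\<close> by
  \<open>p t\<close>.\<close>

lemma has_vector_derivative_of_uniform_increments:
  fixes x p :: "real \<Rightarrow> 'a::real_normed_vector"
  assumes incr: "\<And>e. e > 0 \<Longrightarrow> \<exists>d>0. \<forall>s u. 0 \<le> s \<longrightarrow> s \<le> u \<longrightarrow> \<bar>s - t\<bar> < d \<longrightarrow> \<bar>u - t\<bar> < d \<longrightarrow>
      norm (x u - x s - (u - s) *\<^sub>R p s) \<le> e * (u - s)"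
    and p: "continuous (at t within {0..}) p" and "t \<ge> 0"
  shows "(x has_vector_derivative p t) (at t within {0..})"
  unfolding has_vector_derivative_def has_derivative_within_alt
proof (intro conjI allI impI)
  show "bounded_linear (\<lambda>h. h *\<^sub>R p t)" by (rule bounded_linear_scaleR_left)
  fix e :: real assume "e > 0"
  then have "e / 2 > 0" by simp
  then obtain d1 where "d1 > 0" and d1: "\<And>s u. 0 \<le> s \<Longrightarrow> s \<le> u \<Longrightarrow> \<bar>s - t\<bar> < d1 \<Longrightarrow> \<bar>u - t\<bar> < d1 \<Longrightarrow>
      norm (x u - x s - (u - s) *\<^sub>R p s) \<le> e / 2 * (u - s)"
    using incr[of "e / 2"] by blast
  obtain d2 where "d2 > 0" and d2: "\<And>s. s \<ge> 0 \<Longrightarrow> dist s t < d2 \<Longrightarrow> dist (p s) (p t) < e / 2"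
    using p \<open>e / 2 > 0\<close> unfolding continuous_within_eps_delta by (meson atLeast_iff)
  show "\<exists>d>0. \<forall>u\<in>{0..}. norm (u - t) < d \<longrightarrow> norm (x u - x t - (u - t) *\<^sub>R p t) \<le> e * norm (u - t)"
  proof (intro exI[of _ "min d1 d2"] conjI ballI impI)
    show "min d1 d2 > 0" using \<open>d1 > 0\<close> \<open>d2 > 0\<close> by simp
    fix u :: real assume u: "u \<in> {0..}" "norm (u - t) < min d1 d2"
    show "norm (x u - x t - (u - t) *\<^sub>R p t) \<le> e * norm (u - t)"
    proof (cases "t \<le> u")
      case True
      then have "norm (x u - x t - (u - t) *\<^sub>R p t) \<le> e / 2 * (u - t)"
        using u \<open>t \<ge> 0\<close> \<open>d1 > 0\<close> by (intro d1) auto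
      also have "\<dots> \<le> e * (u - t)" using True \<open>e > 0\<close> by (intro mult_right_mono) auto
      finally show ?thesis using True by simp
    next
      case False
      have 1: "norm (x t - x u - (t - u) *\<^sub>R p u) \<le> e / 2 * (t - u)"
        using u False \<open>d1 > 0\<close> by (intro d1) auto
      have "norm (p u - p t) \<le> e / 2"
        using d2[of u] u by (auto simp: dist_norm)
      then have 2: "norm ((t - u) *\<^sub>R (p u - p t)) \<le> e / 2 * (t - u)"
        using False by (simp add: mult_left_mono mult.commute)
      have "x u - x t - (u - t) *\<^sub>R p t = - ((x t - x u - (t - u) *\<^sub>R p u) + (t - u) *\<^sub>R (p u - p t))"
        by (simp add: algebra_simps)
      then have "norm (x u - x t - (u - t) *\<^sub>R p t)
          \<le> norm (x t - x u - (t - u) *\<^sub>R p u) + norm ((t - u) *\<^sub>R (p u - p t))"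
        by (simp only: norm_minus_cancel norm_triangle_ineq)
      with 1 2 have "norm (x u - x t - (u - t) *\<^sub>R p t) \<le> e * (t - u)"
        by (simp add: field_simps)
      then show ?thesis using False by simp
    qed
  qed
qed

text \<open>The bound \<open>B\<close> limits the speed of all approximations at once, and uniform
  continuity gives one modulus for all starting points and steps.\<close>

locale bounded_field =
  fixes G :: "(real^'n) \<times> (real^'m) \<Rightarrow> (real^'n) \<times> (real^'m)" and B :: real
  assumes bound: "z \<in> saddle_domain UNIV \<Longrightarrow> norm (G z) \<le> B"
    and uc: "uniformly_continuous_on (saddle_domain UNIV) G"
begin

text \<open>An explicit Euler step followed by the metric projection onto the domain, which acts as
  \<open>pos_part\<close> on the multipliers.\<close>

definition euler_step :: "real \<Rightarrow> (real^'n) \<times> (real^'m) \<Rightarrow> (real^'n) \<times> (real^'m)" where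
  "euler_step h z = (fst z + h *\<^sub>R fst (G z), pos_part (snd z + h *\<^sub>R snd (G z)))"

definition euler :: "(real^'n) \<times> (real^'m) \<Rightarrow> real \<Rightarrow> nat \<Rightarrow> (real^'n) \<times> (real^'m)" where
  "euler z0 h j = (euler_step h ^^ j) z0"

lemma euler_Suc: "euler z0 h (Suc j) = euler_step h (euler z0 h j)"
  by (simp add: euler_def)

lemma euler_in_domain: "z0 \<in> saddle_domain UNIV \<Longrightarrow> euler z0 h j \<in> saddle_domain UNIV"
  by (induction j) (auto simp: euler_def euler_step_def saddle_domain_def pos_part_def less_eq_vec_def)

lemma B_nonneg: "B \<ge> 0"
proof -
  have "(0 :: (real^'n) \<times> (real^'m)) \<in> saddle_domain UNIV" by (simp add: saddle_domain_def zero_prod_def)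
  then show ?thesis using bound norm_ge_zero order_trans by blast
qed

text \<open>Since \<open>z\<close> itself lies in the domain, cutting the step off at the boundary
  cannot lengthen it in any coordinate.\<close>

lemma norm_euler_step:
  assumes "z \<in> saddle_domain UNIV" and "h \<ge> 0"
  shows "norm (euler_step h z - z) \<le> h * B"
proof -
  have "norm (euler_step h z - z) \<le> norm (h *\<^sub>R G z)"
  proof -
    have "norm (snd (euler_step h z - z)) \<le> norm (snd (h *\<^sub>R G z))"
    proof (rule norm_le_componentwise_cart)
      fix i
      have "0 \<le> snd z $ i" using assms(1) by (auto simp: saddle_domain_def less_eq_vec_def)
      then show "norm (snd (euler_step h z - z) $ i) \<le> norm (snd (h *\<^sub>R G z) $ i)"
        by (simp add: euler_step_def pos_part_def)
    qed
    moreover have "fst (euler_step h z - z) = fst (h *\<^sub>R G z)" by (simp add: euler_step_def)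
    ultimately show ?thesis unfolding norm_prod_def by (simp add: power_mono)
  qed
  also have "\<dots> \<le> h * B" using bound[OF assms(1)] \<open>h \<ge> 0\<close> by (simp add: mult_left_mono)
  finally show ?thesis .
qed

lemma norm_euler_diff:
  assumes "z0 \<in> saddle_domain UNIV" and "h \<ge> 0"
  shows "norm (euler z0 h (i + k) - euler z0 h i) \<le> real k * h * B"
proof (induction k)
  case (Suc k)
  have "norm (euler z0 h (i + Suc k) - euler z0 h i)
      \<le> norm (euler z0 h (i + Suc k) - euler z0 h (i + k)) + norm (euler z0 h (i + k) - euler z0 h i)"
    using norm_triangle_ineq[of "euler z0 h (i + Suc k) - euler z0 h (i + k)" "euler z0 h (i + k) - euler z0 h i"]
    by simp
  also have "norm (euler z0 h (i + Suc k) - euler z0 h (i + k)) \<le> h * B"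
    using norm_euler_step[OF euler_in_domain[OF assms(1)] assms(2)] by (simp add: euler_Suc)
  finally show ?case using Suc.IH by (simp add: algebra_simps)
qed simp

text \<open>In \<open>k\<close> steps the iterates travel at most \<open>real k * h * B\<close>,
  which is below \<open>d\<close>, so \<open>G\<close> stays within \<open>e\<close> of its initial
  value. The last estimate is the interior case: a coordinate that starts above this travel distance
  is never reflected.\<close>

lemma euler_increments:
  assumes z0: "z0 \<in> saddle_domain UNIV" and "h \<ge> 0" and "e \<ge> 0"
    and d: "\<And>u v. u \<in> saddle_domain UNIV \<Longrightarrow> v \<in> saddle_domain UNIV \<Longrightarrow> dist u v < d \<Longrightarrow> dist (G u) (G v) < e"
    and small: "real k * h * B < d"
  defines "w \<equiv> euler z0 h"
  shows "norm (fst (w (i + k)) - fst (w i) - (real k * h) *\<^sub>R fst (G (w i))) \<le> real k * h * e"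
    and "snd (w (i + k)) $ c - snd (w i) $ c \<ge> real k * h * (snd (G (w i)) $ c - e)"
    and "snd (w (i + k)) $ c - snd (w i) $ c \<le> real k * h * (max 0 (snd (G (w i)) $ c) + e)"
    and "snd (w i) $ c > real k * h * B \<Longrightarrow>
      \<bar>snd (w (i + k)) $ c - snd (w i) $ c - real k * h * snd (G (w i)) $ c\<bar> \<le> real k * h * e"
proof -
  have wZ: "w j \<in> saddle_domain UNIV" for j unfolding w_def by (rule euler_in_domain[OF z0])
  have near: "norm (G (w (i + l)) - G (w i)) \<le> e" if "l < k" for l
  proof -
    have "dist (w (i + l)) (w i) \<le> real l * h * B"
      unfolding w_def dist_norm by (rule norm_euler_diff[OF z0 \<open>h \<ge> 0\<close>])
    also have "\<dots> \<le> real k * h * B"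
      using that \<open>h \<ge> 0\<close> B_nonneg by (intro mult_right_mono) auto
    finally show ?thesis using d[OF wZ wZ, of "i + l" i] small by (simp add: dist_norm)
  qed
  have "norm (fst (G (w (i + l))) - fst (G (w i))) \<le> e" if "l < k" for l
    using near[OF that] norm_fst_le[of "fst (G (w (i + l)) - G (w i))" "snd (G (w (i + l)) - G (w i))"]
    by (simp del: fst_diff snd_diff) (simp add: fst_diff)
  then show "norm (fst (w (i + k)) - fst (w i) - (real k * h) *\<^sub>R fst (G (w i))) \<le> real k * h * e"
    using linear_recursion_bound[OF \<open>h \<ge> 0\<close>, of k "\<lambda>l. fst (w (i + l))" "\<lambda>l. fst (G (w (i + l)))" "fst (G (w i))" e]
    by (simp add: w_def euler_Suc euler_step_def)
  have near': "\<bar>snd (G (w (i + l))) $ c - snd (G (w i)) $ c\<bar> \<le> e" if "l < k" for l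
  proof -
    have "\<bar>snd (G (w (i + l)) - G (w i)) $ c\<bar> \<le> norm (snd (G (w (i + l)) - G (w i)))"
      by (rule component_le_norm_cart)
    also have "\<dots> \<le> norm (G (w (i + l)) - G (w i))"
      using norm_snd_le[of "snd (G (w (i + l)) - G (w i))" "fst (G (w (i + l)) - G (w i))"]
      by (simp del: fst_diff snd_diff)
    also note near[OF that]
    finally show ?thesis by simp
  qed
  have rec: "snd (w (i + Suc l)) $ c = max 0 (snd (w (i + l)) $ c + h * snd (G (w (i + l))) $ c)" for l
    by (simp add: w_def euler_Suc euler_step_def pos_part_def)
  have nonneg: "snd (w j) $ c \<ge> 0" for j
    using wZ[of j] by (auto simp: saddle_domain_def less_eq_vec_def)
  show "snd (w (i + k)) $ c - snd (w i) $ c \<ge> real k * h * (snd (G (w i)) $ c - e)"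
    "snd (w (i + k)) $ c - snd (w i) $ c \<le> real k * h * (max 0 (snd (G (w i)) $ c) + e)"
    using reflected_recursion_bounds[OF \<open>h \<ge> 0\<close>, of k "\<lambda>l. snd (w (i + l)) $ c"
        "\<lambda>l. snd (G (w (i + l))) $ c" "snd (G (w i)) $ c" e] rec near' \<open>e \<ge> 0\<close> nonneg by auto
  assume pos: "snd (w i) $ c > real k * h * B"
  have "snd (w (i + Suc l)) $ c = snd (w (i + l)) $ c + h * snd (G (w (i + l))) $ c" if "l < k" for l
  proof -
    have "\<bar>snd (w (i + l)) $ c - snd (w i) $ c\<bar> \<le> norm (w (i + l) - w i)"
      using component_le_norm_cart[of "snd (w (i + l) - w i)" c] norm_snd_le[of "snd (w (i + l) - w i)" "fst (w (i + l) - w i)"]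
      by (simp del: fst_diff snd_diff) (simp add: snd_diff)
    also have "\<dots> \<le> real l * h * B"
      unfolding w_def by (rule norm_euler_diff[OF z0 \<open>h \<ge> 0\<close>])
    finally have 1: "snd (w (i + l)) $ c \<ge> snd (w i) $ c - real l * h * B" by linarith
    have "\<bar>snd (G (w (i + l))) $ c\<bar> \<le> norm (G (w (i + l)))"
      using component_le_norm_cart[of "snd (G (w (i + l)))" c] norm_snd_le[of "snd (G (w (i + l)))" "fst (G (w (i + l)))"]
      by simp
    also have "\<dots> \<le> B" using bound[OF wZ] .
    finally have "h * snd (G (w (i + l))) $ c \<ge> h * (- B)"
      using \<open>h \<ge> 0\<close> by (intro mult_left_mono) auto
    moreover have "real k * h * B \<ge> real (Suc l) * h * B"
      using that \<open>h \<ge> 0\<close> B_nonneg by (intro mult_right_mono) auto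
    ultimately have "snd (w (i + l)) $ c + h * snd (G (w (i + l))) $ c \<ge> 0"
      using 1 pos by (simp add: algebra_simps)
    then show ?thesis unfolding rec by simp
  qed
  then show "\<bar>snd (w (i + k)) $ c - snd (w i) $ c - real k * h * snd (G (w i)) $ c\<bar> \<le> real k * h * e"
    using linear_recursion_bound[OF \<open>h \<ge> 0\<close>, of k "\<lambda>l. snd (w (i + l)) $ c" "\<lambda>l. snd (G (w (i + l))) $ c" "snd (G (w i)) $ c" e]
      near' by simp
qed

end

section \<open>Convergence of the Euler scheme along a subsequence\<close>

context bounded_field
begin

text \<open>Piecewise constant in time with mesh \<open>1 / (n + 1)\<close>: all values are
  iterates, so the estimates for the recursion apply directly, and the jumps shrink with the
  mesh.\<close>

definition euler_path :: "(real^'n) \<times> (real^'m) \<Rightarrow> nat \<Rightarrow> real \<Rightarrow> (real^'n) \<times> (real^'m)" where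
  "euler_path z0 n t = euler z0 (inverse (real (Suc n))) (nat \<lfloor>t * real (Suc n)\<rfloor>)"

text \<open>The last mesh point not after \<open>t\<close>. The time covered by the steps between
  \<open>s\<close> and \<open>t\<close> is a difference of such points, which equals
  \<open>t - s\<close> only in the limit.\<close>

definition grid_time :: "nat \<Rightarrow> real \<Rightarrow> real" where
  "grid_time n t = real (nat \<lfloor>t * real (Suc n)\<rfloor>) * inverse (real (Suc n))"

lemma grid_time_bounds:
  assumes "t \<ge> 0"
  shows "grid_time n t \<le> t" and "t \<le> grid_time n t + inverse (real (Suc n))"
proof -
  have "real (nat \<lfloor>t * real (Suc n)\<rfloor>) = of_int \<lfloor>t * real (Suc n)\<rfloor>"
    using assms by simp
  then have "real (nat \<lfloor>t * real (Suc n)\<rfloor>) \<le> t * real (Suc n)"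
    "t * real (Suc n) \<le> real (nat \<lfloor>t * real (Suc n)\<rfloor>) + 1"
    by linarith+
  then show "grid_time n t \<le> t" "t \<le> grid_time n t + inverse (real (Suc n))"
    unfolding grid_time_def by (simp_all add: field_simps)
qed

lemma grid_time_tendsto:
  assumes "t \<ge> 0"
  shows "(\<lambda>n. grid_time n t) \<longlonglongrightarrow> t"
proof (rule tendsto_sandwich)
  show "\<forall>\<^sub>F n in sequentially. t - inverse (real (Suc n)) \<le> grid_time n t"
    using grid_time_bounds(2)[OF assms] by (intro always_eventually) (auto simp: diff_le_eq)
  show "\<forall>\<^sub>F n in sequentially. grid_time n t \<le> t"
    using grid_time_bounds(1)[OF assms] by simp
  show "(\<lambda>n. t - inverse (real (Suc n))) \<longlonglongrightarrow> t"
    using tendsto_diff[OF tendsto_const[of t] LIMSEQ_inverse_real_of_nat] by simp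
qed simp

lemma euler_path_steps:
  assumes "0 \<le> s" "s \<le> t"
  obtains k where "euler_path z0 n t = euler z0 (inverse (real (Suc n))) (nat \<lfloor>s * real (Suc n)\<rfloor> + k)"
    and "real k * inverse (real (Suc n)) = grid_time n t - grid_time n s"
proof
  have le: "nat \<lfloor>s * real (Suc n)\<rfloor> \<le> nat \<lfloor>t * real (Suc n)\<rfloor>"
    using assms by (intro nat_mono floor_mono mult_right_mono) auto
  let ?k = "nat \<lfloor>t * real (Suc n)\<rfloor> - nat \<lfloor>s * real (Suc n)\<rfloor>"
  show "euler_path z0 n t = euler z0 (inverse (real (Suc n))) (nat \<lfloor>s * real (Suc n)\<rfloor> + ?k)"
    using le by (simp add: euler_path_def)
  show "real ?k * inverse (real (Suc n)) = grid_time n t - grid_time n s"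
    using le by (simp add: grid_time_def of_nat_diff left_diff_distrib)
qed

lemma euler_path_in_domain: "z0 \<in> saddle_domain UNIV \<Longrightarrow> euler_path z0 n t \<in> saddle_domain UNIV"
  by (simp add: euler_path_def euler_in_domain)

lemma norm_euler_path_diff:
  assumes "z0 \<in> saddle_domain UNIV" and "0 \<le> s" "s \<le> t"
  shows "norm (euler_path z0 n t - euler_path z0 n s) \<le> (grid_time n t - grid_time n s) * B"
proof -
  obtain k where k: "euler_path z0 n t = euler z0 (inverse (real (Suc n))) (nat \<lfloor>s * real (Suc n)\<rfloor> + k)"
    "real k * inverse (real (Suc n)) = grid_time n t - grid_time n s"
    using euler_path_steps[OF assms(2,3)] by blast
  show ?thesis
    using norm_euler_diff[OF assms(1), of "inverse (real (Suc n))" "nat \<lfloor>s * real (Suc n)\<rfloor>" k]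
    unfolding k(1) k(2)[symmetric] by (simp add: euler_path_def)
qed

lemma norm_euler_path_diff':
  assumes "z0 \<in> saddle_domain UNIV" and "0 \<le> s" "s \<le> t"
  shows "norm (euler_path z0 n t - euler_path z0 n s) \<le> (t - s + inverse (real (Suc n))) * B"
proof -
  have "grid_time n t - grid_time n s \<le> t - s + inverse (real (Suc n))"
    using grid_time_bounds[of t n] grid_time_bounds[of s n] assms(2,3) by linarith
  then have "(grid_time n t - grid_time n s) * B \<le> (t - s + inverse (real (Suc n))) * B"
    using B_nonneg by (rule mult_right_mono)
  then show ?thesis using norm_euler_path_diff[OF assms, of n] by linarith
qed

text \<open>An Arzela-Ascoli argument for curves that are equicontinuous only up to the mesh: a
  diagonal subsequence converges at all rational times, and the bound
  \<open>norm_euler_path_diff'\<close> extends this to every time.\<close>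

lemma euler_path_convergent_subsequence:
  assumes z0: "z0 \<in> saddle_domain UNIV"
  obtains y r where "strict_mono (r :: nat \<Rightarrow> nat)"
    and "\<And>t. t \<ge> 0 \<Longrightarrow> (\<lambda>n. euler_path z0 (r n) t) \<longlonglongrightarrow> y t"
proof -
  have cnt: "countable (\<rat> \<inter> {0::real..})" using countable_rat by (rule countable_Int1)
  \<comment> \<open>The diagonal argument asks for a bound uniform in \<open>t\<close>, whereas the
    available one grows linearly; dividing by \<open>1 + t\<close> reconciles them.\<close>
  have bdd: "norm (euler_path z0 n t /\<^sub>R (1 + t)) \<le> norm z0 + B" if "t \<in> \<rat> \<inter> {0..}" for n t
  proof -
    have "t \<ge> 0" using that by simp
    have "norm (euler_path z0 n t - euler_path z0 n 0) \<le> t * B"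
      using norm_euler_path_diff[OF z0 _ \<open>t \<ge> 0\<close>, of n] mult_right_mono[OF grid_time_bounds(1)[OF \<open>t \<ge> 0\<close>] B_nonneg, of n]
      by (simp add: grid_time_def)
    then have "norm (euler_path z0 n t) \<le> norm z0 + t * B"
      using norm_triangle_sub[of "euler_path z0 n t" "euler_path z0 n 0"] by (simp add: euler_path_def euler_def)
    also have "\<dots> \<le> (norm z0 + B) * (1 + t)"
      using \<open>t \<ge> 0\<close> B_nonneg by (simp add: algebra_simps)
    finally show ?thesis using \<open>t \<ge> 0\<close> by (simp add: field_simps)
  qed
  obtain r :: "nat \<Rightarrow> nat" where r: "strict_mono r"
    and conv: "\<And>t. t \<in> \<rat> \<inter> {0..} \<Longrightarrow> \<exists>l. (\<lambda>n. euler_path z0 (r n) t /\<^sub>R (1 + t)) \<longlonglongrightarrow> l"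
    using function_convergent_subsequence[OF cnt, of "\<lambda>n t. euler_path z0 n t /\<^sub>R (1 + t)", OF bdd] by blast
  have Cauchy_rat: "Cauchy (\<lambda>n. euler_path z0 (r n) q)" if q: "q \<in> \<rat>" "q \<ge> 0" for q
  proof -
    obtain l where "(\<lambda>n. euler_path z0 (r n) q /\<^sub>R (1 + q)) \<longlonglongrightarrow> l" using conv[of q] q by auto
    then have "(\<lambda>n. (1 + q) *\<^sub>R (euler_path z0 (r n) q /\<^sub>R (1 + q))) \<longlonglongrightarrow> (1 + q) *\<^sub>R l"
      by (intro tendsto_intros)
    then have "(\<lambda>n. euler_path z0 (r n) q) \<longlonglongrightarrow> (1 + q) *\<^sub>R l" using q(2) by simp
    then show ?thesis by (rule LIMSEQ_imp_Cauchy)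
  qed
  have h0: "(\<lambda>n. inverse (real (Suc (r n)))) \<longlonglongrightarrow> 0"
    using LIMSEQ_subseq_LIMSEQ[OF LIMSEQ_inverse_real_of_nat r] by (simp add: comp_def)
  have "\<exists>l. (\<lambda>n. euler_path z0 (r n) t) \<longlonglongrightarrow> l" if "t \<ge> 0" for t
  proof -
    have "Cauchy (\<lambda>n. euler_path z0 (r n) t)"
    proof (rule metric_CauchyI)
      fix e :: real assume "e > 0"
      \<comment> \<open>Moving from \<open>t\<close> to the rational \<open>q\<close> costs at most
        \<open>2 * e' * B\<close>, hence at most \<open>e / 3\<close>, and it is done for both
        paths. The summand \<open>1\<close> covers \<open>B = 0\<close>.\<close>
      define e' where "e' = e / (6 * (B + 1))"
      have "e' > 0" using \<open>e > 0\<close> B_nonneg by (simp add: e'_def)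
      have "e' * B \<le> e / 6" using \<open>e > 0\<close> B_nonneg by (simp add: e'_def field_simps)
      obtain q where q: "q \<in> \<rat>" "t < q" "q < t + e'" using Rats_dense_in_real[of t "t + e'"] \<open>e' > 0\<close> by auto
      obtain N1 where N1: "\<And>m n. m \<ge> N1 \<Longrightarrow> n \<ge> N1 \<Longrightarrow> dist (euler_path z0 (r m) q) (euler_path z0 (r n) q) < e / 3"
        using metric_CauchyD[OF Cauchy_rat[of q], of "e / 3"] q \<open>t \<ge> 0\<close> \<open>e > 0\<close> by auto
      have "\<forall>\<^sub>F n in sequentially. inverse (real (Suc (r n))) < e'"
        using h0 \<open>e' > 0\<close> by (rule order_tendstoD)
      then obtain N2 where N2: "\<And>n. n \<ge> N2 \<Longrightarrow> inverse (real (Suc (r n))) < e'"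
        by (auto simp: eventually_sequentially)
      have near: "dist (euler_path z0 (r n) q) (euler_path z0 (r n) t) \<le> e / 3" if "n \<ge> N2" for n
      proof -
        have "norm (euler_path z0 (r n) q - euler_path z0 (r n) t) \<le> (q - t + inverse (real (Suc (r n)))) * B"
          using q \<open>t \<ge> 0\<close> by (intro norm_euler_path_diff'[OF z0]) auto
        also have "\<dots> \<le> (e' + e') * B"
          using q N2[OF that] B_nonneg by (intro mult_right_mono) auto
        also have "\<dots> \<le> e / 3" using \<open>e' * B \<le> e / 6\<close> by (simp add: distrib_right)
        finally show ?thesis by (simp add: dist_norm)
      qed
      show "\<exists>M. \<forall>m\<ge>M. \<forall>n\<ge>M. dist (euler_path z0 (r m) t) (euler_path z0 (r n) t) < e"
      proof (intro exI[of _ "max N1 N2"] allI impI)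
        fix m n assume "m \<ge> max N1 N2" "n \<ge> max N1 N2"
        then have "dist (euler_path z0 (r m) q) (euler_path z0 (r m) t) \<le> e / 3"
          "dist (euler_path z0 (r n) q) (euler_path z0 (r n) t) \<le> e / 3"
          "dist (euler_path z0 (r m) q) (euler_path z0 (r n) q) < e / 3"
          using near[of m] near[of n] N1[of m n] by auto
        then show "dist (euler_path z0 (r m) t) (euler_path z0 (r n) t) < e"
          using dist_triangle[of "euler_path z0 (r m) t" "euler_path z0 (r n) t" "euler_path z0 (r m) q"]
            dist_triangle[of "euler_path z0 (r m) q" "euler_path z0 (r n) t" "euler_path z0 (r n) q"]
          by (simp add: dist_commute)
      qed
    qed
    then show ?thesis using Cauchy_convergent_iff convergent_def by blast
  qed
  then show ?thesis using r that by metis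
qed

text \<open>These increment estimates replace the integral equation: they mention no integrals or
  derivatives, and thus pass to pointwise limits.\<close>

lemma euler_limit_increments:
  assumes z0: "z0 \<in> saddle_domain UNIV" and r: "strict_mono (r :: nat \<Rightarrow> nat)"
    and lim: "\<And>t. t \<ge> 0 \<Longrightarrow> (\<lambda>n. euler_path z0 (r n) t) \<longlonglongrightarrow> y t"
    and st: "0 \<le> s" "s \<le> t" and "e \<ge> 0"
    and d: "\<And>u v. u \<in> saddle_domain UNIV \<Longrightarrow> v \<in> saddle_domain UNIV \<Longrightarrow> dist u v < d \<Longrightarrow> dist (G u) (G v) < e"
    and small: "(t - s) * B < d"
  shows "norm (fst (y t) - fst (y s) - (t - s) *\<^sub>R fst (G (y s))) \<le> (t - s) * e"
    and "snd (y t) $ c - snd (y s) $ c \<ge> (t - s) * (snd (G (y s)) $ c - e)"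
    and "snd (y t) $ c - snd (y s) $ c \<le> (t - s) * (max 0 (snd (G (y s)) $ c) + e)"
    and "snd (y s) $ c > (t - s) * B \<Longrightarrow>
      \<bar>snd (y t) $ c - snd (y s) $ c - (t - s) * snd (G (y s)) $ c\<bar> \<le> (t - s) * e"
proof -
  have "t \<ge> 0" using st by simp
  have yZ: "y s \<in> saddle_domain UNIV"
    using closed_sequentially[OF closed_saddle_domain _ lim[OF st(1)]] euler_path_in_domain[OF z0] by blast
  define H where "H n = grid_time (r n) t - grid_time (r n) s" for n
  have "(\<lambda>n. grid_time (r n) \<tau>) \<longlonglongrightarrow> \<tau>" if "\<tau> \<ge> 0" for \<tau>
    using LIMSEQ_subseq_LIMSEQ[OF grid_time_tendsto[OF that] r] by (simp add: comp_def)
  then have H: "H \<longlonglongrightarrow> t - s" unfolding H_def using st by (intro tendsto_diff) auto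
  have ev: "\<forall>\<^sub>F n in sequentially. H n * B < d"
    using tendsto_mult_right[OF H, of B] small by (intro order_tendstoD)
  let ?y = "\<lambda>n. euler_path z0 (r n)"
  have G: "(\<lambda>n. G (?y n s)) \<longlonglongrightarrow> G (y s)"
    using euler_path_in_domain[OF z0]
    by (intro continuous_on_tendsto_compose[OF uniformly_continuous_imp_continuous[OF uc] lim[OF st(1)] yZ]) auto
  note limits = tendsto_intros H G lim[OF st(1)] lim[OF \<open>t \<ge> 0\<close>]
  have step: "norm (fst (?y n t) - fst (?y n s) - H n *\<^sub>R fst (G (?y n s))) \<le> H n * e
      \<and> snd (?y n t) $ c - snd (?y n s) $ c \<ge> H n * (snd (G (?y n s)) $ c - e)
      \<and> snd (?y n t) $ c - snd (?y n s) $ c \<le> H n * (max 0 (snd (G (?y n s)) $ c) + e)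
      \<and> (snd (?y n s) $ c > H n * B \<longrightarrow>
        \<bar>snd (?y n t) $ c - snd (?y n s) $ c - H n * snd (G (?y n s)) $ c\<bar> \<le> H n * e)"
    if "H n * B < d" for n
  proof -
    obtain k where k: "?y n t = euler z0 (inverse (real (Suc (r n)))) (nat \<lfloor>s * real (Suc (r n))\<rfloor> + k)"
      "real k * inverse (real (Suc (r n))) = H n"
      using euler_path_steps[OF st] unfolding H_def by blast
    have s: "euler z0 (inverse (real (Suc (r n)))) (nat \<lfloor>s * real (Suc (r n))\<rfloor>) = ?y n s"
      by (simp add: euler_path_def)
    have "real k * inverse (real (Suc (r n))) * B < d" using that k(2) by simp
    note * = euler_increments[OF z0 _ \<open>e \<ge> 0\<close> d this, of "nat \<lfloor>s * real (Suc (r n))\<rfloor>", unfolded s k(2), folded k(1)]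
    show ?thesis using *(1) *(2-4)[of c] by simp
  qed
  show "norm (fst (y t) - fst (y s) - (t - s) *\<^sub>R fst (G (y s))) \<le> (t - s) * e"
  proof (rule tendsto_le[OF sequentially_bot])
    show "\<forall>\<^sub>F n in sequentially. norm (fst (?y n t) - fst (?y n s) - H n *\<^sub>R fst (G (?y n s))) \<le> H n * e"
      using ev by eventually_elim (use step in blast)
  qed (intro limits)+
  show "snd (y t) $ c - snd (y s) $ c \<ge> (t - s) * (snd (G (y s)) $ c - e)"
  proof (rule tendsto_le[OF sequentially_bot])
    show "\<forall>\<^sub>F n in sequentially. snd (?y n t) $ c - snd (?y n s) $ c \<ge> H n * (snd (G (?y n s)) $ c - e)"
      using ev by eventually_elim (use step in blast)
  qed (intro limits)+
  show "snd (y t) $ c - snd (y s) $ c \<le> (t - s) * (max 0 (snd (G (y s)) $ c) + e)"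
  proof (rule tendsto_le[OF sequentially_bot])
    show "\<forall>\<^sub>F n in sequentially. snd (?y n t) $ c - snd (?y n s) $ c \<le> H n * (max 0 (snd (G (?y n s)) $ c) + e)"
      using ev by eventually_elim (use step in blast)
  qed (intro limits)+
  assume pos: "snd (y s) $ c > (t - s) * B"
  show "\<bar>snd (y t) $ c - snd (y s) $ c - (t - s) * snd (G (y s)) $ c\<bar> \<le> (t - s) * e"
  proof (rule tendsto_le[OF sequentially_bot])
    \<comment> \<open>The interior condition is strict, so it passes from the limit to all late
      paths.\<close>
    have "(\<lambda>n. snd (?y n s) $ c - H n * B) \<longlonglongrightarrow> snd (y s) $ c - (t - s) * B"
      by (intro limits)
    then have "\<forall>\<^sub>F n in sequentially. snd (?y n s) $ c - H n * B > 0"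
      using pos by (intro order_tendstoD) auto
    with ev show "\<forall>\<^sub>F n in sequentially.
        \<bar>snd (?y n t) $ c - snd (?y n s) $ c - H n * snd (G (?y n s)) $ c\<bar> \<le> H n * e"
      by eventually_elim (use step in force)
  qed (intro limits)+
qed

end

text \<open>The exceptional times are those at which \<open>m\<close> reaches \<open>0\<close> from positive values with negative
  slope; each of them is the first zero of \<open>m\<close> after some rational.\<close>

lemma reflected_path_derivative:
  fixes m q :: "real \<Rightarrow> real"
  assumes q: "continuous_on {0..} q" and m: "continuous_on {0..} m"
    and nonneg: "\<And>t. t \<ge> 0 \<Longrightarrow> m t \<ge> 0" and "B \<ge> 0"
    and incr: "\<And>e. e > 0 \<Longrightarrow> \<exists>d>0. \<forall>s u. 0 \<le> s \<longrightarrow> s \<le> u \<longrightarrow> u - s < d \<longrightarrow>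
        m u - m s \<ge> (u - s) * (q s - e) \<and> m u - m s \<le> (u - s) * (max 0 (q s) + e) \<and>
        (m s > (u - s) * B \<longrightarrow> \<bar>m u - m s - (u - s) * q s\<bar> \<le> (u - s) * e)"
  obtains N where "countable N"
    and "\<And>t. t \<ge> 0 \<Longrightarrow> t \<notin> N \<Longrightarrow>
      (m has_vector_derivative (if m t = 0 then max 0 (q t) else q t)) (at t within {0..})"
proof
  have q_near: "\<exists>d>0. \<forall>u\<ge>0. \<bar>u - t\<bar> < d \<longrightarrow> \<bar>q u - q t\<bar> < e" if "t \<ge> 0" "e > 0" for t e
    using q that unfolding continuous_on_iff dist_real_def by (meson atLeast_iff)
  have m_near: "\<exists>d>0. \<forall>u\<ge>0. \<bar>u - t\<bar> < d \<longrightarrow> \<bar>m u - m t\<bar> < e" if "t \<ge> 0" "e > 0" for t e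
    using m that unfolding continuous_on_iff dist_real_def by (meson atLeast_iff)
  \<comment> \<open>Near a time of positive value, \<open>m\<close> exceeds
    \<open>(u - s) * B\<close> on all short intervals, so the two-sided estimate without reflection
    is available.\<close>
  have pos_case: "(m has_vector_derivative q t) (at t within {0..})" if tm: "t \<ge> 0" "m t > 0" for t
  proof (rule has_vector_derivative_of_uniform_increments)
    show "continuous (at t within {0..}) q" using q that by (simp add: continuous_on_eq_continuous_within)
    fix e :: real assume "e > 0"
    then obtain d1 where d1: "d1 > 0" "\<And>s u. 0 \<le> s \<Longrightarrow> s \<le> u \<Longrightarrow> u - s < d1 \<Longrightarrow>
        m s > (u - s) * B \<Longrightarrow> \<bar>m u - m s - (u - s) * q s\<bar> \<le> (u - s) * e"
      using incr[of e] by blast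
    obtain d2 where d2: "d2 > 0" "\<And>u. u \<ge> 0 \<Longrightarrow> \<bar>u - t\<bar> < d2 \<Longrightarrow> \<bar>m u - m t\<bar> < m t / 2"
      using m_near[OF tm(1), of "m t / 2"] tm(2) half_gt_zero[of "m t"] by blast
    define d3 where "d3 = m t / (4 * (B + 1))"
    have "d3 > 0" using that \<open>B \<ge> 0\<close> by (simp add: d3_def)
    have "2 * d3 * B \<le> m t / 2" using that \<open>B \<ge> 0\<close> by (simp add: d3_def field_simps)
    show "\<exists>d>0. \<forall>s u. 0 \<le> s \<longrightarrow> s \<le> u \<longrightarrow> \<bar>s - t\<bar> < d \<longrightarrow> \<bar>u - t\<bar> < d \<longrightarrow>
      norm (m u - m s - (u - s) *\<^sub>R q s) \<le> e * (u - s)"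
    proof (intro exI[of _ "min (d1 / 2) (min d2 d3)"] conjI allI impI)
      show "min (d1 / 2) (min d2 d3) > 0" using d1 d2 \<open>d3 > 0\<close> by simp
      fix s u assume su: "0 \<le> s" "s \<le> u" "\<bar>s - t\<bar> < min (d1 / 2) (min d2 d3)" "\<bar>u - t\<bar> < min (d1 / 2) (min d2 d3)"
      have "u - s < d1" "u - s \<le> 2 * d3" using su by linarith+
      have "(u - s) * B \<le> 2 * d3 * B" using \<open>u - s \<le> 2 * d3\<close> \<open>B \<ge> 0\<close> by (rule mult_right_mono)
      also have "\<dots> \<le> m t / 2" by fact
      also have "\<dots> < m s"
      proof -
        have "\<bar>m s - m t\<bar> < m t / 2" using d2(2)[of s] su by simp
        then show ?thesis by linarith
      qed
      finally have "\<bar>m u - m s - (u - s) * q s\<bar> \<le> (u - s) * e"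
        using d1(2) su(1,2) \<open>u - s < d1\<close> by blast
      then show "norm (m u - m s - (u - s) *\<^sub>R q s) \<le> e * (u - s)" by (simp add: mult.commute)
    qed
  qed (use that in simp)
  \<comment> \<open>Time \<open>0\<close> is included so that every other time has room on its
    left.\<close>
  define N where "N = insert 0 ((\<lambda>r. Inf {s. s \<ge> r \<and> m s = 0}) ` \<rat>)"
  show "countable N" unfolding N_def using countable_rat by auto
  have zero_left: "\<exists>d>0. \<forall>u\<ge>0. t - d < u \<longrightarrow> u < t \<longrightarrow> m u = 0"
    if t: "t > 0" "m t = 0" "q t < 0" "t \<notin> N" for t
  proof -
    obtain d0 where d0: "d0 > 0" "\<And>u. u \<ge> 0 \<Longrightarrow> \<bar>u - t\<bar> < d0 \<Longrightarrow> \<bar>q u - q t\<bar> < - q t"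
      using q_near[of t "- q t"] t by auto
    define d where "d = min d0 t"
    have "d > 0" using d0 t by (simp add: d_def)
    have neg: "q u < 0" if "t - d < u" "u \<le> t" for u
    proof -
      have "\<bar>q u - q t\<bar> < - q t" using d0(2)[of u] that by (auto simp: d_def)
      then show ?thesis by linarith
    qed
    \<comment> \<open>Once at \<open>0\<close>, the path cannot leave while the slope is negative: a
      positive maximum after \<open>w\<close> would be preceded by larger values.\<close>
    have stays: "m v = 0" if w: "t - d < w" "m w = 0" and v: "w \<le> v" "v \<le> t" for w v
    proof -
      have "w > 0" using w by (simp add: d_def)
      have "continuous_on {w..t} m" using m \<open>w > 0\<close> by (rule_tac continuous_on_subset) auto
      then obtain x where x: "x \<in> {w..t}" and max: "\<And>u. u \<in> {w..t} \<Longrightarrow> m u \<le> m x"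
        using continuous_attains_sup[of "{w..t}" m] v by auto
      have "m x = 0"
      proof (rule ccontr)
        assume "m x \<noteq> 0"
        then have "m x > 0" using nonneg[of x] x \<open>w > 0\<close> by simp
        then have "w < x" using x w by (cases "x = w") auto
        have "(m has_vector_derivative q x) (at x within {0..})"
          using pos_case \<open>m x > 0\<close> \<open>w < x\<close> \<open>w > 0\<close> by simp
        moreover have "at x within {0..} = at x"
          using \<open>w < x\<close> \<open>w > 0\<close> by (intro at_within_interior) auto
        ultimately have "(m has_real_derivative q x) (at x)"
          by (simp add: has_real_derivative_iff_has_vector_derivative)
        moreover have "q x < 0" using neg[of x] x w by simp
        ultimately obtain d' where d': "d' > 0" "\<forall>h>0. h < d' \<longrightarrow> m x < m (x - h)"
          using DERIV_neg_dec_left[of m "q x" x] by blast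
        define h where "h = min (d' / 2) (x - w)"
        have "h > 0" "h < d'" "x - h \<in> {w..t}" using d' \<open>w < x\<close> x by (auto simp: h_def)
        then show False using d'(2) max[of "x - h"] by force
      qed
      then show ?thesis using max[of v] nonneg[of v] v \<open>w > 0\<close> by auto
    qed
    \<comment> \<open>Otherwise \<open>t\<close> would be the first zero after a rational chosen
      between \<open>t - d\<close> and \<open>t\<close>, and so belong to \<open>N\<close>.\<close>
    have "\<exists>w. t - d < w \<and> w < t \<and> m w = 0"
    proof (rule ccontr)
      assume no: "\<not> (\<exists>w. t - d < w \<and> w < t \<and> m w = 0)"
      obtain r where r: "r \<in> \<rat>" "t - d < r" "r < t"
        using Rats_dense_in_real[of "t - d" t] \<open>d > 0\<close> by auto
      have "Inf {s. s \<ge> r \<and> m s = 0} = t"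
      proof (rule cInf_eq_minimum)
        show "t \<in> {s. s \<ge> r \<and> m s = 0}" using r t(2) by simp
        fix x assume "x \<in> {s. s \<ge> r \<and> m s = 0}"
        then have "t - d < x" "m x = 0" using r by auto
        then show "t \<le> x" using no not_le by blast
      qed
      then have "t \<in> N" using r(1) unfolding N_def
        by (intro insertI2 image_eqI[of t _ r]) simp_all
      then show False using t(4) by simp
    qed
    then obtain w where w: "t - d < w" "w < t" "m w = 0" by blast
    then show ?thesis using stays[OF w(1,3)] by (intro exI[of _ "t - w"]) auto
  qed
  fix t assume "t \<ge> 0" "t \<notin> N"
  then have "t > 0" by (auto simp: N_def less_le)
  show "(m has_vector_derivative (if m t = 0 then max 0 (q t) else q t)) (at t within {0..})"
  proof (cases "m t = 0")
    case False
    then show ?thesis using pos_case[of t] nonneg[of t] \<open>t \<ge> 0\<close> by simp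
  next
    case True
    \<comment> \<open>With a positive slope \<open>m\<close> would increase up to its zero at
      \<open>t\<close>, and so be negative just before.\<close>
    have "\<not> q t > 0"
    proof
      assume "q t > 0"
      obtain d1 where d1: "d1 > 0" "\<And>s u. 0 \<le> s \<Longrightarrow> s \<le> u \<Longrightarrow> u - s < d1 \<Longrightarrow> m u - m s \<ge> (u - s) * (q s - q t / 4)"
        using incr[of "q t / 4"] \<open>q t > 0\<close> by (metis divide_pos_pos zero_less_numeral)
      obtain d2 where d2: "d2 > 0" "\<And>u. u \<ge> 0 \<Longrightarrow> \<bar>u - t\<bar> < d2 \<Longrightarrow> \<bar>q u - q t\<bar> < q t / 2"
        using q_near[of t "q t / 2"] \<open>q t > 0\<close> \<open>t \<ge> 0\<close> by auto
      define h where "h = min t (min (d1 / 2) (d2 / 2))"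
      have h: "h > 0" "h < d1" "h < d2" "h \<le> t" using d1(1) d2(1) \<open>t > 0\<close> by (auto simp: h_def)
      have "\<bar>q (t - h) - q t\<bar> < q t / 2" using d2(2)[of "t - h"] h by simp
      then have "q (t - h) - q t / 4 > 0" using \<open>q t > 0\<close> by linarith
      then have "h * (q (t - h) - q t / 4) > 0" using h by simp
      moreover have "m t - m (t - h) \<ge> h * (q (t - h) - q t / 4)"
        using d1(2)[of "t - h" t] h by simp
      ultimately show False using True nonneg[of "t - h"] h by simp
    qed
    have "(m has_vector_derivative 0) (at t within {0..})"
      unfolding has_vector_derivative_def has_derivative_within_alt
    proof (intro conjI allI impI)
      fix e :: real assume "e > 0"
      then have "e / 2 > 0" by simp
      then obtain d1 where d1: "d1 > 0" "\<And>s u. 0 \<le> s \<Longrightarrow> s \<le> u \<Longrightarrow> u - s < d1 \<Longrightarrow>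
          m u - m s \<ge> (u - s) * (q s - e / 2) \<and> m u - m s \<le> (u - s) * (max 0 (q s) + e / 2)"
        using incr[of "e / 2"] by blast
      have right: "m u \<le> e * (u - t)" if "t \<le> u" "u - t < d1" for u
      proof -
        have "m u \<le> (u - t) * (e / 2)" using d1(2)[of t u] that \<open>\<not> q t > 0\<close> \<open>t \<ge> 0\<close> True by simp
        also have "\<dots> \<le> (u - t) * e" using that \<open>e > 0\<close> by (intro mult_left_mono) auto
        finally show ?thesis by (simp add: mult.commute)
      qed
      \<comment> \<open>On the left there are two regimes. For negative slope \<open>m\<close>
        vanishes identically there; for zero slope the lower increment bound from \<open>u\<close>
        to \<open>t\<close> limits how far \<open>m\<close> can have descended.\<close>
      have "\<exists>d>0. \<forall>u\<ge>0. t - d < u \<longrightarrow> u < t \<longrightarrow> m u \<le> e * (t - u)"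
      proof (cases "q t = 0")
        case False
        then have "q t < 0" using \<open>\<not> q t > 0\<close> by simp
        then obtain d where "d > 0" "\<forall>u\<ge>0. t - d < u \<longrightarrow> u < t \<longrightarrow> m u = 0"
          using zero_left \<open>t > 0\<close> True \<open>t \<notin> N\<close> by blast
        then show ?thesis using \<open>e > 0\<close> by (intro exI[of _ d]) auto
      next
        case q0: True
        obtain d2 where d2: "d2 > 0" "\<And>u. u \<ge> 0 \<Longrightarrow> \<bar>u - t\<bar> < d2 \<Longrightarrow> \<bar>q u\<bar> < e / 2"
          using q_near[of t "e / 2"] \<open>e / 2 > 0\<close> \<open>t \<ge> 0\<close> q0 by auto
        have "m u \<le> e * (t - u)" if u: "u \<ge> 0" "t - min d1 d2 < u" "u < t" for u
        proof -
          have "(t - u) * (- e) \<le> (t - u) * (q u - e / 2)"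
          proof (rule mult_left_mono)
            have "\<bar>q u\<bar> < e / 2" using d2(2)[of u] u by auto
            then show "- e \<le> q u - e / 2" by linarith
          qed (use u in simp)
          also have "\<dots> \<le> m t - m u" using d1(2)[of u t] u by auto
          finally show ?thesis using True by (simp add: mult.commute)
        qed
        then show ?thesis using d1(1) d2(1) by (intro exI[of _ "min d1 d2"]) auto
      qed
      then obtain d where "d > 0" and left: "\<And>u. u \<ge> 0 \<Longrightarrow> t - d < u \<Longrightarrow> u < t \<Longrightarrow> m u \<le> e * (t - u)"
        by blast
      show "\<exists>d>0. \<forall>u\<in>{0..}. norm (u - t) < d \<longrightarrow> norm (m u - m t - (u - t) *\<^sub>R 0) \<le> e * norm (u - t)"
      proof (intro exI[of _ "min d d1"] conjI ballI impI)
        show "min d d1 > 0" using \<open>d > 0\<close> d1(1) by simp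
        fix u assume "u \<in> {0..}" "norm (u - t) < min d d1"
        then show "norm (m u - m t - (u - t) *\<^sub>R 0) \<le> e * norm (u - t)"
          using left[of u] right[of u] nonneg[of u] True by (cases "t \<le> u") auto
      qed
    qed simp
    then show ?thesis using True \<open>\<not> q t > 0\<close> by (simp add: max_def)
  qed
qed

lemma has_vector_derivative_vecI:
  fixes f :: "real \<Rightarrow> real^'m"
  assumes "\<And>i. ((\<lambda>t. f t $ i) has_vector_derivative v $ i) (at t within S)"
  shows "(f has_vector_derivative v) (at t within S)"
  unfolding has_vector_derivative_def
proof (subst has_derivative_componentwise_within, rule ballI)
  fix b :: "real^'m" assume "b \<in> Basis"
  then obtain i where b: "b = axis i 1" by (auto simp: Basis_vec_def)
  show "((\<lambda>t. f t \<bullet> b) has_derivative (\<lambda>h. (h *\<^sub>R v) \<bullet> b)) (at t within S)"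
    using assms[of i] by (simp add: b inner_axis has_vector_derivative_def)
qed

context bounded_field
begin

text \<open>The first component of the limit is unconstrained and differentiable at every time. Each
  multiplier is a reflected path, differentiable off a countable set, and the union of these sets
  over the coordinates is null.\<close>

theorem trajectory_exists:
  assumes z0: "z0 \<in> saddle_domain UNIV"
  obtains y where "trajectory (saddle_domain UNIV) G y" and "y 0 = z0"
proof -
  obtain y and r :: "nat \<Rightarrow> nat" where r: "strict_mono r"
    and lim: "\<And>t. t \<ge> 0 \<Longrightarrow> (\<lambda>n. euler_path z0 (r n) t) \<longlonglongrightarrow> y t"
    using euler_path_convergent_subsequence[OF z0] by blast
  have yZ: "y t \<in> saddle_domain UNIV" if "t \<ge> 0" for t
    using closed_sequentially[OF closed_saddle_domain _ lim[OF that]] euler_path_in_domain[OF z0] by blast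
  have y0: "y 0 = z0"
    using LIMSEQ_unique[OF lim[of 0], of z0] by (simp add: euler_path_def euler_def)
  have lip_le: "norm (y u - y s) \<le> (u - s) * B" if su: "0 \<le> s" "s \<le> u" for s u
  proof (rule tendsto_le[OF sequentially_bot])
    have "(\<lambda>n. grid_time (r n) \<tau>) \<longlonglongrightarrow> \<tau>" if "\<tau> \<ge> 0" for \<tau>
      using LIMSEQ_subseq_LIMSEQ[OF grid_time_tendsto[OF that] r] by (simp add: comp_def)
    then show "(\<lambda>n. (grid_time (r n) u - grid_time (r n) s) * B) \<longlonglongrightarrow> (u - s) * B"
      using su by (intro tendsto_intros) auto
    show "(\<lambda>n. norm (euler_path z0 (r n) u - euler_path z0 (r n) s)) \<longlonglongrightarrow> norm (y u - y s)"
      using su by (intro tendsto_intros lim) auto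
    show "\<forall>\<^sub>F n in sequentially. norm (euler_path z0 (r n) u - euler_path z0 (r n) s)
        \<le> (grid_time (r n) u - grid_time (r n) s) * B"
      using norm_euler_path_diff[OF z0 su] by simp
  qed
  have lip: "dist (y s) (y u) \<le> B * dist s u" if "s \<ge> 0" "u \<ge> 0" for s u
    using lip_le[of s u] lip_le[of u s] that
    by (cases "s \<le> u") (auto simp: dist_norm norm_minus_commute mult.commute)
  have "continuous_on {0..} y"
    by (rule lipschitz_on_continuous_on[of B]) (use lip B_nonneg in \<open>auto simp: lipschitz_on_def\<close>)
  have contG: "continuous_on {0..} (\<lambda>t. G (y t))"
    by (rule continuous_on_compose2[OF uniformly_continuous_imp_continuous[OF uc] \<open>continuous_on {0..} y\<close>])
      (use yZ in auto)
  have modulus: "\<exists>d>0. \<forall>s u c. 0 \<le> s \<longrightarrow> s \<le> u \<longrightarrow> u - s < d \<longrightarrow>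
      norm (fst (y u) - fst (y s) - (u - s) *\<^sub>R fst (G (y s))) \<le> (u - s) * e
      \<and> snd (y u) $ c - snd (y s) $ c \<ge> (u - s) * (snd (G (y s)) $ c - e)
      \<and> snd (y u) $ c - snd (y s) $ c \<le> (u - s) * (max 0 (snd (G (y s)) $ c) + e)
      \<and> (snd (y s) $ c > (u - s) * B \<longrightarrow>
        \<bar>snd (y u) $ c - snd (y s) $ c - (u - s) * snd (G (y s)) $ c\<bar> \<le> (u - s) * e)"
    if "e > 0" for e
  proof -
    obtain d where "d > 0" and "\<forall>v\<in>saddle_domain UNIV. \<forall>u\<in>saddle_domain UNIV. dist u v < d \<longrightarrow> dist (G u) (G v) < e"
      using uc[unfolded uniformly_continuous_on_def, rule_format, OF \<open>e > 0\<close>] by blast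
    then have d: "dist (G u) (G v) < e" if "u \<in> saddle_domain UNIV" "v \<in> saddle_domain UNIV" "dist u v < d" for u v
      using that by blast
    show ?thesis
    proof (intro exI[of _ "d / (B + 1)"] allI impI)
      show "d / (B + 1) > 0 \<and> (\<forall>s u c. 0 \<le> s \<longrightarrow> s \<le> u \<longrightarrow> u - s < d / (B + 1) \<longrightarrow>
        norm (fst (y u) - fst (y s) - (u - s) *\<^sub>R fst (G (y s))) \<le> (u - s) * e
        \<and> snd (y u) $ c - snd (y s) $ c \<ge> (u - s) * (snd (G (y s)) $ c - e)
        \<and> snd (y u) $ c - snd (y s) $ c \<le> (u - s) * (max 0 (snd (G (y s)) $ c) + e)
        \<and> (snd (y s) $ c > (u - s) * B \<longrightarrow>
          \<bar>snd (y u) $ c - snd (y s) $ c - (u - s) * snd (G (y s)) $ c\<bar> \<le> (u - s) * e))"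
      proof (intro conjI allI impI)
        show "d / (B + 1) > 0" using \<open>d > 0\<close> B_nonneg by simp
        fix s u c assume su: "0 \<le> s" "s \<le> u" "u - s < d / (B + 1)"
        have "(u - s) * B \<le> (u - s) * (B + 1)" using su by (intro mult_left_mono) auto
        also have "\<dots> < d" using su(3) B_nonneg by (simp add: pos_less_divide_eq)
        finally have small: "(u - s) * B < d" .
        note * = euler_limit_increments[OF z0 r lim su(1,2) less_imp_le[OF \<open>e > 0\<close>] d small]
        show "norm (fst (y u) - fst (y s) - (u - s) *\<^sub>R fst (G (y s))) \<le> (u - s) * e" by (rule *(1))
        show "snd (y u) $ c - snd (y s) $ c \<ge> (u - s) * (snd (G (y s)) $ c - e)" by (rule *(2))
        show "snd (y u) $ c - snd (y s) $ c \<le> (u - s) * (max 0 (snd (G (y s)) $ c) + e)" by (rule *(3))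
        show "\<bar>snd (y u) $ c - snd (y s) $ c - (u - s) * snd (G (y s)) $ c\<bar> \<le> (u - s) * e"
          if "snd (y s) $ c > (u - s) * B" using *(4)[of c] that by simp
      qed
    qed
  qed
  have der_fst: "((\<lambda>t. fst (y t)) has_vector_derivative fst (G (y t))) (at t within {0..})" if "t \<ge> 0" for t
  proof (rule has_vector_derivative_of_uniform_increments[where p = "\<lambda>t. fst (G (y t))"])
    show "continuous (at t within {0..}) (\<lambda>t. fst (G (y t)))"
      using continuous_on_fst[OF contG] that by (simp add: continuous_on_eq_continuous_within)
    fix e :: real assume "e > 0"
    then obtain d where d: "d > 0" "\<And>s u. 0 \<le> s \<Longrightarrow> s \<le> u \<Longrightarrow> u - s < d \<Longrightarrow>
        norm (fst (y u) - fst (y s) - (u - s) *\<^sub>R fst (G (y s))) \<le> (u - s) * e"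
      using modulus by meson
    show "\<exists>d>0. \<forall>s u. 0 \<le> s \<longrightarrow> s \<le> u \<longrightarrow> \<bar>s - t\<bar> < d \<longrightarrow> \<bar>u - t\<bar> < d \<longrightarrow>
        norm (fst (y u) - fst (y s) - (u - s) *\<^sub>R fst (G (y s))) \<le> e * (u - s)"
    proof (intro exI[of _ "d / 2"] conjI allI impI)
      fix s u assume su: "0 \<le> s" "s \<le> u" "\<bar>s - t\<bar> < d / 2" "\<bar>u - t\<bar> < d / 2"
      then have "u - s < d" by linarith
      with su show "norm (fst (y u) - fst (y s) - (u - s) *\<^sub>R fst (G (y s))) \<le> e * (u - s)"
        using d(2)[of s u] by (simp add: mult.commute)
    qed (use d in simp)
  qed (use that in simp)
  have "\<exists>N. countable N \<and> (\<forall>t\<ge>0. t \<notin> N \<longrightarrow> ((\<lambda>t. snd (y t) $ c) has_vector_derivative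
      (if snd (y t) $ c = 0 then max 0 (snd (G (y t)) $ c) else snd (G (y t)) $ c)) (at t within {0..}))" for c
  proof (rule reflected_path_derivative[of "\<lambda>t. snd (G (y t)) $ c" "\<lambda>t. snd (y t) $ c" B])
    show "continuous_on {0..} (\<lambda>t. snd (G (y t)) $ c)" "continuous_on {0..} (\<lambda>t. snd (y t) $ c)"
      using contG \<open>continuous_on {0..} y\<close> by (auto intro!: continuous_intros)
    show "snd (y t) $ c \<ge> 0" if "t \<ge> 0" for t
      using yZ[OF that] by (auto simp: saddle_domain_def less_eq_vec_def)
    show "B \<ge> 0" by (rule B_nonneg)
    show "\<exists>d>0. \<forall>s u. 0 \<le> s \<longrightarrow> s \<le> u \<longrightarrow> u - s < d \<longrightarrow>
        snd (y u) $ c - snd (y s) $ c \<ge> (u - s) * (snd (G (y s)) $ c - e)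
        \<and> snd (y u) $ c - snd (y s) $ c \<le> (u - s) * (max 0 (snd (G (y s)) $ c) + e)
        \<and> (snd (y s) $ c > (u - s) * B \<longrightarrow>
          \<bar>snd (y u) $ c - snd (y s) $ c - (u - s) * snd (G (y s)) $ c\<bar> \<le> (u - s) * e)" if "e > 0" for e
      using modulus[OF that] by meson
  qed blast
  then obtain N where N: "\<And>c. countable (N c)"
    and der_snd: "\<And>c t. t \<ge> 0 \<Longrightarrow> t \<notin> N c \<Longrightarrow> ((\<lambda>t. snd (y t) $ c) has_vector_derivative
      (if snd (y t) $ c = 0 then max 0 (snd (G (y t)) $ c) else snd (G (y t)) $ c)) (at t within {0..})"
    by metis
  have "trajectory (saddle_domain UNIV) G y"
    unfolding trajectory_def
  proof (intro conjI allI impI)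
    show "abs_continuous_on {0..T} y" for T
      by (rule abs_continuous_on_lipschitz) (use lip in auto)
    have "countable (\<Union>c. N c)" using N by (intro countable_UN) auto
    then have null: "(\<Union>c. N c) \<in> null_sets lebesgue"
      by (intro null_sets_completionI countable_imp_null_set_lborel)
    show "AE t in lebesgue. t \<ge> 0 \<longrightarrow>
        (y has_vector_derivative projected_field (saddle_domain UNIV) G (y t)) (at t within {0..})"
    proof (rule AE_I'[OF null], intro subsetI)
      fix t assume t: "t \<in> {t \<in> space lebesgue. \<not> (t \<ge> 0 \<longrightarrow>
        (y has_vector_derivative projected_field (saddle_domain UNIV) G (y t)) (at t within {0..}))}"
      show "t \<in> (\<Union>c. N c)"
      proof (rule ccontr)
        assume "t \<notin> (\<Union>c. N c)"
        with t have "t \<ge> 0" "\<And>c. t \<notin> N c" by auto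
        have "((\<lambda>t. snd (y t)) has_vector_derivative (\<chi> c. if snd (y t) $ c = 0
            then max 0 (snd (G (y t)) $ c) else snd (G (y t)) $ c)) (at t within {0..})"
          by (rule has_vector_derivative_vecI) (use der_snd[OF \<open>t \<ge> 0\<close> \<open>t \<notin> N _\<close>] in simp)
        from has_vector_derivative_Pair[OF der_fst[OF \<open>t \<ge> 0\<close>] this]
        show False using t \<open>t \<ge> 0\<close> by (simp add: projected_field_saddle_domain[OF yZ])
      qed
    qed
  qed (use yZ in auto)
  then show ?thesis using y0 that by blast
qed

end

section \<open>The saddle flow\<close>

lemma normal_cone_UNIV: "normal_cone UNIV x = {0}"
proof -
  have "tangent_cone UNIV x = UNIV"
    unfolding tangent_cone_def using gt_ex[of "0::real"] by simp
  moreover have "\<eta> = 0" if "\<forall>v. v \<bullet> \<eta> \<le> 0" for \<eta> :: 'a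
    using that inner_gt_zero_iff[of \<eta>] not_less by blast
  ultimately show ?thesis unfolding normal_cone_def by auto
qed

locale saddle_problem =
  fixes f :: "real^'n \<Rightarrow> real" and g :: "real^'n \<Rightarrow> real^'m" and \<rho> :: real
    and zs :: "(real^'n) \<times> (real^'m)"
  assumes f_convex: "convex_on UNIV f" and f_diff: "f differentiable (at x)"
    and g_convex: "convex_on UNIV (\<lambda>x. g x $ i)" and g_diff: "g differentiable (at x)"
    and zs_solution: "zs \<in> primal_dual_solutions UNIV f g"
    and rho_pos: "\<rho> > 0"
begin

abbreviation "Z \<equiv> saddle_domain UNIV :: ((real^'n) \<times> (real^'m)) set"
abbreviation "F \<equiv> saddle_field f g \<rho>"
abbreviation "PF \<equiv> projected_field Z F"
abbreviation "df \<equiv> gradient f"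
abbreviation "dg i \<equiv> gradient (\<lambda>y. g y $ i)"
abbreviation "xs \<equiv> fst zs"
abbreviation "ms \<equiv> snd zs"

section \<open>Explicit form, continuity and equilibria of the saddle field\<close>

lemma g_comp_diff: "(\<lambda>y. g y $ i) differentiable (at x)"
  using g_diff by (auto simp: differentiable_def intro: bounded_linear.has_derivative[OF bounded_linear_vec_nth])

lemma f_tangent: "(y - x) \<bullet> df x \<le> f y - f x"
  using convex_on_ge_tangent[OF f_convex f_diff, of x y] by simp

lemma g_tangent: "(y - x) \<bullet> dg i x \<le> g y $ i - g x $ i"
  using convex_on_ge_tangent[OF g_convex g_comp_diff, of x i y] by simp

lemma F_eq: "F z = (- df (fst z) - (\<Sum>i\<in>UNIV. (snd z $ i + \<rho> * max 0 (g (fst z) $ i)) *\<^sub>R dg i (fst z)), g (fst z))"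
  using saddle_field_eq[OF f_diff g_diff, of \<rho> "fst z" "snd z"]
  by (simp add: matrix_vector_mult_grad_matrix pos_part_def)

lemma continuous_f: "continuous_on UNIV f"
  using f_diff by (auto simp: continuous_on_eq_continuous_within intro: differentiable_imp_continuous_within)

lemma continuous_g: "continuous_on UNIV g"
  using g_diff by (auto simp: continuous_on_eq_continuous_within intro: differentiable_imp_continuous_within)

lemma continuous_df: "continuous_on UNIV df"
  using continuous_on_gradient_convex[OF f_convex f_diff] .

lemma continuous_dg: "continuous_on UNIV (dg i)"
  using continuous_on_gradient_convex[OF g_convex g_comp_diff] .

lemmas continuous_data =
  continuous_on_compose2[OF continuous_df _ subset_UNIV] continuous_on_compose2[OF continuous_dg _ subset_UNIV]
  continuous_on_compose2[OF continuous_g _ subset_UNIV] continuous_on_compose2[OF continuous_f _ subset_UNIV]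

lemma continuous_F: "continuous_on UNIV F"
proof -
  have "continuous_on UNIV (\<lambda>z. (- df (fst z) - (\<Sum>i\<in>UNIV. (snd z $ i + \<rho> * max 0 (g (fst z) $ i)) *\<^sub>R dg i (fst z)), g (fst z)))"
    by (intro continuous_intros continuous_data)
  then show ?thesis by (simp only: F_eq[symmetric] eta_contract_eq)
qed

lemma Z_iff: "z \<in> Z \<longleftrightarrow> (\<forall>i. 0 \<le> snd z $ i)"
  by (cases z) (auto simp: saddle_domain_def less_eq_vec_def)

lemma solution_iff:
  "z \<in> primal_dual_solutions UNIV f g \<longleftrightarrow>
    (\<forall>i. g (fst z) $ i \<le> 0) \<and> z \<in> Z \<and> df (fst z) + (\<Sum>i\<in>UNIV. snd z $ i *\<^sub>R dg i (fst z)) = 0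
    \<and> (\<forall>i. snd z $ i > 0 \<longrightarrow> g (fst z) $ i = 0)"
  by (cases z) (auto simp: primal_dual_solutions_def normal_cone_UNIV Z_iff less_eq_vec_def matrix_vector_mult_grad_matrix)

text \<open>Both sides include feasibility, since the second component of the field is
  \<open>g\<close>. At feasible points the augmentation vanishes, and the first component is minus
  the gradient of the ordinary Lagrangian.\<close>

lemma equilibria_eq_solutions: "equilibria Z F = primal_dual_solutions UNIV f g"
proof -
  have "z \<in> equilibria Z F \<longleftrightarrow> z \<in> primal_dual_solutions UNIV f g" for z
  proof -
    have eq: "fst (F z) = - (df (fst z) + (\<Sum>i\<in>UNIV. snd z $ i *\<^sub>R dg i (fst z)))" if "\<forall>i. g (fst z) $ i \<le> 0"
      using that by (simp add: F_eq)
    have "fst (F z) = 0 \<longleftrightarrow> df (fst z) + (\<Sum>i\<in>UNIV. snd z $ i *\<^sub>R dg i (fst z)) = 0" if "\<forall>i. g (fst z) $ i \<le> 0"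
      using eq[OF that] by (simp only: neg_equal_0_iff_equal)
    moreover have "snd (F z) = g (fst z)" by (simp add: F_eq)
    ultimately show ?thesis
      unfolding equilibria_def solution_iff using projected_field_eq_0_iff[of z F]
      by (auto simp: less_eq_vec_def)
  qed
  then show ?thesis by blast
qed

lemma zs_facts:
  shows zs_feasible: "g xs $ i \<le> 0" and zs_Z: "zs \<in> Z"
    and zs_stationary: "df xs + (\<Sum>i\<in>UNIV. ms $ i *\<^sub>R dg i xs) = 0"
    and zs_complementary: "ms $ i * g xs $ i = 0" and ms_nonneg: "ms $ i \<ge> 0"
  using zs_solution unfolding solution_iff Z_iff by (auto simp: less_le)

text \<open>The convex-concave structure of the augmented Lagrangian: the weights \<open>a i\<close>
  of the constraint gradients are nonnegative on the domain, so the tangent inequalities of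
  \<open>f\<close> and \<open>g\<close> may be added with these weights.\<close>

lemma inner_F_le:
  assumes z: "z \<in> Z"
  shows "(z - w) \<bullet> F z \<le> f (fst w) - f (fst z) + (\<Sum>i\<in>UNIV.
    (snd z $ i + \<rho> * max 0 (g (fst z) $ i)) * (g (fst w) $ i - g (fst z) $ i)
    + (snd z $ i - snd w $ i) * g (fst z) $ i)"
proof -
  define a where "a i = snd z $ i + \<rho> * max 0 (g (fst z) $ i)" for i
  have a_nonneg: "a i \<ge> 0" for i using z rho_pos by (simp add: a_def Z_iff)
  let ?x = "fst z" and ?y = "fst w"
  have "(z - w) \<bullet> F z = (?x - ?y) \<bullet> (- df ?x - (\<Sum>i\<in>UNIV. a i *\<^sub>R dg i ?x)) + (snd z - snd w) \<bullet> g ?x"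
    by (simp add: inner_prod_def F_eq a_def)
  also have "(?x - ?y) \<bullet> (- df ?x - (\<Sum>i\<in>UNIV. a i *\<^sub>R dg i ?x))
      = (?y - ?x) \<bullet> df ?x + (?y - ?x) \<bullet> (\<Sum>i\<in>UNIV. a i *\<^sub>R dg i ?x)"
    by (simp add: inner_diff_left inner_diff_right)
  also have "(?y - ?x) \<bullet> (\<Sum>i\<in>UNIV. a i *\<^sub>R dg i ?x) = (\<Sum>i\<in>UNIV. a i * ((?y - ?x) \<bullet> dg i ?x))"
    by (simp add: inner_sum_right)
  also have "(snd z - snd w) \<bullet> g ?x = (\<Sum>i\<in>UNIV. (snd z $ i - snd w $ i) * g ?x $ i)"
    by (simp add: inner_vec_def)
  also have "(?y - ?x) \<bullet> df ?x + (\<Sum>i\<in>UNIV. a i * ((?y - ?x) \<bullet> dg i ?x)) + \<dots>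
      \<le> (f ?y - f ?x) + (\<Sum>i\<in>UNIV. a i * (g ?y $ i - g ?x $ i)) + (\<Sum>i\<in>UNIV. (snd z $ i - snd w $ i) * g ?x $ i)"
    by (intro add_mono sum_mono mult_left_mono f_tangent g_tangent a_nonneg order_refl)
  finally show ?thesis by (simp add: a_def sum.distrib)
qed

text \<open>Adding the estimate for \<open>u\<close> and \<open>v\<close> to the one with both
  exchanged cancels \<open>f\<close> and all multiplier terms. What remains is the augmentation,
  whose sign follows from the monotonicity of \<open>max 0\<close>.\<close>

lemma F_monotone:
  assumes u: "u \<in> Z" and v: "v \<in> Z"
  shows "(u - v) \<bullet> (F u - F v) \<le> 0"
proof -
  let ?gu = "\<lambda>i. g (fst u) $ i" and ?gv = "\<lambda>i. g (fst v) $ i"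
  have "(u - v) \<bullet> (F u - F v) = (u - v) \<bullet> F u + (v - u) \<bullet> F v"
    by (simp add: inner_diff_left inner_diff_right)
  also have "\<dots> \<le> (\<Sum>i\<in>UNIV. ((snd u $ i + \<rho> * max 0 (?gu i)) * (?gv i - ?gu i) + (snd u $ i - snd v $ i) * ?gu i)
      + ((snd v $ i + \<rho> * max 0 (?gv i)) * (?gu i - ?gv i) + (snd v $ i - snd u $ i) * ?gv i))"
    using inner_F_le[OF u, of v] inner_F_le[OF v, of u] by (subst sum.distrib) linarith
  also have "\<dots> \<le> 0"
  proof (rule sum_nonpos)
    fix i
    have "((snd u $ i + \<rho> * max 0 (?gu i)) * (?gv i - ?gu i) + (snd u $ i - snd v $ i) * ?gu i)
      + ((snd v $ i + \<rho> * max 0 (?gv i)) * (?gu i - ?gv i) + (snd v $ i - snd u $ i) * ?gv i)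
      = - (\<rho> * ((max 0 (?gu i) - max 0 (?gv i)) * (?gu i - ?gv i)))"
      by (simp add: algebra_simps)
    also have "0 \<le> (max 0 (?gu i) - max 0 (?gv i)) * (?gu i - ?gv i)"
      by (auto simp: zero_le_mult_iff max_def)
    then have "- (\<rho> * ((max 0 (?gu i) - max 0 (?gv i)) * (?gu i - ?gv i))) \<le> 0"
      using rho_pos by simp
    finally show "((snd u $ i + \<rho> * max 0 (?gu i)) * (?gv i - ?gu i) + (snd u $ i - snd v $ i) * ?gu i)
      + ((snd v $ i + \<rho> * max 0 (?gv i)) * (?gu i - ?gv i) + (snd v $ i - snd u $ i) * ?gv i) \<le> 0" .
  qed
  finally show ?thesis .
qed

text \<open>Projecting at \<open>u\<close> lowers the inner product with \<open>u - v\<close>, and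
  projecting at \<open>v\<close> lowers the one with \<open>v - u\<close>.\<close>

lemma PF_monotone:
  assumes u: "u \<in> Z" and v: "v \<in> Z"
  shows "(u - v) \<bullet> (PF u - PF v) \<le> 0"
  using inner_projected_field_le[OF u v, of F] inner_projected_field_le[OF v u, of F] F_monotone[OF u v]
  by (simp add: inner_diff_left inner_diff_right)

text \<open>The value \<open>f xs\<close> is the minimum of the unaugmented Lagrangian with
  multiplier \<open>ms\<close>, as \<open>lagrangian_ge\<close> confirms, so an equation suffices to
  describe its minimizers.\<close>

definition minimizer :: "real^'n \<Rightarrow> bool" where
  "minimizer x \<longleftrightarrow> f x + (\<Sum>i\<in>UNIV. ms $ i * g x $ i) = f xs"

text \<open>Stationarity at \<open>xs\<close> kills the sum of the tangent terms weighted by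
  \<open>1\<close> and \<open>ms\<close>, and complementarity removes the values of \<open>g\<close>
  at \<open>xs\<close>.\<close>

lemma lagrangian_ge: "f x + (\<Sum>i\<in>UNIV. ms $ i * g x $ i) \<ge> f xs"
proof -
  have "0 = (x - xs) \<bullet> (df xs + (\<Sum>i\<in>UNIV. ms $ i *\<^sub>R dg i xs))" by (simp add: zs_stationary)
  also have "\<dots> = (x - xs) \<bullet> df xs + (\<Sum>i\<in>UNIV. ms $ i * ((x - xs) \<bullet> dg i xs))"
    by (simp add: inner_add_right inner_sum_right)
  also have "\<dots> \<le> (f x - f xs) + (\<Sum>i\<in>UNIV. ms $ i * (g x $ i - g xs $ i))"
    by (intro add_mono sum_mono mult_left_mono f_tangent g_tangent ms_nonneg)
  also have "\<dots> = f x - f xs + (\<Sum>i\<in>UNIV. ms $ i * g x $ i)"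
    by (simp add: right_diff_distrib zs_complementary)
  finally show ?thesis by simp
qed

lemma minimizer_xs: "minimizer xs"
  by (simp add: minimizer_def zs_complementary)

lemma minimizer_gradient:
  assumes "minimizer x"
  shows "df x + (\<Sum>i\<in>UNIV. ms $ i *\<^sub>R dg i x) = 0"
proof -
  have "((\<lambda>x. f x + (\<Sum>i\<in>UNIV. ms $ i * g x $ i)) has_derivative
      (\<lambda>h. h \<bullet> df x + (\<Sum>i\<in>UNIV. ms $ i * (h \<bullet> dg i x)))) (at x)"
    by (intro has_derivative_add has_derivative_sum has_derivative_mult_right
        GDERIV_gradient[OF f_diff, unfolded gderiv_def] GDERIV_gradient[OF g_comp_diff, unfolded gderiv_def])
  then have "(\<lambda>h. h \<bullet> df x + (\<Sum>i\<in>UNIV. ms $ i * (h \<bullet> dg i x))) = (\<lambda>h. 0)"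
    by (rule differential_zero_maxmin[of x UNIV, rotated 2])
      (use assms lagrangian_ge in \<open>auto simp: minimizer_def\<close>)
  then have "h \<bullet> (df x + (\<Sum>i\<in>UNIV. ms $ i *\<^sub>R dg i x)) = 0" for h
    by (simp add: inner_add_right inner_sum_right fun_eq_iff)
  then show ?thesis using inner_eq_zero_iff by blast
qed

text \<open>Weighted by \<open>1\<close> and \<open>ms\<close>, the tangent inequalities of \<open>f\<close> and \<open>g\<close> between two minimizers add
  up to an equality, so each of positive weight is tight.\<close>

lemma minimizer_affine:
  assumes x: "minimizer x" and y: "minimizer y" and "ms $ i > 0"
  shows "(y - x) \<bullet> dg i x = g y $ i - g x $ i"
proof -
  define r where "r i = g y $ i - g x $ i - (y - x) \<bullet> dg i x" for i
  have r: "r i \<ge> 0" for i using g_tangent[of y x i] by (simp add: r_def)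
  have "(f y - f x - (y - x) \<bullet> df x) + (\<Sum>i\<in>UNIV. ms $ i * r i)
      = (f y + (\<Sum>i\<in>UNIV. ms $ i * g y $ i)) - (f x + (\<Sum>i\<in>UNIV. ms $ i * g x $ i))
        - (y - x) \<bullet> (df x + (\<Sum>i\<in>UNIV. ms $ i *\<^sub>R dg i x))"
    by (simp add: r_def inner_add_right inner_sum_right right_diff_distrib sum_subtractf)
  also have "\<dots> = 0" using x y by (simp add: minimizer_gradient minimizer_def)
  finally have "(\<Sum>i\<in>UNIV. ms $ i * r i) \<le> 0" using f_tangent[of y x] by linarith
  moreover have "ms $ i * r i \<ge> 0" for i using r ms_nonneg by simp
  ultimately have "ms $ i * r i = 0"
    by (metis (no_types, lifting) UNIV_I finite order.antisym sum_nonneg sum_nonneg_eq_0_iff)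
  then show ?thesis using \<open>ms $ i > 0\<close> by (simp add: r_def)
qed

text \<open>Splits the bound into three contributions, each nonpositive on the domain: optimality of
  the Lagrangian, slackness at \<open>xs\<close>, and violation of the constraints. A zero gap thus
  annihilates each of them.\<close>

lemma gap_le:
  assumes z: "z \<in> Z"
  shows "(z - zs) \<bullet> F z \<le> (f xs - f (fst z) - (\<Sum>i\<in>UNIV. ms $ i * g (fst z) $ i))
    + (\<Sum>i\<in>UNIV. snd z $ i * g xs $ i) - \<rho> * (\<Sum>i\<in>UNIV. (max 0 (g (fst z) $ i))\<^sup>2)"
proof -
  let ?g = "\<lambda>i. g (fst z) $ i"
  have "(z - zs) \<bullet> F z \<le> f xs - f (fst z) + (\<Sum>i\<in>UNIV.
      (snd z $ i + \<rho> * max 0 (?g i)) * (g xs $ i - ?g i) + (snd z $ i - ms $ i) * ?g i)"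
    by (rule inner_F_le[OF z])
  also have "(\<Sum>i\<in>UNIV. (snd z $ i + \<rho> * max 0 (?g i)) * (g xs $ i - ?g i) + (snd z $ i - ms $ i) * ?g i)
      \<le> (\<Sum>i\<in>UNIV. snd z $ i * g xs $ i - ms $ i * ?g i - \<rho> * (max 0 (?g i))\<^sup>2)"
  proof (rule sum_mono)
    fix i
    have "\<rho> * max 0 (?g i) * g xs $ i \<le> 0"
      using rho_pos zs_feasible[of i] by (intro mult_nonneg_nonpos) auto
    moreover have "max 0 (?g i) * ?g i = (max 0 (?g i))\<^sup>2"
      by (simp add: max_def power2_eq_square)
    moreover have "(snd z $ i + \<rho> * max 0 (?g i)) * (g xs $ i - ?g i) + (snd z $ i - ms $ i) * ?g i
        = snd z $ i * g xs $ i - ms $ i * ?g i + \<rho> * max 0 (?g i) * g xs $ i - \<rho> * (max 0 (?g i) * ?g i)"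
      by (simp add: algebra_simps)
    ultimately show "(snd z $ i + \<rho> * max 0 (?g i)) * (g xs $ i - ?g i) + (snd z $ i - ms $ i) * ?g i
        \<le> snd z $ i * g xs $ i - ms $ i * ?g i - \<rho> * (max 0 (?g i))\<^sup>2" by simp
  qed
  finally show ?thesis by (simp add: sum_subtractf sum_distrib_left)
qed

lemma gap_terms:
  assumes z: "z \<in> Z"
  shows "(\<Sum>i\<in>UNIV. snd z $ i * g xs $ i) \<le> 0" and "\<rho> * (\<Sum>i\<in>UNIV. (max 0 (g (fst z) $ i))\<^sup>2) \<ge> 0"
  using z zs_feasible less_imp_le[OF rho_pos]
  by (auto simp: Z_iff intro!: sum_nonpos sum_nonneg mult_nonneg_nonpos mult_nonneg_nonneg)

lemma gap_nonpos: "z \<in> Z \<Longrightarrow> (z - zs) \<bullet> F z \<le> 0"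
  using gap_le[of z] gap_terms[of z] lagrangian_ge[of "fst z"] by linarith

text \<open>Formed with \<open>F\<close> instead of \<open>PF\<close>: only the former is
  continuous, which makes this set closed.\<close>

definition gap_zeros :: "((real^'n) \<times> (real^'m)) set" where
  "gap_zeros = {z \<in> Z. (z - zs) \<bullet> F z = 0}"

text \<open>The three contributions in \<open>gap_le\<close> vanish one by one. The violation term
  carries the factor \<open>\<rho>\<close>, so its positivity is what yields feasibility.\<close>

lemma gap_zerosD:
  assumes "z \<in> gap_zeros"
  shows "z \<in> Z" and "minimizer (fst z)" and "g (fst z) $ i \<le> 0" and "g xs $ i < 0 \<Longrightarrow> snd z $ i = 0"
proof -
  show z: "z \<in> Z" using assms by (simp add: gap_zeros_def)
  have zero: "(z - zs) \<bullet> F z = 0" using assms by (simp add: gap_zeros_def)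
  note * = gap_le[OF z, unfolded zero] gap_terms[OF z] lagrangian_ge[of "fst z"]
  show "minimizer (fst z)" unfolding minimizer_def using * by linarith
  have "\<rho> * (\<Sum>i\<in>UNIV. (max 0 (g (fst z) $ i))\<^sup>2) = 0" using * by linarith
  then have "(\<Sum>i\<in>UNIV. (max 0 (g (fst z) $ i))\<^sup>2) = 0" using rho_pos by simp
  then have "max 0 (g (fst z) $ i) = 0" by (simp add: sum_nonneg_eq_0_iff)
  then show "g (fst z) $ i \<le> 0" by simp
  have "(\<Sum>i\<in>UNIV. - (snd z $ i * g xs $ i)) = 0" using * by (simp add: sum_negf)
  moreover have "- (snd z $ i * g xs $ i) \<ge> 0" for i
    using z zs_feasible[of i] by (simp add: Z_iff mult_nonneg_nonpos)
  ultimately have "snd z $ i * g xs $ i = 0" by (simp add: sum_nonneg_eq_0_iff)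
  then show "snd z $ i = 0" if "g xs $ i < 0" using that by simp
qed

lemma closed_gap_zeros: "closed gap_zeros"
proof -
  have "closed {z. (z - zs) \<bullet> F z = 0}"
    by (intro closed_Collect_eq continuous_intros continuous_F)
  then have "closed (Z \<inter> {z. (z - zs) \<bullet> F z = 0})" using closed_saddle_domain by (rule closed_Int[rotated])
  then show ?thesis by (simp add: gap_zeros_def Int_def)
qed

text \<open>The projected inner product is at most the gap, and the gap is at most \<open>0\<close>;
  if the first is \<open>0\<close>, so is the second. Closedness of \<open>gap_zeros\<close> absorbs
  the closure.\<close>

lemma stationary_set_subset_gap_zeros: "stationary_set Z F zs \<subseteq> gap_zeros"
  unfolding stationary_set_def
proof (rule closure_minimal[OF _ closed_gap_zeros], intro subsetI)
  fix z assume "z \<in> {z \<in> Z. (z - zs) \<bullet> PF z = 0}"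
  then have z: "z \<in> Z" "(z - zs) \<bullet> PF z = 0" by auto
  then have "(z - zs) \<bullet> F z = 0"
    using inner_projected_field_le[OF z(1) zs_Z, of F] gap_nonpos[OF z(1)] by simp
  then show "z \<in> gap_zeros" using z by (simp add: gap_zeros_def)
qed

section \<open>Contraction, boundedness and decay of the gap along trajectories\<close>

lemma zs_equilibrium: "zs \<in> equilibria Z F"
  using zs_solution equilibria_eq_solutions by simp

lemma trajectory_contraction:
  assumes "trajectory Z F y" and "trajectory Z F z" and "0 \<le> s" "s \<le> t"
  shows "dist (y t) (z t) \<le> dist (y s) (z s)"
  using trajectory_dist_nonincreasing[OF assms] PF_monotone by blast

lemma trajectory_bounded:
  assumes "trajectory Z F z" and "t \<ge> 0"
  shows "z t \<in> cball zs (dist (z 0) zs)"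
  using trajectory_contraction[OF assms(1) trajectory_const[OF zs_equilibrium] order_refl assms(2)]
  by (simp add: dist_commute)

lemma trajectory_equilibrium_stays:
  assumes "trajectory Z F z" and "z 0 \<in> equilibria Z F" and "t \<ge> 0"
  shows "z t = z 0"
  using trajectory_contraction[OF assms(1) trajectory_const[OF assms(2)] order_refl assms(3)] by simp

text \<open>A trajectory stays in a ball on which \<open>F\<close> is bounded, so it is Lipschitz,
  and \<open>\<phi>\<close> is uniformly continuous on the ball. This supplies the regularity
  demanded by Barbalat's lemma.\<close>

lemma uniformly_continuous_on_trajectory:
  fixes \<phi> :: "_ \<Rightarrow> 'b::metric_space"
  assumes traj: "trajectory Z F z" and \<phi>: "continuous_on UNIV \<phi>"
  shows "uniformly_continuous_on {0..} (\<lambda>t. \<phi> (z t))"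
proof -
  let ?K = "cball zs (dist (z 0) zs)"
  have in_K: "z t \<in> ?K" if "t \<ge> 0" for t using trajectory_bounded[OF traj that] .
  have "bounded (F ` ?K)"
    by (intro compact_imp_bounded compact_continuous_image continuous_on_subset[OF continuous_F]) auto
  then obtain B where "\<forall>w\<in>F ` ?K. norm w \<le> B" unfolding bounded_iff by blast
  then have "norm (F w) \<le> B" if "w \<in> ?K" for w using that by blast
  then have "norm (PF (z t)) \<le> B" if "t \<ge> 0" for t
    using norm_projected_field_le[OF trajectory_in_domain[OF traj that], of F] in_K[OF that] order_trans by blast
  then have lip: "norm (z t - z s) \<le> B * \<bar>t - s\<bar>" if "s \<ge> 0" "t \<ge> 0" for s t
    using trajectory_lipschitz[OF traj that] by blast
  have "uniformly_continuous_on {0..} z"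
  proof (rule lipschitz_on_uniformly_continuous)
    show "\<bar>B\<bar>-lipschitz_on {0..} z"
    proof (rule lipschitz_onI)
      fix s t :: real assume st: "s \<in> {0..}" "t \<in> {0..}"
      have "dist (z s) (z t) \<le> B * dist s t" using lip[of t s] st by (simp add: dist_norm)
      also have "\<dots> \<le> \<bar>B\<bar> * dist s t" by (intro mult_right_mono) auto
      finally show "dist (z s) (z t) \<le> \<bar>B\<bar> * dist s t" .
    qed simp
  qed
  moreover have "uniformly_continuous_on ?K \<phi>"
    by (intro compact_uniformly_continuous continuous_on_subset[OF \<phi>]) auto
  then have "uniformly_continuous_on (z ` {0..}) \<phi>"
  proof -
    have sub: "z ` {0..} \<subseteq> ?K" using in_K by blast
    assume "uniformly_continuous_on ?K \<phi>"
    then show ?thesis unfolding uniformly_continuous_on_def by (meson sub subsetD)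
  qed
  ultimately show ?thesis
    using uniformly_continuous_on_compose[of "{0..}" z \<phi>] by (simp add: comp_def)
qed

text \<open>The distance to \<open>zs\<close> pays for the gap: the integral of the negated gap
  never exceeds half the initial squared distance, so Barbalat's lemma applies.\<close>

lemma gap_tendsto_0:
  assumes traj: "trajectory Z F z"
  shows "((\<lambda>t. (z t - zs) \<bullet> F (z t)) \<longlongrightarrow> 0) at_top"
proof -
  have cont: "continuous_on UNIV (\<lambda>z. (z - zs) \<bullet> F z)"
    by (intro continuous_intros continuous_F)
  have ucont: "uniformly_continuous_on {0..} (\<lambda>t. - ((z t - zs) \<bullet> F (z t)))"
    using continuous_on_minus[OF cont] by (intro uniformly_continuous_on_trajectory[OF traj])
  have "((\<lambda>t. - ((z t - zs) \<bullet> F (z t))) \<longlongrightarrow> 0) at_top"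
  proof (rule integrand_tendsto_0[OF ucont, where C = "(norm (z 0 - zs))\<^sup>2 / 2"])
    show "- ((z t - zs) \<bullet> F (z t)) \<ge> 0" if "t \<ge> 0" for t
      using gap_nonpos[OF trajectory_in_domain[OF traj that]] by simp
    show "integral {0..t} (\<lambda>t. - ((z t - zs) \<bullet> F (z t))) \<le> (norm (z 0 - zs))\<^sup>2 / 2" if "t \<ge> 0" for t
    proof -
      have "(norm (z t - zs))\<^sup>2 / 2 - (norm (z 0 - zs))\<^sup>2 / 2 \<le> integral {0..t} (\<lambda>t. (z t - zs) \<bullet> F (z t))"
      proof (rule trajectory_energy_le[OF traj order_refl that])
        show "continuous_on {0..t} (\<lambda>t. (z t - zs) \<bullet> F (z t))"
          using continuous_on_compose2[OF cont trajectory_continuous_on[OF traj]]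
          by (auto intro: continuous_on_subset)
      qed (use inner_projected_field_le[OF trajectory_in_domain[OF traj] zs_Z] in auto)
      moreover have "(norm (z t - zs))\<^sup>2 / 2 \<ge> 0" by simp
      ultimately show ?thesis unfolding integral_neg by linarith
    qed
  qed
  then show ?thesis using tendsto_minus_cancel_left[of "\<lambda>t. (z t - zs) \<bullet> F (z t)" 0] by simp
qed

end

lemma closest_point_cball_outside:
  fixes z c :: "'a::euclidean_space"
  assumes "R \<ge> 0" and "z \<notin> cball c R"
  shows "closest_point (cball c R) z = c + (R / dist z c) *\<^sub>R (z - c)"
proof (rule sym, rule closest_point_unique)
  have far: "dist z c > R" using assms(2) by (simp add: dist_commute)
  then have pos: "dist z c > 0" using assms(1) by linarith
  have "norm ((R / dist z c) *\<^sub>R (z - c)) = R"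
    using pos assms(1) by (simp add: dist_norm)
  then show "c + (R / dist z c) *\<^sub>R (z - c) \<in> cball c R" by (simp add: dist_norm)
  have "z - (c + (R / dist z c) *\<^sub>R (z - c)) = (1 - R / dist z c) *\<^sub>R (z - c)"
    by (simp add: algebra_simps)
  then have "dist z (c + (R / dist z c) *\<^sub>R (z - c)) = \<bar>1 - R / dist z c\<bar> * dist z c"
    by (simp add: dist_norm)
  also have "\<dots> = dist z c - R" using pos far by (simp add: field_simps)
  finally have eq: "dist z (c + (R / dist z c) *\<^sub>R (z - c)) = dist z c - R" .
  show "\<forall>w\<in>cball c R. dist z (c + (R / dist z c) *\<^sub>R (z - c)) \<le> dist z w"
  proof
    fix w assume "w \<in> cball c R"
    then show "dist z (c + (R / dist z c) *\<^sub>R (z - c)) \<le> dist z w"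
      using dist_triangle[of z c w] unfolding eq by (simp add: dist_commute)
  qed
qed auto

section \<open>Existence and regularity of saddle trajectories\<close>

context saddle_problem
begin

text \<open>Truncating \<open>F\<close> by the radial projection onto a ball around \<open>zs\<close> keeps the distance to \<open>zs\<close>
  nonincreasing, so the trajectories of the truncated field never meet the truncation.\<close>

lemma saddle_trajectory_exists:
  assumes z0: "z0 \<in> Z"
  obtains y where "trajectory Z F y" and "y 0 = z0"
proof -
  define R where "R = dist z0 zs"
  define P where "P = closest_point (cball zs R)"
  define G where "G = (\<lambda>z. F (P z))"
  have "R \<ge> 0" by (simp add: R_def)
  then have ne: "cball zs R \<noteq> {}" by simp
  have P_in: "P z \<in> cball zs R" for z
    unfolding P_def by (rule closest_point_in_set[OF closed_cball ne])
  have P_lip: "dist (P u) (P v) \<le> dist u v" for u v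
    unfolding P_def by (rule closest_point_lipschitz[OF convex_cball closed_cball ne])
  have "bounded (F ` cball zs R)"
    by (intro compact_imp_bounded compact_continuous_image continuous_on_subset[OF continuous_F]) auto
  then obtain B where B: "\<And>w. w \<in> cball zs R \<Longrightarrow> norm (F w) \<le> B" unfolding bounded_iff by blast
  have "uniformly_continuous_on (cball zs R) F"
    by (intro compact_uniformly_continuous continuous_on_subset[OF continuous_F]) auto
  then have "uniformly_continuous_on Z G"
    unfolding uniformly_continuous_on_def G_def using P_in P_lip by (meson order_le_less_trans)
  moreover have "norm (G z) \<le> B" for z unfolding G_def by (rule B[OF P_in])
  ultimately interpret bounded_field G B by unfold_locales
  obtain y where y: "trajectory Z G y" and y0: "y 0 = z0"
    using trajectory_exists[OF z0] by blast
  \<comment> \<open>Outside a ball of positive radius, \<open>z - zs\<close> is a positive multiple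
    of \<open>P z - zs\<close>. As \<open>P z\<close> is in the domain by convexity, the sign of the
    gap at \<open>P z\<close> carries over.\<close>
  have inward: "(z - zs) \<bullet> G z \<le> 0" if z: "z \<in> Z" for z
  proof (cases "z \<in> cball zs R")
    case True
    then have "G z = F z" by (simp add: G_def P_def closest_point_self)
    then show ?thesis using gap_nonpos[OF z] by simp
  next
    case False
    define c where "c = R / dist z zs"
    have far: "dist z zs > R" using False by (simp add: dist_commute)
    have c: "0 \<le> c" "c \<le> 1" using far \<open>R \<ge> 0\<close> by (auto simp: c_def divide_le_eq)
    have P: "P z = zs + c *\<^sub>R (z - zs)"
      unfolding P_def c_def by (rule closest_point_cball_outside[OF \<open>R \<ge> 0\<close> False])
    show ?thesis
    proof (cases "R = 0")
      case True
      \<comment> \<open>The ball is the single point \<open>zs\<close>, so rescaling is impossible;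
        the equilibrium property of \<open>zs\<close> gives the sign instead.\<close>
      then have "P z = zs" by (simp add: P c_def)
      have "(zs - z) \<bullet> PF zs \<le> (zs - z) \<bullet> F zs"
        by (rule inner_projected_field_le[OF zs_Z z])
      moreover have "PF zs = 0" using zs_equilibrium by (simp add: equilibria_def)
      ultimately show ?thesis by (simp add: G_def \<open>P z = zs\<close> inner_diff_left)
    next
      case False
      then have "c > 0" using \<open>R \<ge> 0\<close> far by (auto simp: c_def intro!: divide_pos_pos)
      have "P z = (1 - c) *\<^sub>R zs + c *\<^sub>R z" by (simp add: P algebra_simps)
      then have "P z \<in> Z"
        using convexD[OF convex_saddle_domain zs_Z z, of "1 - c" c] c by simp
      from gap_nonpos[OF this] have "c * ((z - zs) \<bullet> G z) \<le> 0" by (simp add: G_def P)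
      then show ?thesis using \<open>c > 0\<close> by (simp add: mult_le_0_iff)
    qed
  qed
  have in_ball: "y t \<in> cball zs R" if "t \<ge> 0" for t
  proof -
    have "(norm (y t - zs))\<^sup>2 / 2 - (norm (y 0 - zs))\<^sup>2 / 2 \<le> integral {0..t} (\<lambda>_. 0)"
    proof (rule trajectory_energy_le[OF y order_refl that])
      fix \<tau> assume "\<tau> \<in> {0..t}"
      then have "y \<tau> \<in> Z" using trajectory_in_domain[OF y] by simp
      then show "(y \<tau> - zs) \<bullet> projected_field Z G (y \<tau>) \<le> 0"
        using inner_projected_field_le[OF _ zs_Z, of "y \<tau>" G] inward[of "y \<tau>"] by linarith
    qed simp
    then have "(norm (y t - zs))\<^sup>2 \<le> R\<^sup>2" by (simp add: y0 R_def dist_norm)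
    then have "norm (y t - zs) \<le> R" using \<open>R \<ge> 0\<close> by (rule power2_le_imp_le)
    then show ?thesis by (simp add: dist_norm norm_minus_commute)
  qed
  have "projected_field Z G (y t) = PF (y t)" if "t \<ge> 0" for t
    using in_ball[OF that] by (simp add: projected_field_def G_def P_def closest_point_self)
  then have "trajectory Z F y"
    using y unfolding trajectory_def by (auto elim: eventually_mono)
  then show ?thesis using y0 that by blast
qed

text \<open>The projection never acts on the first component, whose velocity is therefore a
  continuous function of time. The integral equation then upgrades differentiability almost
  everywhere to every time.\<close>

lemma trajectory_fst_derivative:
  assumes traj: "trajectory Z F z" and "t \<ge> 0"
  shows "((\<lambda>t. fst (z t)) has_vector_derivative fst (F (z t))) (at t within {0..})"
proof (rule has_vector_derivative_vecI)
  fix j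
  define c where "c t = fst (F (z t)) $ j" for t
  have cont: "continuous_on {0..} c"
    unfolding c_def
    by (intro continuous_intros continuous_on_compose2[OF continuous_F trajectory_continuous_on[OF traj]]) auto
  have PF: "fst (PF (z s)) $ j = c s" if "s \<ge> 0" for s
    by (simp add: projected_field_saddle_domain[OF trajectory_in_domain[OF traj that]] c_def)
  have inner: "w \<bullet> (axis j a, 0) = fst w $ j * a" for w :: "(real^'n) \<times> (real^'m)" and a
    by (simp add: inner_prod_def inner_axis)
  have eq: "fst (z s) $ j = fst (z 0) $ j + integral {0..s} c" if "s \<ge> 0" for s
  proof -
    have cont': "continuous_on {0..s} c" by (rule continuous_on_subset[OF cont]) auto
    \<comment> \<open>Testing with both signs of the axis vector turns the one-sided increment
      estimate into an equation.\<close>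
    have "z s \<bullet> (axis j 1, 0) - z 0 \<bullet> (axis j 1, 0) \<le> integral {0..s} c"
      by (rule trajectory_inner_increment_le[OF traj order_refl that cont']) (simp add: inner PF)
    moreover have "z s \<bullet> (axis j (-1), 0) - z 0 \<bullet> (axis j (-1), 0) \<le> integral {0..s} (\<lambda>t. - c t)"
      by (rule trajectory_inner_increment_le[OF traj order_refl that continuous_on_minus[OF cont']]) (simp add: inner PF)
    ultimately show ?thesis by (simp add: inner)
  qed
  have "((\<lambda>s. integral {0..s} c) has_vector_derivative c t) (at t within {0..t + 1})"
    using \<open>t \<ge> 0\<close> by (intro integral_has_vector_derivative continuous_on_subset[OF cont]) auto
  moreover have "at t within {0..t + 1} = at t within {0..}"
    by (rule at_within_nhd[of t "{..<t + 1}"]) auto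
  ultimately have "((\<lambda>s. fst (z 0) $ j + integral {0..s} c) has_vector_derivative 0 + c t) (at t within {0..})"
    by (intro has_vector_derivative_add has_vector_derivative_const) simp
  then have "((\<lambda>s. fst (z 0) $ j + integral {0..s} c) has_vector_derivative c t) (at t within {0..})"
    by simp
  then have "((\<lambda>s. fst (z s) $ j) has_vector_derivative c t) (at t within {0..})"
    by (rule has_vector_derivative_transform[rotated 2]) (use \<open>t \<ge> 0\<close> in simp, rule eq, simp)
  then show "((\<lambda>t. fst (z t) $ j) has_vector_derivative fst (F (z t)) $ j) (at t within {0..})"
    by (simp add: c_def)
qed

lemma trajectory_limit_point:
  assumes traj: "trajectory Z F z" and T: "\<And>n. T n \<ge> 0"
  obtains p r where "strict_mono (r :: nat \<Rightarrow> nat)" and "(\<lambda>n. z (T (r n))) \<longlonglongrightarrow> p"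
proof -
  have "seq_compact (cball zs (dist (z 0) zs))"
    by (intro compact_imp_seq_compact compact_cball)
  moreover have "\<forall>n. z (T n) \<in> cball zs (dist (z 0) zs)"
    using trajectory_bounded[OF traj T] by blast
  ultimately obtain p r where "p \<in> cball zs (dist (z 0) zs)" "strict_mono (r :: nat \<Rightarrow> nat)" "((\<lambda>n. z (T n)) \<circ> r) \<longlonglongrightarrow> p"
    by (rule seq_compactE)
  then show ?thesis using that by (simp add: comp_def)
qed

text \<open>Feasibility removes the augmentation, and stationarity of the Lagrangian with multiplier
  \<open>ms\<close> at \<open>fst z\<close> eliminates the gradient of \<open>f\<close>.\<close>

lemma fst_F_gap_zeros:
  assumes "z \<in> gap_zeros"
  shows "fst (F z) = - (\<Sum>i\<in>UNIV. (snd z $ i - ms $ i) *\<^sub>R dg i (fst z))"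
proof -
  have "df (fst z) = - (\<Sum>i\<in>UNIV. ms $ i *\<^sub>R dg i (fst z))"
    using minimizer_gradient[OF gap_zerosD(2)[OF assms]] by (simp add: add_eq_0_iff2)
  moreover have "fst (F z) = - df (fst z) - (\<Sum>i\<in>UNIV. snd z $ i *\<^sub>R dg i (fst z))"
    using gap_zerosD(3)[OF assms] by (simp add: F_eq)
  ultimately show ?thesis by (simp add: scaleR_diff_left sum_subtractf)
qed

section \<open>Trajectories of vanishing gap under strict complementarity\<close>

context
  assumes strict: "strictly_complementary g zs"
begin

text \<open>The place where strict complementarity enters: a constraint of weight \<open>0\<close>
  is inactive at \<open>xs\<close>, and zero gap forces the multiplier of such a constraint to
  vanish.\<close>

lemma gap_zeros_inactive:
  assumes "z \<in> gap_zeros" and "\<not> ms $ i > 0"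
  shows "ms $ i = 0" and "snd z $ i = 0"
proof -
  show "ms $ i = 0" using assms(2) ms_nonneg[of i] by simp
  have "g xs $ i \<noteq> 0" using strict assms(2) by (auto simp: strictly_complementary_def)
  then show "snd z $ i = 0" using gap_zerosD(4)[OF assms(1)] zs_feasible[of i] by simp
qed

text \<open>Constraints of positive weight vanish at \<open>w\<close> and are affine between
  minimizers, so the gradient tested with \<open>fst z - w\<close> returns the value of
  \<open>g\<close> itself. The others have coefficient \<open>0\<close>.\<close>

lemma gap_zeros_inner_fst_F:
  assumes z: "z \<in> gap_zeros" and w: "minimizer w" and w0: "\<And>i. ms $ i * g w $ i = 0"
  shows "(fst z - w) \<bullet> fst (F z) = - (\<Sum>i\<in>UNIV. (snd z $ i - ms $ i) * g (fst z) $ i)"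
proof -
  have "(fst z - w) \<bullet> fst (F z) = - (\<Sum>i\<in>UNIV. (snd z $ i - ms $ i) * ((fst z - w) \<bullet> dg i (fst z)))"
    by (simp add: fst_F_gap_zeros[OF z] inner_sum_right)
  also have "\<dots> = - (\<Sum>i\<in>UNIV. (snd z $ i - ms $ i) * g (fst z) $ i)"
  proof (intro arg_cong[where f = uminus] sum.cong refl)
    fix i
    show "(snd z $ i - ms $ i) * ((fst z - w) \<bullet> dg i (fst z)) = (snd z $ i - ms $ i) * g (fst z) $ i"
    proof (cases "ms $ i > 0")
      case True
      then have "g w $ i = 0" using w0[of i] by simp
      with minimizer_affine[OF gap_zerosD(2)[OF z] w True] have "(fst z - w) \<bullet> dg i (fst z) = g (fst z) $ i"
        by (simp add: inner_diff_left)
      then show ?thesis by simp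
    qed (use gap_zeros_inactive[OF z] in simp)
  qed
  finally show ?thesis .
qed

text \<open>Two energies drive the argument: \<open>(norm (x - xs))\<^sup>2 / 2 + (norm \<mu>)\<^sup>2 / 2\<close> decreases at rate
  \<open>- ms \<bullet> g x\<close>, which yields a limit point \<open>p\<close> that is an equilibrium, and the distance to \<open>p\<close> is
  constant.\<close>

lemma trajectory_in_gap_zeros_const:
  assumes traj: "trajectory Z F z" and stays: "\<And>t. t \<ge> 0 \<Longrightarrow> z t \<in> gap_zeros"
  shows "z 0 \<in> equilibria Z F"
proof -
  let ?x = "\<lambda>t. fst (z t)" and ?mu = "\<lambda>t. snd (z t)"
  have zZ: "z t \<in> Z" if "t \<ge> 0" for t using trajectory_in_domain[OF traj that] .
  note contz = trajectory_continuous_on[OF traj]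
  have g_le: "g (?x t) $ i \<le> 0" if "t \<ge> 0" for t i using gap_zerosD(3)[OF stays[OF that]] .
  have snd_PF: "snd (PF (z t)) $ i = (if ?mu t $ i = 0 then 0 else g (?x t) $ i)" if "t \<ge> 0" for t i
    using g_le[OF that, of i] by (simp add: projected_field_saddle_domain[OF zZ[OF that]] F_eq)
  have fst_PF: "fst (PF (z t)) = fst (F (z t))" if "t \<ge> 0" for t
    by (simp add: projected_field_saddle_domain[OF zZ[OF that]])
  have mu_decr: "?mu t $ i \<le> ?mu s $ i" if "0 \<le> s" "s \<le> t" for s t i
  proof -
    have "z t \<bullet> (0, axis i 1) - z s \<bullet> (0, axis i 1) \<le> integral {s..t} (\<lambda>_. 0)"
    proof (rule trajectory_inner_increment_le[OF traj that])
      fix \<tau> assume "\<tau> \<in> {s..t}"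
      then have "\<tau> \<ge> 0" using that by simp
      then show "PF (z \<tau>) \<bullet> (0, axis i 1) \<le> 0"
        using g_le[of \<tau> i] by (simp add: inner_prod_def inner_axis snd_PF)
    qed simp
    then show ?thesis by (simp add: inner_prod_def inner_axis)
  qed
  define q where "q t = - (\<Sum>i\<in>UNIV. ms $ i * g (?x t) $ i)" for t
  have "continuous_on UNIV (\<lambda>z. - (\<Sum>i\<in>UNIV. ms $ i * g (fst z) $ i))"
    by (intro continuous_intros continuous_data)
  then have q_uc: "uniformly_continuous_on {0..} q"
    unfolding q_def by (intro uniformly_continuous_on_trajectory[OF traj])
  have terms: "- (ms $ i * g (?x t) $ i) \<ge> 0" if "t \<ge> 0" for t i
    using g_le[OF that] ms_nonneg by (simp add: mult_nonneg_nonpos)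
  have "(q \<longlongrightarrow> 0) at_top"
  proof (rule integrand_tendsto_0[OF q_uc, where C = "(norm (z 0 - (xs, 0)))\<^sup>2 / 2"])
    show "q t \<ge> 0" if "t \<ge> 0" for t
      using sum_nonneg[of UNIV "\<lambda>i. - (ms $ i * g (?x t) $ i)"] terms[OF that] by (simp add: q_def sum_negf)
    show "integral {0..t} q \<le> (norm (z 0 - (xs, 0)))\<^sup>2 / 2" if "t \<ge> 0" for t
    proof -
      have cont_q: "continuous_on {0..t} (\<lambda>t. - q t)"
        using uniformly_continuous_imp_continuous[OF q_uc]
        by (intro continuous_on_minus) (auto intro: continuous_on_subset)
      \<comment> \<open>The multiplier of the centre is \<open>0\<close> so that the products of the
        current multipliers with \<open>g\<close> cancel between the two components and only those
        with \<open>ms\<close> remain. It also hides the projection, which acts only on coordinates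
        where the multiplier is \<open>0\<close>.\<close>
      have "(norm (z t - (xs, 0)))\<^sup>2 / 2 - (norm (z 0 - (xs, 0)))\<^sup>2 / 2 \<le> integral {0..t} (\<lambda>t. - q t)"
      proof (rule trajectory_energy_le[OF traj order_refl that cont_q])
        fix \<tau> assume "\<tau> \<in> {0..t}"
        then have "\<tau> \<ge> 0" by simp
        have "(z \<tau> - (xs, 0)) \<bullet> PF (z \<tau>)
            = (?x \<tau> - xs) \<bullet> fst (F (z \<tau>)) + (\<Sum>i\<in>UNIV. ?mu \<tau> $ i * snd (PF (z \<tau>)) $ i)"
          by (simp add: inner_prod_def fst_PF[OF \<open>\<tau> \<ge> 0\<close>] inner_vec_def[of "?mu \<tau>"])
        also have "(?x \<tau> - xs) \<bullet> fst (F (z \<tau>)) = - (\<Sum>i\<in>UNIV. (?mu \<tau> $ i - ms $ i) * g (?x \<tau>) $ i)"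
          using gap_zeros_inner_fst_F[OF stays[OF \<open>\<tau> \<ge> 0\<close>] minimizer_xs zs_complementary] .
        also have "(\<Sum>i\<in>UNIV. ?mu \<tau> $ i * snd (PF (z \<tau>)) $ i) = (\<Sum>i\<in>UNIV. ?mu \<tau> $ i * g (?x \<tau>) $ i)"
          by (rule sum.cong) (auto simp: snd_PF[OF \<open>\<tau> \<ge> 0\<close>])
        finally show "(z \<tau> - (xs, 0)) \<bullet> PF (z \<tau>) \<le> - q \<tau>"
          by (simp add: q_def left_diff_distrib sum_subtractf)
      qed
      moreover have "(norm (z t - (xs, 0)))\<^sup>2 / 2 \<ge> 0" by simp
      ultimately show ?thesis unfolding integral_neg by linarith
    qed
  qed
  \<comment> \<open>All summands of \<open>q\<close> are nonnegative, so each of them inherits the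
    limit \<open>0\<close>.\<close>
  have active: "((\<lambda>t. ms $ i * g (?x t) $ i) \<longlongrightarrow> 0) at_top" for i
  proof (rule tendsto_sandwich[OF _ _ _ tendsto_const])
    show "((\<lambda>t. - q t) \<longlongrightarrow> 0) at_top" using tendsto_minus[OF \<open>(q \<longlongrightarrow> 0) at_top\<close>] by simp
    show "\<forall>\<^sub>F t in at_top. - q t \<le> ms $ i * g (?x t) $ i"
      using eventually_ge_at_top[of "0::real"]
    proof eventually_elim
      fix t :: real assume "t \<ge> 0"
      have "- (ms $ i * g (?x t) $ i) \<le> (\<Sum>i\<in>UNIV. - (ms $ i * g (?x t) $ i))"
        by (rule member_le_sum) (use terms[OF \<open>t \<ge> 0\<close>] in auto)
      then show "- q t \<le> ms $ i * g (?x t) $ i" by (simp add: q_def sum_negf)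
    qed
    show "\<forall>\<^sub>F t in at_top. ms $ i * g (?x t) $ i \<le> 0"
      using eventually_ge_at_top[of "0::real"] by eventually_elim (use terms[of _ i] in force)
  qed
  obtain p r where r: "strict_mono (r :: nat \<Rightarrow> nat)" and p: "(\<lambda>n. z (real (r n))) \<longlonglongrightarrow> p"
    using trajectory_limit_point[OF traj, of real, OF of_nat_0_le_iff] by blast
  have r_top: "filterlim (\<lambda>n. real (r n)) at_top sequentially"
    using filterlim_compose[OF filterlim_real_sequentially filterlim_subseq[OF r]] .
  have pQ: "p \<in> gap_zeros"
    using closed_sequentially[OF closed_gap_zeros _ p] stays by simp
  have mu_ge: "snd p $ i \<le> ?mu t $ i" if "t \<ge> 0" for t i
  proof (rule tendsto_upperbound[OF tendsto_vec_nth[OF tendsto_snd[OF p]]])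
    show "\<forall>\<^sub>F n in sequentially. ?mu (real (r n)) $ i \<le> ?mu t $ i"
      using r_top[unfolded filterlim_at_top, rule_format, of t] by eventually_elim (use mu_decr that in blast)
  qed simp
  have gp: "ms $ i * g (fst p) $ i = 0" for i
  proof -
    have "(\<lambda>n. ms $ i * g (?x (real (r n))) $ i) \<longlonglongrightarrow> ms $ i * g (fst p) $ i"
      by (intro tendsto_intros continuous_on_tendsto_compose[OF continuous_g] p) auto
    moreover have "(\<lambda>n. ms $ i * g (?x (real (r n))) $ i) \<longlonglongrightarrow> 0"
      using filterlim_compose[OF active r_top] .
    ultimately show ?thesis by (rule LIMSEQ_unique)
  qed
  \<comment> \<open>The multipliers are frozen at their limit \<open>snd p\<close>, so that
    \<open>- dh (fst p)\<close> is exactly the velocity of the first component at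
    \<open>p\<close>.\<close>
  define h where "h x = (\<Sum>i\<in>UNIV. (snd p $ i - ms $ i) * g x $ i)" for x
  define dh where "dh x = (\<Sum>i\<in>UNIV. (snd p $ i - ms $ i) *\<^sub>R dg i x)" for x
  have h_der: "(h has_derivative (\<lambda>v. v \<bullet> dh x)) (at x)" for x
  proof -
    have "(h has_derivative (\<lambda>v. \<Sum>i\<in>UNIV. (snd p $ i - ms $ i) * (v \<bullet> dg i x))) (at x)"
      unfolding h_def
      by (intro has_derivative_sum has_derivative_mult_right GDERIV_gradient[OF g_comp_diff, unfolded gderiv_def])
    then show ?thesis by (simp add: dh_def inner_sum_right)
  qed
  have h_lim: "((\<lambda>t. h (?x t)) \<longlongrightarrow> 0) at_top"
  proof -
    have "((\<lambda>t. (snd p $ i - ms $ i) * g (?x t) $ i) \<longlongrightarrow> 0) at_top" for i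
    proof (cases "ms $ i > 0")
      case True
      have "((\<lambda>t. (snd p $ i - ms $ i) / ms $ i * (ms $ i * g (?x t) $ i)) \<longlongrightarrow> (snd p $ i - ms $ i) / ms $ i * 0) at_top"
        by (intro tendsto_mult_left active)
      moreover have "(snd p $ i - ms $ i) / ms $ i * (ms $ i * a) = (snd p $ i - ms $ i) * a" for a
        using True by simp
      ultimately show ?thesis by simp
    next
      case False
      then show ?thesis using gap_zeros_inactive[OF pQ False] by simp
    qed
    then have "((\<lambda>t. h (?x t)) \<longlongrightarrow> (\<Sum>i\<in>(UNIV::'m set). 0)) at_top"
      unfolding h_def by (intro tendsto_sum)
    then show ?thesis by simp
  qed
  have cont_dh: "continuous_on UNIV (\<lambda>z. fst (F z) \<bullet> dh (fst z))"
    unfolding dh_def by (intro continuous_intros continuous_data continuous_F)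
  \<comment> \<open>Barbalat's lemma for \<open>h\<close> along the trajectory. At the limit point
    this derivative is minus the squared norm of \<open>dh (fst p)\<close>, so the velocity there
    vanishes.\<close>
  have "((\<lambda>t. fst (F (z t)) \<bullet> dh (?x t)) \<longlongrightarrow> 0) at_top"
  proof (rule deriv_tendsto_0_of_tendsto[OF _ _ h_lim])
    show "uniformly_continuous_on {0..} (\<lambda>t. fst (F (z t)) \<bullet> dh (?x t))"
      using cont_dh by (rule uniformly_continuous_on_trajectory[OF traj])
    show "((\<lambda>t. h (?x t)) has_vector_derivative fst (F (z t)) \<bullet> dh (?x t)) (at t within {0..})" if "t \<ge> 0" for t
      using vector_derivative_diff_chain_within[OF trajectory_fst_derivative[OF traj that] has_derivative_at_withinI[OF h_der]]
      by (simp add: comp_def)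
  qed
  from filterlim_compose[OF this r_top]
  have "(\<lambda>n. fst (F (z (real (r n)))) \<bullet> dh (?x (real (r n)))) \<longlonglongrightarrow> 0" .
  moreover have "(\<lambda>n. fst (F (z (real (r n)))) \<bullet> dh (?x (real (r n)))) \<longlonglongrightarrow> fst (F p) \<bullet> dh (fst p)"
    by (rule continuous_on_tendsto_compose[OF cont_dh p]) auto
  ultimately have "fst (F p) \<bullet> dh (fst p) = 0" by (rule LIMSEQ_unique[symmetric])
  moreover have Fp: "fst (F p) = - dh (fst p)" by (simp add: fst_F_gap_zeros[OF pQ] dh_def)
  ultimately have dh0: "dh (fst p) = 0" by simp
  have p_eq: "p \<in> equilibria Z F"
  proof -
    have "g (fst p) $ i = 0" if "snd p $ i > 0" for i
      using gap_zeros_inactive[OF pQ, of i] gp[of i] that by force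
    then show ?thesis
      using projected_field_eq_0_iff[OF gap_zerosD(1)[OF pQ], of F] gap_zerosD(1,3)[OF pQ] Fp dh0
      by (auto simp: equilibria_def F_eq less_eq_vec_def)
  qed
  \<comment> \<open>Adding the two components leaves \<open>- h\<close>, which between minimizers is
    affine with slope \<open>dh (fst p) = 0\<close> and vanishes at \<open>fst p\<close>.\<close>
  have orth: "(z t - p) \<bullet> PF (z t) = 0" if "t \<ge> 0" for t
  proof -
    have "(z t - p) \<bullet> PF (z t) = (?x t - fst p) \<bullet> fst (F (z t)) + (\<Sum>i\<in>UNIV. (?mu t $ i - snd p $ i) * snd (PF (z t)) $ i)"
      by (simp add: inner_prod_def fst_PF[OF that] inner_vec_def[of "?mu t - snd p"])
    also have "(?x t - fst p) \<bullet> fst (F (z t)) = - (\<Sum>i\<in>UNIV. (?mu t $ i - ms $ i) * g (?x t) $ i)"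
      using gap_zeros_inner_fst_F[OF stays[OF that] gap_zerosD(2)[OF pQ] gp] .
    also have "(\<Sum>i\<in>UNIV. (?mu t $ i - snd p $ i) * snd (PF (z t)) $ i) = (\<Sum>i\<in>UNIV. (?mu t $ i - snd p $ i) * g (?x t) $ i)"
    proof (rule sum.cong[OF refl])
      fix i
      \<comment> \<open>Multipliers only decrease, so one that has reached \<open>0\<close> has
        limit \<open>0\<close>; the factor then vanishes wherever the projection is active.\<close>
      have "snd p $ i = 0" if "?mu t $ i = 0"
        using mu_ge[OF \<open>t \<ge> 0\<close>, of i] gap_zerosD(1)[OF pQ] that by (auto simp: Z_iff intro: order.antisym)
      then show "(?mu t $ i - snd p $ i) * snd (PF (z t)) $ i = (?mu t $ i - snd p $ i) * g (?x t) $ i"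
        by (auto simp: snd_PF[OF that])
    qed
    also have "- (\<Sum>i\<in>UNIV. (?mu t $ i - ms $ i) * g (?x t) $ i) + (\<Sum>i\<in>UNIV. (?mu t $ i - snd p $ i) * g (?x t) $ i)
        = - h (?x t)"
      by (simp add: h_def left_diff_distrib sum_subtractf)
    also have "h (?x t) = (?x t - fst p) \<bullet> dh (fst p)"
      unfolding h_def dh_def inner_sum_right
    proof (rule sum.cong[OF refl])
      fix i
      show "(snd p $ i - ms $ i) * g (?x t) $ i = (?x t - fst p) \<bullet> ((snd p $ i - ms $ i) *\<^sub>R dg i (fst p))"
      proof (cases "ms $ i > 0")
        case True
        then have "g (fst p) $ i = 0" using gp[of i] by simp
        then show ?thesis
          using minimizer_affine[OF gap_zerosD(2)[OF pQ] gap_zerosD(2)[OF stays[OF that]] True] by simp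
      qed (use gap_zeros_inactive[OF pQ] in simp)
    qed
    finally show ?thesis by (simp add: dh0)
  qed
  \<comment> \<open>The distance to \<open>p\<close> never falls below its initial value, yet it
    tends to \<open>0\<close> along the subsequence.\<close>
  have "norm (z 0 - p) \<le> 0"
  proof (rule tendsto_lowerbound)
    show "(\<lambda>n. norm (z (real (r n)) - p)) \<longlonglongrightarrow> 0"
      using tendsto_norm[OF tendsto_diff[OF p tendsto_const[of p]]] by simp
    have "norm (z 0 - p) \<le> norm (z (real (r n)) - p)" for n
      by (rule trajectory_dist_nondecreasing[OF traj order_refl]) (use orth in auto)
    then show "\<forall>\<^sub>F n in sequentially. norm (z 0 - p) \<le> norm (z (real (r n)) - p)" by simp
  qed simp
  then show ?thesis using p_eq by simp
qed

lemma largest_invariant_subset_eq_equilibria: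
  "largest_invariant_subset Z F (stationary_set Z F zs) = equilibria Z F"
proof
  show "largest_invariant_subset Z F (stationary_set Z F zs) \<subseteq> equilibria Z F"
  proof
    fix z0 assume "z0 \<in> largest_invariant_subset Z F (stationary_set Z F zs)"
    then obtain S where S: "z0 \<in> S" "S \<subseteq> stationary_set Z F zs" "invariant_set Z F S"
      by (auto simp: largest_invariant_subset_def)
    then have "z0 \<in> Z" by (auto simp: invariant_set_def)
    then obtain y where y: "trajectory Z F y" "y 0 = z0" by (rule saddle_trajectory_exists)
    have "y t \<in> gap_zeros" if "t \<ge> 0" for t
      using S y that stationary_set_subset_gap_zeros unfolding invariant_set_def by blast
    then show "z0 \<in> equilibria Z F"
      using trajectory_in_gap_zeros_const[OF y(1)] y(2) by simp
  qed
  \<comment> \<open>Conversely, the equilibria qualify as an invariant subset; their invariance is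
    contraction towards the constant trajectory.\<close>
  have "equilibria Z F \<subseteq> stationary_set Z F zs"
    unfolding stationary_set_def equilibria_def by (rule subset_trans[OF _ closure_subset]) auto
  moreover have "invariant_set Z F (equilibria Z F)"
    unfolding invariant_set_def
  proof (intro conjI allI impI)
    show "equilibria Z F \<subseteq> Z" by (auto simp: equilibria_def)
    show "z t \<in> equilibria Z F" if "trajectory Z F z" "z 0 \<in> equilibria Z F" "t \<ge> 0" for z t
      using trajectory_equilibrium_stays[OF that] that(2) by simp
  qed
  ultimately show "equilibria Z F \<subseteq> largest_invariant_subset Z F (stationary_set Z F zs)"
    by (auto simp: largest_invariant_subset_def)
qed

lemma trajectory_converges:
  assumes traj: "trajectory Z F z"
  shows "((\<lambda>t. infdist (z t) (primal_dual_solutions UNIV f g)) \<longlongrightarrow> 0) at_top"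
proof (rule ccontr)
  let ?d = "\<lambda>t. infdist (z t) (primal_dual_solutions UNIV f g)"
  assume "\<not> (?d \<longlongrightarrow> 0) at_top"
  then obtain e where "e > 0" and "\<not> (\<forall>\<^sub>F t in at_top. dist (?d t) 0 < e)"
    unfolding tendsto_iff by blast
  \<comment> \<open>Failure of convergence gives arbitrarily late times at distance at least
    \<open>e\<close> from the solutions; a limit point along these times will turn out to be a
    solution.\<close>
  then have "\<exists>t\<ge>T. ?d t \<ge> e" for T
    unfolding eventually_at_top_linorder by (metis dist_0_norm dist_commute infdist_nonneg not_less real_norm_def abs_of_nonneg)
  then have "\<forall>n::nat. \<exists>t. t \<ge> real n \<and> ?d t \<ge> e" by blast
  from choice[OF this] obtain T where "\<forall>n::nat. T n \<ge> real n \<and> ?d (T n) \<ge> e" by (elim exE)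
  then have T: "T n \<ge> real n" "?d (T n) \<ge> e" for n :: nat by simp_all
  have T_nonneg: "T n \<ge> 0" for n using T(1)[of n] of_nat_0_le_iff[of n] by linarith
  obtain p r where r: "strict_mono (r :: nat \<Rightarrow> nat)" and p: "(\<lambda>n. z (T (r n))) \<longlonglongrightarrow> p"
    using trajectory_limit_point[OF traj, of T, OF T_nonneg] by blast
  have pZ: "p \<in> Z"
    using closed_sequentially[OF closed_saddle_domain _ p] trajectory_in_domain[OF traj T_nonneg] by blast
  then obtain y where y: "trajectory Z F y" "y 0 = p" by (rule saddle_trajectory_exists)
  have "y s \<in> gap_zeros" if "s \<ge> 0" for s
  proof -
    \<comment> \<open>The trajectory restarted at time \<open>T (r n)\<close> begins ever closer to
      \<open>p\<close>, and contraction keeps it as close to \<open>y\<close> at every later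
      \<open>s\<close>. The gap at \<open>y s\<close> is therefore a limit of gaps of
      \<open>z\<close> at late times.\<close>
    have "(\<lambda>n. z (T (r n) + s)) \<longlonglongrightarrow> y s"
    proof (rule metric_tendsto_imp_tendsto[OF p])
      have "dist (z (T (r n) + s)) (y s) \<le> dist (z (T (r n))) p" for n
        using trajectory_contraction[OF trajectory_shift[OF traj T_nonneg] y(1) order_refl that, of "r n"]
        by (simp add: y(2))
      then show "\<forall>\<^sub>F n in sequentially. dist (z (T (r n) + s)) (y s) \<le> dist (z (T (r n))) p" by simp
    qed
    moreover have "continuous_on UNIV (\<lambda>z. (z - zs) \<bullet> F z)"
      by (intro continuous_intros continuous_F)
    ultimately have "(\<lambda>n. (z (T (r n) + s) - zs) \<bullet> F (z (T (r n) + s))) \<longlonglongrightarrow> (y s - zs) \<bullet> F (y s)"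
      using continuous_on_tendsto_compose[of UNIV "\<lambda>z. (z - zs) \<bullet> F z" "\<lambda>n. z (T (r n) + s)" "y s"] by simp
    moreover have "(\<lambda>n. (z (T (r n) + s) - zs) \<bullet> F (z (T (r n) + s))) \<longlonglongrightarrow> 0"
    proof (rule filterlim_compose[OF gap_tendsto_0[OF traj]])
      show "filterlim (\<lambda>n. T (r n) + s) at_top sequentially"
      proof (rule filterlim_at_top_mono[OF filterlim_real_sequentially])
        have "real n \<le> T (r n) + s" for n
          using T(1)[of "r n"] strict_mono_imp_increasing[OF r, of n] that by linarith
        then show "\<forall>\<^sub>F n in sequentially. real n \<le> T (r n) + s" by simp
      qed
    qed
    ultimately have "(y s - zs) \<bullet> F (y s) = 0" by (rule LIMSEQ_unique)
    then show ?thesis using trajectory_in_domain[OF y(1) that] by (simp add: gap_zeros_def)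
  qed
  then have "p \<in> primal_dual_solutions UNIV f g"
    using trajectory_in_gap_zeros_const[OF y(1)] y(2) equilibria_eq_solutions by simp
  then have "e \<le> dist (z (T (r n))) p" for n
    using T(2)[of "r n"] infdist_le[of p "primal_dual_solutions UNIV f g" "z (T (r n))"] by linarith
  moreover have "\<forall>\<^sub>F n in sequentially. dist (z (T (r n))) p < e"
    using p \<open>e > 0\<close> by (rule tendstoD)
  ultimately show False by (metis (mono_tags, lifting) eventually_sequentially not_less order_refl)
qed

end

end

theorem theorem3:
  fixes f :: "real^'n \<Rightarrow> real" and g :: "real^'n \<Rightarrow> real^'m"
    and \<rho> :: real and zs :: "(real^'n) \<times> (real^'m)"
  assumes "convex_on UNIV f" and "\<And>x. f differentiable (at x)"
    and "\<And>i. convex_on UNIV (\<lambda>x. g x $ i)" and "\<And>x. g differentiable (at x)"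
    and "\<exists>x. is_optimizer UNIV f g x"
    and "slater UNIV g"
    and "zs \<in> primal_dual_solutions UNIV f g" and "strictly_complementary g zs"
    and "\<rho> > 0"
  shows "largest_invariant_subset (saddle_domain UNIV) (saddle_field f g \<rho>)
           (stationary_set (saddle_domain UNIV) (saddle_field f g \<rho>) zs)
         = equilibria (saddle_domain UNIV) (saddle_field f g \<rho>)
       \<and> (\<forall>z. trajectory (saddle_domain UNIV) (saddle_field f g \<rho>) z \<longrightarrow>
           ((\<lambda>t. infdist (z t) (primal_dual_solutions UNIV f g)) \<longlongrightarrow> 0) at_top)"
proof -
  interpret saddle_problem f g \<rho> zs
    using assms by unfold_locales auto
  show ?thesis
    using largest_invariant_subset_eq_equilibria[OF assms(8)] trajectory_converges[OF assms(8)] by blast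
qed

end
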